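(* Let $X=(X,\mu_X,d_X)$ and $Y=(Y,\mu_Y,d_Y)$ be qmm-spaces. Then $\tau(X)=\tau(Y)$ if and only if $\underline{\square}_1(X,Y)=0$. In fact, if $\tau(X)=\tau(Y)$, then there exist $\Psi_1\in MPM(X)$ and $\Psi_2\in MPM(Y)$ such that $(\Psi_1)^{-1}(d_X)=(\Psi_2)^{-1}(d_Y)$.
   Context: $\mathcal{P}[0,1]$ is the space of Borel probability measures on $[0,1]$, and $\delta_t$ is the point mass at $t$. A qmm-space (quantum metric measure space) is a triple $(X,\mu,d^* )$ where $X$ is a standard Borel space, $\mu$ is a probability measure on $X$ and $d^*:X\times X\to\mathcal{P}[0,1]$ is a Borel measurable function with $d^*(x,x)=\delta_0$ and $d^*(x,y)=d^*(y,x)$, satisfying the following condition. For a triple of different points $a,b,c$ pick independent random lengths $l(a,b),l(b,c),l(a,c)$ using the probability measures $d^*(a,b),d^*(b,c),d^*(a,c)$; it is required that for $\mu$-almost all such triples the random lengths satisfy the triangle inequality. In the notation $(X,\mu_X,d_X)$ the function $d_X$ is this $\mathcal{P}[0,1]$-valued function. $M_\infty$ is the compact space of infinite real matrices $(d_{i,j})_{i,j\ge 1}$ with $0\le d_{i,j}\le 1$, $d_{i,j}=d_{j,i}$, $d_{i,i}=0$. For a qmm-space $(X,\mu,d^* )$, $\tau(X)$ is the probability measure on $M_\infty$ obtained as follows: each sequence $(x_1,x_2,\dots)\in X^{\mathbb{N}}$ gives the matrix of measures $(d^*(x_i,x_j))_{i,j}$, which defines a probability measure on $M_\infty$ (the entries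 $d_{i,j}$, $i<j$, being chosen independently with laws $d^*(x_i,x_j)$); $\tau(X)$ is the barycenter (average) of these measures with respect to $\mu\times\mu\times\cdots$. $MPM(X)$ is the set of measure preserving maps $\Psi:([0,1],\lambda)\to(X,\mu_X)$, where $\lambda$ is Lebesgue measure; $\Psi^{-1}(d_X)$ denotes the pulled-back function $(s,t)\mapsto d_X(\Psi(s),\Psi(t))$ on $[0,1]^2$. For $\mu,\nu\in\mathcal{P}[0,1]$, $d_{ext}(\mu,\nu)=\sup_f|\int_0^1 f\,d\mu-\int_0^1 f\,d\nu|$ over all $1$-Lipschitz $f:[0,1]\to\mathbb{R}$. For $\mathcal{P}[0,1]$-valued weak-$*$-measurable functions $f,g$ on $[0,1]^2$, $\square_1(f,g)$ is the infimal $\epsilon$ such that $f$ and $g$ are $\epsilon$-close in the $d_{ext}$-distance outside a subset $X_\epsilon\subset[0,1]$ of measure at most $\epsilon$, that is, $d_{ext}(f(x,y),g(x,y))\le\epsilon$ for $(x,y)\in([0,1]\setminus X_\epsilon)\times([0,1]\setminus X_\epsilon)$. Finally $$\underline{\square}_1(X,Y)=\inf_{\Psi_1\in MPM(X),\,\Psi_2\in MPM(Y)}\square_1\big((\Psi_1)^{-1}(d_X),(\Psi_2)^{-1}(d_Y)\big).$$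
   Formalization: Equality of the pullbacks and the ε-closeness in □₁ are required for almost every (x,y) in [0,1]² rather than every one; pointwise the claim fails (d=δ₁ off the diagonal versus δ_{1/2} at nonzero rational differences on [0,1]). *)

theory Defs
  imports "HOL-Probability.Probability"
begin

definition borel_of :: "'a topology \<Rightarrow> 'a measure" where
  "borel_of T = sigma (topspace T) {U. openin T U}"

definition standard_borel :: "'a measure \<Rightarrow> bool" where
  "standard_borel M \<longleftrightarrow>
     (\<exists>T. completely_metrizable_space T \<and> second_countable T \<and> sets M = sets (borel_of T))"

definition I01 :: "real measure" where
  "I01 = restrict_space borel {0..1}"

definition lambda01 :: "real measure" where
  "lambda01 = restrict_space lborel {0..1}"

text \<open>The weak-* topology on the set of Borel probability measures on the unit interval
  (the carrier is the part \<open>U = UNIV\<close> of the subbase), and its Borel sigma-algebra.\<close>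

definition weak_star_topology :: "real measure topology" where
  "weak_star_topology = topology_generated_by
     {{p \<in> space (prob_algebra I01). (\<integral>x. f x \<partial>p) \<in> U} | (f :: real \<Rightarrow> real) U.
        continuous_on {0..1} f \<and> open U}"

definition P01 :: "real measure measure" where
  "P01 = borel_of weak_star_topology"

locale qmm_space = prob_space \<mu> for \<mu> :: "'a measure" +
  fixes d :: "'a \<Rightarrow> 'a \<Rightarrow> real measure"
  assumes standard_borel: "standard_borel \<mu>"
    and measurable_d: "(\<lambda>(x, y). d x y) \<in> \<mu> \<Otimes>\<^sub>M \<mu> \<rightarrow>\<^sub>M P01"
    and d_refl: "x \<in> space \<mu> \<Longrightarrow> d x x = return I01 0"
    and d_sym: "x \<in> space \<mu> \<Longrightarrow> y \<in> space \<mu> \<Longrightarrow> d x y = d y x"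
    and triangle:
      "AE (a, b, c) in \<mu> \<Otimes>\<^sub>M \<mu> \<Otimes>\<^sub>M \<mu>. a \<noteq> b \<and> b \<noteq> c \<and> a \<noteq> c \<longrightarrow>
         (AE (l_ab, l_bc, l_ac) in d a b \<Otimes>\<^sub>M d b c \<Otimes>\<^sub>M d a c.
            l_ab \<le> l_bc + l_ac \<and> l_bc \<le> l_ab + l_ac \<and> l_ac \<le> l_ab + l_bc)"

text \<open>Matrix indices start at \<open>0\<close>. The Borel sets of the function type
  \<open>nat \<Rightarrow> nat \<Rightarrow> real\<close> are those of the product topology.\<close>

definition M_inf :: "(nat \<Rightarrow> nat \<Rightarrow> real) measure" where
  "M_inf = restrict_space borel
     {D. \<forall>i j. 0 \<le> D i j \<and> D i j \<le> 1 \<and> D i j = D j i \<and> D i i = 0}"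

definition symmetric_matrix :: "(nat \<times> nat \<Rightarrow> real) \<Rightarrow> nat \<Rightarrow> nat \<Rightarrow> real" where
  "symmetric_matrix e = (\<lambda>i j. if i < j then e (i, j) else if j < i then e (j, i) else 0)"

definition random_matrix ::
    "('a \<Rightarrow> 'a \<Rightarrow> real measure) \<Rightarrow> (nat \<Rightarrow> 'a) \<Rightarrow> (nat \<Rightarrow> nat \<Rightarrow> real) measure" where
  "random_matrix d x =
     distr (PiM {(i, j). i < j} (\<lambda>(i, j). d (x i) (x j))) M_inf symmetric_matrix"

text \<open>The barycenter of a random probability measure is its monadic bind:
  \<open>tau \<mu> d\<close> assigns to \<open>A\<close> the integral of \<open>emeasure (random_matrix d x) A\<close>
  over the i.i.d. sequences \<open>x\<close>.\<close>

definition tau :: "'a measure \<Rightarrow> ('a \<Rightarrow> 'a \<Rightarrow> real measure) \<Rightarrow> (nat \<Rightarrow> nat \<Rightarrow> real) measure" where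
  "tau \<mu> d = bind (PiM UNIV (\<lambda>_. \<mu>)) (random_matrix d)"

definition MPM :: "'a measure \<Rightarrow> (real \<Rightarrow> 'a) set" where
  "MPM \<mu> = {\<Psi>. \<Psi> \<in> lambda01 \<rightarrow>\<^sub>M \<mu> \<and> distr lambda01 \<mu> \<Psi> = \<mu>}"

definition pullback ::
    "(real \<Rightarrow> 'a) \<Rightarrow> ('a \<Rightarrow> 'a \<Rightarrow> real measure) \<Rightarrow> real \<Rightarrow> real \<Rightarrow> real measure" where
  "pullback \<Psi> d = (\<lambda>s t. d (\<Psi> s) (\<Psi> t))"

definition d_ext :: "real measure \<Rightarrow> real measure \<Rightarrow> real" where
  "d_ext p q = (SUP f \<in> {f :: real \<Rightarrow> real. 1-lipschitz_on {0..1} f}.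
     \<bar>(\<integral>x. f x \<partial>p) - (\<integral>x. f x \<partial>q)\<bar>)"

text \<open>Functions on the unit square are taken modulo null sets of the two-dimensional Lebesgue
  measure, so closeness off the exceptional set is required almost everywhere only. This is
  essential: \<open>tau\<close> does not see the values of \<open>d\<close> on a null set of pairs. For instance, let
  \<open>d x y\<close> on \<open>{0..1}\<close> be the point mass at \<open>1\<close> for all \<open>x \<noteq> y\<close>, or alternatively the point mass
  at \<open>1/2\<close> if \<open>x - y\<close> is rational and nonzero; both have the same \<open>tau\<close>, but every set of
  positive measure contains distinct points with rational difference.\<close>

definition box1 ::
    "(real \<Rightarrow> real \<Rightarrow> real measure) \<Rightarrow> (real \<Rightarrow> real \<Rightarrow> real measure) \<Rightarrow> real" where
  "box1 f g = Inf {\<epsilon>. \<exists>E \<in> sets lambda01. measure lambda01 E \<le> \<epsilon> \<and>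
     (AE (x, y) in lambda01 \<Otimes>\<^sub>M lambda01. x \<notin> E \<and> y \<notin> E \<longrightarrow> d_ext (f x y) (g x y) \<le> \<epsilon>)}"

text \<open>For standard Borel probability spaces the index set is nonempty, and \<open>box1\<close> takes values
  in \<open>{0..1}\<close>.\<close>

definition underline_box1 ::
    "'a measure \<Rightarrow> ('a \<Rightarrow> 'a \<Rightarrow> real measure) \<Rightarrow> 'b measure \<Rightarrow> ('b \<Rightarrow> 'b \<Rightarrow> real measure) \<Rightarrow> real"
  where
  "underline_box1 \<mu> d \<nu> d' =
     (INF (\<Psi>\<^sub>1, \<Psi>\<^sub>2) \<in> MPM \<mu> \<times> MPM \<nu>. box1 (pullback \<Psi>\<^sub>1 d) (pullback \<Psi>\<^sub>2 d'))"

end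

theory Submission
  imports Defs
begin

text \<open>
  Write \<open>w t x y\<close> for the mass that \<open>d x y\<close> gives to \<open>{0..t}\<close>.

  Suppose that both spaces have the same \<open>tau\<close>. Given the sample \<open>x\<close>, the centred indicators
  \<open>of_bool (D i j \<le> t) - w t (x i) (x j)\<close> are independent over the pairs \<open>i < j\<close>, so the expected
  sum of their products around closed walks of length 4 is of order \<open>n\<^sup>3\<close> instead of \<open>n\<^sup>4\<close>. By
  Cauchy-Schwarz, with high probability this noise is negligible in every bilinear form with bounded weights.
  Since the laws of the matrices agree, there is one matrix \<open>D\<close> which is typical for a sample \<open>x\<close>
  of the first space and for a sample \<open>y\<close> of the second. Hence \<open>w t (x i) (x j)\<close> and the corresponding
  values at \<open>y\<close> are close in cut norm. Encode points by bit sequences and let \<open>\<kappa>\<close> be a limit of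
  the empirical measures of the pairs \<open>(x i, y i)\<close>. It is a coupling of the two measures, and the
  difference of the two kernels is orthogonal in \<open>\<kappa> \<Otimes>\<^sub>M \<kappa>\<close> to all products of cylinder functions, so it
  vanishes almost everywhere. Nested intervals realize \<open>\<kappa>\<close> as an image of Lebesgue measure.

  Conversely, the probability under \<open>tau\<close> of a box of matrices is a limit of integrals of
  products of Lipschitz functions of the entries, and such integrals depend continuously on the
  pulled back kernels with respect to \<open>box1\<close>.
\<close>

section \<open>Laws on the unit interval\<close>

text \<open>Measure-valued kernels are reduced to the countably many real kernels \<open>w t\<close>
  with rational \<open>t\<close>. Thresholding also makes the data Boolean: whether a sample fits a
  matrix depends on finitely many bits of the matrix, which settles the measurability of the set of
  matrices without a fitting sample.

  The obstacle is that empirical measures converge only against functions of finitely many bits,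
  whereas \<open>w t\<close> is merely measurable. Each \<open>w t\<close> is therefore replaced by
  step functions on prefixes, with the error controlled twice: in mean on the limit coupling, and on
  average along the finite samples. The second control does not follow from the limit, so it is
  built into typicality. Moreover \<open>y\<close> is selected through \<open>D\<close>, so weights
  that depend on the pairs \<open>(x i, y i)\<close> are correlated with the noise; a bound uniform
  over all weights survives this.

  The diagonal needs separate care: \<open>(x i, x i)\<close> does not have the product law, yet the
  double empirical average factorizes only with the diagonal included. Its \<open>n\<close> terms
  vanish after division by \<open>n ^ 2\<close>.\<close>

abbreviation square :: "'a measure \<Rightarrow> ('a \<times> 'a) measure" where
  "square M \<equiv> M \<Otimes>\<^sub>M M"

lemma space_borel_of [simp]: "space (borel_of T) = topspace T"
  by (simp add: borel_of_def space_measure_of_conv)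

lemma sets_borel_of: "sets (borel_of T) = sigma_sets (topspace T) {U. openin T U}"
  unfolding borel_of_def by (rule sets_measure_of) (auto dest: openin_subset)

text \<open>A continuous substitute for the indicator of \<open>{..a}\<close>: it equals 1 up to
  \<open>a\<close> and then decreases with slope \<open>k\<close>. Continuity makes its integral
  weak-* measurable, and the slope bound makes it controllable by \<open>d_ext\<close>.\<close>

definition ramp :: "real \<Rightarrow> real \<Rightarrow> real \<Rightarrow> real" where
  "ramp k a r = max 0 (min 1 (1 - k * (r - a)))"

lemma ramp_bounds: "0 \<le> ramp k a r" "ramp k a r \<le> 1"
  by (auto simp: ramp_def)

lemma continuous_on_ramp: "continuous_on S (ramp k a)"
  unfolding ramp_def[abs_def] by (intro continuous_intros)

lemma borel_measurable_ramp [measurable]: "ramp k a \<in> borel_measurable borel"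
  by (rule borel_measurable_continuous_onI) (rule continuous_on_ramp)

lemma ramp_LIMSEQ: "(\<lambda>n. ramp (real n) a r) \<longlonglongrightarrow> indicator {..a} r"
proof (cases "r \<le> a")
  case True
  then have "1 \<le> 1 - real n * (r - a)" for n
    by (simp add: mult_nonneg_nonpos)
  then have "ramp (real n) a r = 1" for n
    by (simp add: ramp_def min_absorb1)
  then show ?thesis using True by simp
next
  case False
  then obtain m :: nat where m: "1 / (r - a) < real m"
    using reals_Archimedean2 by blast
  have "ramp (real n) a r = 0" if "m \<le> n" for n
  proof -
    have "1 / (r - a) \<le> real n" using m that by linarith
    then have "1 \<le> real n * (r - a)" using False by (simp add: field_simps)
    then show ?thesis by (simp add: ramp_def)
  qed
  then have "eventually (\<lambda>n. ramp (real n) a r = 0) sequentially"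
    by (auto simp: eventually_sequentially)
  then show ?thesis using False by (simp add: tendsto_eventually)
qed

lemma ramp_lipschitz: "0 \<le> k \<Longrightarrow> k-lipschitz_on S (ramp k a)"
proof (rule lipschitz_onI)
  fix x y :: real assume "0 \<le> k"
  then have "\<bar>ramp k a x - ramp k a y\<bar> \<le> \<bar>k * (x - a) - k * (y - a)\<bar>"
    unfolding ramp_def by linarith
  also have "\<dots> = k * \<bar>x - y\<bar>"
    using \<open>0 \<le> k\<close> by (simp add: abs_mult flip: right_diff_distrib)
  finally show "dist (ramp k a x) (ramp k a y) \<le> k * dist x y"
    by (simp add: dist_real_def)
qed

lemma space_I01 [simp]: "space I01 = {0..1}"
  by (simp add: I01_def space_restrict_space)

lemma sets_I01: "sets I01 = (\<inter>) {0..1} ` sets borel"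
  by (simp add: I01_def sets_restrict_space)

lemma measurable_I01: "f \<in> measurable borel M \<Longrightarrow> f \<in> measurable I01 M"
  by (simp add: I01_def measurable_restrict_space1)

lemma Int_sets_I01 [measurable]: "A \<in> sets borel \<Longrightarrow> {0..1} \<inter> A \<in> sets I01"
  by (auto simp: sets_I01)

lemma P_I01D:
  assumes "p \<in> space (prob_algebra I01)"
  shows "prob_space p" "sets p = sets I01" "space p = {0..1}"
  using assms sets_eq_imp_space_eq[of p I01] by (auto simp: space_prob_algebra)

lemma measurable_P_I01:
  assumes p: "p \<in> space (prob_algebra I01)" and f: "f \<in> measurable I01 M"
  shows "f \<in> measurable p M"
  using f P_I01D(2)[OF p] by (subst measurable_cong_sets[of p I01 M M]) auto

lemma integrable_P_I01:
  fixes f :: "real \<Rightarrow> real"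
  assumes p: "p \<in> space (prob_algebra I01)" and f: "f \<in> borel_measurable I01"
    and b: "\<And>x. x \<in> {0..1} \<Longrightarrow> \<bar>f x\<bar> \<le> c"
  shows "integrable p f"
proof -
  interpret prob_space p using p by (rule P_I01D)
  have "f \<in> borel_measurable p" using p f by (rule measurable_P_I01)
  then show ?thesis
    by (intro integrable_const_bound[where B=c]) (auto simp: P_I01D[OF p] b intro!: AE_I2)
qed

text \<open>The intersection with \<open>{0..1}\<close> matters: \<open>{..a}\<close> is not in the
  sigma-algebra of a law on the unit interval, and \<open>measure\<close> would return 0 for
  it.\<close>

definition cdf01 :: "real measure \<Rightarrow> real \<Rightarrow> real" where
  "cdf01 p a = measure p ({0..1} \<inter> {..a})"

lemma cdf01_bounds:
  assumes "p \<in> space (prob_algebra I01)"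
  shows "0 \<le> cdf01 p a" "cdf01 p a \<le> 1"
proof -
  interpret prob_space p using assms by (rule P_I01D)
  show "0 \<le> cdf01 p a" "cdf01 p a \<le> 1" by (auto simp: cdf01_def)
qed

lemma integral_ramp_LIMSEQ:
  assumes p: "p \<in> space (prob_algebra I01)"
  shows "(\<lambda>n. \<integral>x. ramp (real n) a x \<partial>p) \<longlonglongrightarrow> cdf01 p a"
proof -
  interpret prob_space p using p by (rule P_I01D)
  note m = measurable_P_I01[OF p measurable_I01]
  have "(\<lambda>n. \<integral>x. ramp (real n) a x \<partial>p) \<longlonglongrightarrow> (\<integral>x. indicator {..a} x \<partial>p)"
  proof (rule integral_dominated_convergence[where w="\<lambda>_. 1"])
    show "AE x in p. (\<lambda>n. ramp (real n) a x) \<longlonglongrightarrow> indicator {..a} x"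
      by (simp add: ramp_LIMSEQ)
    show "AE x in p. norm (ramp (real n) a x) \<le> 1" for n
      using ramp_bounds by (intro AE_I2) (auto simp: abs_le_iff intro: order_trans[of _ 0])
  qed (auto intro!: m)
  also have "(\<integral>x. indicator {..a} x \<partial>p) = (\<integral>x. indicator ({0..1} \<inter> {..a}) x \<partial>p)"
    by (rule Bochner_Integration.integral_cong) (auto simp: P_I01D[OF p] indicator_def)
  also have "\<dots> = cdf01 p a"
    by (simp add: cdf01_def P_I01D[OF p])
  finally show ?thesis .
qed

lemma sets_I01_generator: "sets I01 = sigma_sets {0..1} (range (\<lambda>a. {0..1} \<inter> {..a}))"
proof -
  have "sets I01 = (\<inter>) {0..1} ` sigma_sets UNIV (range (\<lambda>a::real. {..a}))"
    unfolding sets_I01 by (simp add: borel_eq_atMost)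
  also have "\<dots> = sigma_sets {0..1} ((\<inter>) {0..1} ` range (\<lambda>a::real. {..a}))"
  proof (rule sigma_sets_Int)
    have "{0..1} \<in> sets (borel :: real measure)" by simp
    then show "{0..1} \<in> sigma_sets UNIV (range (\<lambda>a::real. {..a}))"
      by (simp add: borel_eq_atMost)
  qed simp
  finally show ?thesis by (simp add: image_image)
qed

lemma Int_stable_I01_generator: "Int_stable (range (\<lambda>a::real. {0..1} \<inter> {..a}))"
proof (rule Int_stableI)
  fix a b :: "real set" assume "a \<in> range (\<lambda>a. {0..1} \<inter> {..a})" "b \<in> range (\<lambda>a. {0..1} \<inter> {..a})"
  then obtain u v where "a = {0..1} \<inter> {..u}" "b = {0..1} \<inter> {..v}" by auto
  then have "a \<inter> b = {0..1} \<inter> {..min u v}" by auto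
  then show "a \<inter> b \<in> range (\<lambda>a. {0..1} \<inter> {..a})" by blast
qed

text \<open>Right continuity of distribution functions extends the equality from rational to real
  thresholds, and initial segments generate the Borel sets. Countability of the thresholds is the
  point: the null sets belonging to single thresholds can be united.\<close>

lemma P_I01_eqI:
  assumes p: "p \<in> space (prob_algebra I01)" and q: "q \<in> space (prob_algebra I01)"
    and eq: "\<And>t. t \<in> \<rat> \<Longrightarrow> cdf01 p t = cdf01 q t"
  shows "p = q"
proof -
  interpret p: prob_space p using p by (rule P_I01D)
  interpret q: prob_space q using q by (rule P_I01D)
  note P = P_I01D[OF p] and Q = P_I01D[OF q]
  have eq_all: "emeasure p ({0..1} \<inter> {..a}) = emeasure q ({0..1} \<inter> {..a})" for a
  proof -
    \<comment> \<open>The approach is from above, so that the indicators of \<open>{..r n}\<close>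
      stay 1 at \<open>x = a\<close>.\<close>
    have "\<exists>r\<in>\<rat>. a < r \<and> r < a + inverse (real (Suc n))" for n
      using Rats_dense_in_real[of a "a + inverse (real (Suc n))"] by auto
    then obtain r where r: "\<And>n. r n \<in> \<rat>" "\<And>n. a < r n" "\<And>n. r n < a + inverse (real (Suc n))"
      by metis
    have rl: "r \<longlonglongrightarrow> a"
      using r LIMSEQ_inverse_real_of_nat_add[of a]
      by (intro tendsto_sandwich[OF _ _ tendsto_const, of a r sequentially "\<lambda>n. a + inverse (real (Suc n))"])
        (auto intro!: always_eventually less_imp_le)
    have lim: "(\<lambda>n. cdf01 s (r n)) \<longlonglongrightarrow> cdf01 s a" if s: "s \<in> space (prob_algebra I01)" for s
    proof -
      interpret s: prob_space s using s by (rule P_I01D)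
      note m = measurable_P_I01[OF s measurable_I01]
      have "(\<lambda>n. \<integral>x. indicator ({0..1} \<inter> {..r n}) x \<partial>s) \<longlonglongrightarrow> (\<integral>x. indicator ({0..1} \<inter> {..a}) x \<partial>s :: real)"
      proof (rule integral_dominated_convergence[where w="\<lambda>_. 1"])
        show "AE x in s. (\<lambda>n. indicator ({0..1} \<inter> {..r n}) x) \<longlonglongrightarrow> (indicator ({0..1} \<inter> {..a}) x :: real)"
        proof (intro AE_I2)
          fix x
          show "(\<lambda>n. indicator ({0..1} \<inter> {..r n}) x) \<longlonglongrightarrow> (indicator ({0..1} \<inter> {..a}) x :: real)"
          proof (cases "x \<le> a")
            case True
            then have "x \<le> r n" for n using r(2)[of n] by linarith
            then show ?thesis using True by (simp add: indicator_def)
          next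
            case False
            then have "eventually (\<lambda>n. r n < x) sequentially"
              using order_tendstoD(2)[OF rl] by auto
            then show ?thesis using False
              by (intro tendsto_eventually) (auto elim!: eventually_mono simp: indicator_def)
          qed
        qed
      qed (simp_all add: m borel_measurable_indicator P_I01D(2)[OF s] del: Int_atLeastAtMost Int_atMost)
      then show ?thesis by (simp add: cdf01_def P_I01D[OF s] s.emeasure_eq_measure)
    qed
    have "cdf01 p a = cdf01 q a"
      using LIMSEQ_unique[OF lim[OF p]] lim[OF q] eq r(1) by simp
    then show ?thesis by (simp add: cdf01_def p.emeasure_eq_measure q.emeasure_eq_measure)
  qed
  show ?thesis
  proof (rule measure_eqI_generator_eq[where E="range (\<lambda>a. {0..1} \<inter> {..a})" and \<Omega>="{0..1}" and A="\<lambda>_. {0..1}"])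
    show "Int_stable (range (\<lambda>a::real. {0..1} \<inter> {..a}))" by (rule Int_stable_I01_generator)
    show "range (\<lambda>_::nat. {0..1}) \<subseteq> range (\<lambda>a::real. {0..1} \<inter> {..a})"
      by (auto intro!: image_eqI[of _ _ 1])
    show "emeasure p X = emeasure q X" if "X \<in> range (\<lambda>a. {0..1} \<inter> {..a})" for X
      using that by (elim imageE) (simp only: eq_all)
  qed (simp_all only: P Q sets_I01_generator, auto)
qed

section \<open>The weak-* Borel structure on laws\<close>

lemma topspace_weak_star: "topspace weak_star_topology = space (prob_algebra I01)"
proof -
  have "space (prob_algebra I01) \<in> {{p \<in> space (prob_algebra I01). (\<integral>x. f x \<partial>p) \<in> U} | (f :: real \<Rightarrow> real) U.
        continuous_on {0..1} f \<and> open U}"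
    by (intro CollectI exI[of _ "\<lambda>_. 0"] exI[of _ UNIV]) auto
  then show ?thesis
    unfolding weak_star_topology_def topology_generated_by_topspace by blast
qed

lemma space_P01 [simp]: "space P01 = space (prob_algebra I01)"
  by (simp add: P01_def topspace_weak_star)

lemma P01_integral_measurable:
  fixes f :: "real \<Rightarrow> real"
  assumes "continuous_on {0..1} f"
  shows "(\<lambda>p. \<integral>x. f x \<partial>p) \<in> borel_measurable P01"
proof (rule borel_measurableI)
  fix U :: "real set" assume "open U"
  have "openin weak_star_topology {p \<in> space (prob_algebra I01). (\<integral>x. f x \<partial>p) \<in> U}"
    unfolding weak_star_topology_def
    by (rule topology_generated_by_Basis) (use assms \<open>open U\<close> in blast)
  moreover have "(\<lambda>p. \<integral>x. f x \<partial>p) -` U \<inter> space P01 = {p \<in> space (prob_algebra I01). (\<integral>x. f x \<partial>p) \<in> U}"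
    by auto
  ultimately show "(\<lambda>p. \<integral>x. f x \<partial>p) -` U \<inter> space P01 \<in> sets P01"
    unfolding P01_def sets_borel_of by (auto intro: sigma_sets.Basic)
qed

text \<open>Integrals of continuous functions are weak-* continuous, and the mass of an initial
  segment is a limit of integrals of ramps, so evaluations of measures are weak-* Borel. This
  transfers kernels to the Giry setting, where binding and products of kernels are
  available.\<close>

lemma P01_ident_measurable: "(\<lambda>p. p) \<in> P01 \<rightarrow>\<^sub>M prob_algebra I01"
proof (rule measurable_prob_algebra_generated[OF sets_I01_generator])
  show "Int_stable (range (\<lambda>a::real. {0..1} \<inter> {..a}))" by (rule Int_stable_I01_generator)
  fix A assume "A \<in> range (\<lambda>a::real. {0..1} \<inter> {..a})"
  then obtain a where A: "A = {0..1} \<inter> {..a}" by auto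
  have "(\<lambda>p. cdf01 p a) \<in> borel_measurable P01"
    by (rule borel_measurable_LIMSEQ_real[where u="\<lambda>n p. \<integral>x. ramp (real n) a x \<partial>p"])
      (auto intro!: integral_ramp_LIMSEQ P01_integral_measurable continuous_on_ramp)
  then have "(\<lambda>p. ennreal (cdf01 p a)) \<in> borel_measurable P01" by simp
  moreover have "emeasure p A = ennreal (cdf01 p a)" if "p \<in> space P01" for p
    using that P_I01D[of p] unfolding cdf01_def A
    by (intro finite_measure.emeasure_eq_measure) (auto simp: prob_space_def)
  ultimately show "(\<lambda>p. emeasure p A) \<in> borel_measurable P01"
    by (subst measurable_cong[where g="\<lambda>p. ennreal (cdf01 p a)"])
qed (auto dest: P_I01D)

section \<open>Coding standard Borel spaces by bit sequences\<close>

abbreviation Bits :: "(nat \<Rightarrow> bool) measure" where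
  "Bits \<equiv> PiM UNIV (\<lambda>_. count_space UNIV)"

lemma space_Bits [simp]: "space Bits = UNIV"
  by (simp add: space_PiM)

lemma pred_countable2:
  fixes f g :: "'a \<Rightarrow> 'b :: countable"
  assumes f: "f \<in> M \<rightarrow>\<^sub>M count_space UNIV" and g: "g \<in> M \<rightarrow>\<^sub>M count_space UNIV"
  shows "Measurable.pred M (\<lambda>x. P (f x) (g x))"
  by (rule measurable_compose_countable[OF _ f, where f="\<lambda>i x. P i (g x)"],
      rule measurable_compose_countable[OF _ g]) simp

text \<open>The bit with code \<open>(m, i)\<close> of a point records whether its distance to the \<open>i\<close>-th point of a dense
  sequence is less than \<open>1 / (m + 1)\<close>; a point is recovered as the limit over \<open>m\<close> of the first dense
  point whose bit is set.\<close>

lemma standard_borel_bits: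
  fixes M :: "'a measure"
  assumes "standard_borel M" "space M \<noteq> {}"
  obtains e :: "'a \<Rightarrow> nat \<Rightarrow> bool" and g
  where "e \<in> M \<rightarrow>\<^sub>M Bits" "g \<in> Bits \<rightarrow>\<^sub>M M" "\<And>x. x \<in> space M \<Longrightarrow> g (e x) = x"
proof -
  obtain T where T: "completely_metrizable_space T" "second_countable T" and sM: "sets M = sets (borel_of T)"
    using assms(1) unfolding standard_borel_def by blast
  obtain S d where "Metric_space S d" and compl: "Metric_space.mcomplete S d" and TS: "T = Metric_space.mtopology S d"
    using T(1) unfolding completely_metrizable_space_def by blast
  interpret Metric_space S d by fact
  have topT [simp]: "topspace T = S" by (simp add: TS)
  have spM: "space M = S" using sets_eq_imp_space_eq[OF sM] by simp
  obtain C where C: "countable C" "C \<subseteq> S" "T closure_of C = S"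
    using second_countable_imp_separable_space[OF T(2)] by (auto simp: separable_space_def)
  obtain x0 where x0: "x0 \<in> S" using assms(2) spM by auto
  have "C \<noteq> {}" using C(3) x0 by auto
  define q where "q = from_nat_into C"
  have rq: "range q = C" unfolding q_def using C(1) \<open>C \<noteq> {}\<close> by (rule range_from_nat_into[OF _ _, rotated])
  have qS [simp]: "q i \<in> S" for i using rq C(2) by blast
  define eps where "eps = (\<lambda>m. inverse (real (Suc m)))"
  have eps_pos [simp]: "0 < eps m" for m by (simp add: eps_def)
  have eps_small: "\<exists>m. eps m < r" if "0 < r" for r
    using reals_Archimedean[OF that] by (simp add: eps_def)
  have eps_mono: "eps n \<le> eps m" if "m \<le> n" for m n
    using that by (simp add: eps_def)
  have dense: "\<exists>i. d x (q i) < eps m" if "x \<in> S" for x m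
  proof -
    have "x \<in> T closure_of C" using C(3) that by simp
    then obtain y where "y \<in> C" "y \<in> mball x (eps m)"
      unfolding TS metric_closure_of by (auto dest!: spec[of _ "eps m"])
    then show ?thesis using rq by (auto simp: in_mball)
  qed
  define e where "e = (\<lambda>x n. d x (q (snd (prod_decode n))) < eps (fst (prod_decode n)))"
  \<comment> \<open>If no bit of row \<open>m\<close> is set, \<open>LEAST\<close> is an unspecified
    number; \<open>q\<close> still maps it into \<open>S\<close>, so \<open>s b\<close> is a
    sequence in \<open>S\<close> for every \<open>b\<close>.\<close>
  define idx where "idx = (\<lambda>(b :: nat \<Rightarrow> bool) m. LEAST i. b (prod_encode (m, i)))"
  define s where "s = (\<lambda>b m. q (idx b m))"
  \<comment> \<open>Bit sequences for which \<open>s b\<close> is not Cauchy are sent to the default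
    \<open>x0\<close>; thus \<open>g\<close> takes values in \<open>S\<close> everywhere.\<close>
  define g where "g = (\<lambda>b. if MCauchy (s b) then (SOME x. limitin T (s b) x sequentially) else x0)"
  have idx_e: "d x (s (e x) m) < eps m" if "x \<in> S" for x m
    unfolding s_def idx_def using LeastI_ex[of "\<lambda>i. e x (prod_encode (m, i))"] dense[OF that, of m]
    by (simp add: e_def)
  have g_lim: "limitin T (s b) (g b) sequentially" if "MCauchy (s b)" for b
  proof -
    have "\<exists>x. limitin T (s b) x sequentially"
      using compl that unfolding mcomplete_def TS by blast
    then have "limitin T (s b) (SOME x. limitin T (s b) x sequentially) sequentially"
      by (rule someI_ex)
    then show ?thesis using that by (simp add: g_def)
  qed
  have lim_d: "\<exists>N. \<forall>m\<ge>N. d (s b m) (g b) < r" if "MCauchy (s b)" "0 < r" for b r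
    using g_lim[OF that(1)] that(2) unfolding TS limitin_metric eventually_sequentially by metis
  have gS: "g b \<in> S" for b
  proof (cases "MCauchy (s b)")
    case True
    then show ?thesis using g_lim[OF True] by (auto simp: TS limitin_metric)
  qed (simp add: g_def x0)
  \<comment> \<open>Radii \<open>eps k\<close> instead of all positive reals turn the Cauchy
    property into a countable combination of conditions on two indices, which is measurable.\<close>
  have MC: "MCauchy (s b) \<longleftrightarrow> (\<forall>k. \<exists>N. \<forall>n\<ge>N. \<forall>n'\<ge>N. d (s b n) (s b n') < eps k)" for b
  proof
    assume "MCauchy (s b)"
    then have *: "\<exists>N. \<forall>n n'. N \<le> n \<longrightarrow> N \<le> n' \<longrightarrow> d (s b n) (s b n') < eps k" for k
      unfolding MCauchy_def by simp
    show "\<forall>k. \<exists>N. \<forall>n\<ge>N. \<forall>n'\<ge>N. d (s b n) (s b n') < eps k"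
    proof
      fix k
      obtain N where "\<forall>n n'. N \<le> n \<longrightarrow> N \<le> n' \<longrightarrow> d (s b n) (s b n') < eps k" using * by blast
      then show "\<exists>N. \<forall>n\<ge>N. \<forall>n'\<ge>N. d (s b n) (s b n') < eps k" by (intro exI[of _ N]) simp
    qed
  next
    assume *: "\<forall>k. \<exists>N. \<forall>n\<ge>N. \<forall>n'\<ge>N. d (s b n) (s b n') < eps k"
    show "MCauchy (s b)" unfolding MCauchy_def
    proof (intro conjI allI impI)
      show "range (s b) \<subseteq> S" by (auto simp: s_def)
      fix r :: real assume "0 < r"
      then obtain k where k: "eps k < r" using eps_small by blast
      obtain N where N: "\<forall>n\<ge>N. \<forall>n'\<ge>N. d (s b n) (s b n') < eps k" using * by blast
      show "\<exists>N. \<forall>n n'. N \<le> n \<longrightarrow> N \<le> n' \<longrightarrow> d (s b n) (s b n') < r"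
      proof (intro exI[of _ N] allI impI)
        fix n n' assume "N \<le> n" "N \<le> n'"
        then show "d (s b n) (s b n') < r" using N k by (meson order_less_trans)
      qed
    qed
  qed
  have idx_meas: "(\<lambda>b. idx b m) \<in> Bits \<rightarrow>\<^sub>M count_space UNIV" for m
    unfolding idx_def by measurable
  have MC_meas: "Measurable.pred Bits (\<lambda>b. MCauchy (s b))"
    unfolding MC unfolding s_def
    by (intro pred_intros_countable pred_intros_logic pred_countable2[OF idx_meas idx_meas]) 
  \<comment> \<open>Membership of the limit in an open set has to be expressed by the indices alone.
    The radius must be the same for all late terms: otherwise a sequence inside \<open>U\<close>
    could converge to a boundary point.\<close>
  have inU: "g b \<in> U \<longleftrightarrow> (\<exists>k N. \<forall>m\<ge>N. mball (s b m) (eps k) \<subseteq> U)"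
    if b: "MCauchy (s b)" and U: "openin T U" for b U
  proof
    assume "g b \<in> U"
    then obtain r where r: "0 < r" "mball (g b) r \<subseteq> U"
      using U unfolding TS openin_mtopology by blast
    obtain k where k: "eps k < r / 2" using eps_small[of "r/2"] r by auto
    obtain N where N: "\<forall>m\<ge>N. d (s b m) (g b) < r / 2" using lim_d[OF b, of "r/2"] r by auto
    have "mball (s b m) (eps k) \<subseteq> U" if "N \<le> m" for m
    proof
      fix y assume "y \<in> mball (s b m) (eps k)"
      then have y: "y \<in> S" "d (s b m) y < eps k" by (auto simp: in_mball)
      have "d (g b) y \<le> d (s b m) (g b) + d (s b m) y"
        using triangle[of "g b" "s b m" y] y gS commute[of "g b" "s b m"] by (simp add: s_def)
      also have "\<dots> < r" using N that y k by fastforce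
      finally show "y \<in> U" using r y gS by (auto simp: in_mball)
    qed
    then show "\<exists>k N. \<forall>m\<ge>N. mball (s b m) (eps k) \<subseteq> U" by blast
  next
    assume "\<exists>k N. \<forall>m\<ge>N. mball (s b m) (eps k) \<subseteq> U"
    then obtain k N where kN: "\<forall>m\<ge>N. mball (s b m) (eps k) \<subseteq> U" by blast
    obtain N' where "\<forall>m\<ge>N'. d (s b m) (g b) < eps k" using lim_d[OF b, of "eps k"] by auto
    then have "g b \<in> mball (s b (max N N')) (eps k)" by (auto simp: in_mball gS s_def)
    then show "g b \<in> U" using kN by (meson max.cobounded1 subsetD)
  qed
  have g_meas: "g \<in> Bits \<rightarrow>\<^sub>M borel_of T"
    unfolding borel_of_def
  proof (rule measurable_measure_of)
    fix U assume "U \<in> {U. openin T U}"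
    then have U: "openin T U" by simp
    have "Measurable.pred Bits (\<lambda>b. g b \<in> U)"
    proof -
      have eq: "(\<lambda>b. g b \<in> U) = (\<lambda>b. (MCauchy (s b) \<and> (\<exists>k N. \<forall>m\<ge>N. mball (q (idx b m)) (eps k) \<subseteq> U)) \<or>
          (\<not> MCauchy (s b) \<and> x0 \<in> U))"
        using inU[OF _ U] by (auto simp: fun_eq_iff s_def g_def)
      show ?thesis unfolding eq
        by (intro pred_intros_countable pred_intros_logic MC_meas pred_countable2[OF idx_meas idx_meas, where P="\<lambda>i _. _ i"])
    qed
    then show "g -` U \<inter> space Bits \<in> sets Bits" by (simp add: pred_def vimage_def)
  qed (use openin_subset[of T] in \<open>auto simp: gS\<close>)
  have "e \<in> borel_of T \<rightarrow>\<^sub>M Bits"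
  proof (rule measurable_PiM_single')
    fix n
    have "{x \<in> S. e x n} = mball (q (snd (prod_decode n))) (eps (fst (prod_decode n)))"
      by (auto simp: e_def in_mball commute)
    then have "{x \<in> S. e x n} \<in> sets (borel_of T)"
      unfolding sets_borel_of using openin_mball TS by (auto intro!: sigma_sets.Basic)
    then show "(\<lambda>x. e x n) \<in> borel_of T \<rightarrow>\<^sub>M count_space UNIV"
      by (simp add: pred_def)
  qed simp
  then have e_meas: "e \<in> M \<rightarrow>\<^sub>M Bits"
    by (subst measurable_cong_sets[OF sM refl])
  have g_meas': "g \<in> Bits \<rightarrow>\<^sub>M M"
    using g_meas by (subst measurable_cong_sets[OF refl sM])
  have "g (e x) = x" if "x \<in> space M" for x
  proof -
    have x: "x \<in> S" using that spM by simp
    have "limitin T (s (e x)) x sequentially"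
      unfolding TS limitin_metric
    proof (intro conjI allI impI x)
      fix r :: real assume "0 < r"
      then obtain k where k: "eps k < r" using eps_small by blast
      show "\<forall>\<^sub>F n in sequentially. s (e x) n \<in> S \<and> d (s (e x) n) x < r"
        unfolding eventually_sequentially
      proof (intro exI[of _ k] allI impI conjI)
        fix n assume "k \<le> n"
        then show "d (s (e x) n) x < r"
          using idx_e[OF x, of n] eps_mono[of k n] k commute[of x "s (e x) n"] by simp
      qed (simp add: s_def)
    qed
    moreover from this have "MCauchy (s (e x))"
      unfolding TS by (intro convergent_imp_MCauchy) (auto simp: s_def)
    ultimately show ?thesis
      using g_lim[of "e x"] limitin_metric_unique[of "s (e x)"] by (auto simp: TS)
  qed
  then show thesis using that e_meas g_meas' by blast
qed

section \<open>Random matrices and their noise\<close>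

text \<open>Residual of a Boolean matrix \<open>A\<close> against its conditional probabilities
  \<open>W\<close>. It is zero on the diagonal because diagonal entries are not sampled.\<close>

definition resid :: "(nat \<Rightarrow> nat \<Rightarrow> bool) \<Rightarrow> (nat \<Rightarrow> nat \<Rightarrow> real) \<Rightarrow> nat \<Rightarrow> nat \<Rightarrow> real" where
  "resid A W i j = (if i = j then 0 else of_bool (A i j) - W i j)"

text \<open>Expanding the square yields the sum over closed walks of length 4. For the leading
  \<open>n\<close> by \<open>n\<close> block this is the trace of \<open>(E E^T)^2\<close>, the
  fourth power of the Schatten 4-norm.\<close>

definition C4 :: "(nat \<Rightarrow> nat \<Rightarrow> real) \<Rightarrow> nat \<Rightarrow> real" where
  "C4 E n = (\<Sum>i<n. \<Sum>i'<n. (\<Sum>j<n. E i j * E i' j)\<^sup>2)"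

lemma C4_nonneg: "0 \<le> C4 E n"
  by (simp add: C4_def sum_nonneg)

text \<open>Uniformity in \<open>a\<close> and \<open>b\<close> matters: these weights may depend on the matrix entries.\<close>

lemma bilinear_le_C4:
  fixes E :: "nat \<Rightarrow> nat \<Rightarrow> real"
  assumes a: "\<And>i. \<bar>a i\<bar> \<le> 1" and b: "\<And>j. \<bar>b j\<bar> \<le> 1"
  shows "(\<Sum>i<n. \<Sum>j<n. E i j * a i * b j) ^ 4 \<le> real n ^ 4 * C4 E n"
proof -
  have sq1: "(x::real)\<^sup>2 \<le> 1" if "\<bar>x\<bar> \<le> 1" for x
    using that by (simp add: abs_square_le_1)
  define v where "v j = (\<Sum>i<n. E i j * a i)" for j
  define u where "u p = (\<Sum>j<n. E (fst p) j * E (snd p) j)" for p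
  define I where "I = {..<n} \<times> {..<n}"
  have "(\<Sum>i<n. \<Sum>j<n. E i j * a i * b j) = (\<Sum>j<n. b j * v j)"
    unfolding v_def by (subst sum.swap) (simp add: sum_distrib_left mult_ac)
  \<comment> \<open>Cauchy-Schwarz in the column index removes \<open>b\<close>. Expanding the
    square then doubles the row index, and a second application over pairs of rows removes
    \<open>a\<close>.\<close>
  then have "(\<Sum>i<n. \<Sum>j<n. E i j * a i * b j)\<^sup>2 \<le> (\<Sum>j<n. (b j)\<^sup>2) * (\<Sum>j<n. (v j)\<^sup>2)"
    using Cauchy_Schwarz_ineq_sum[of b v "{..<n}"] by simp
  also have "\<dots> \<le> real n * (\<Sum>j<n. (v j)\<^sup>2)"
    using sum_mono[of "{..<n}" "\<lambda>j. (b j)\<^sup>2" "\<lambda>_. 1"] sq1[OF b]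
    by (intro mult_right_mono) (auto intro: sum_nonneg)
  finally have s2: "(\<Sum>i<n. \<Sum>j<n. E i j * a i * b j)\<^sup>2 \<le> real n * (\<Sum>j<n. (v j)\<^sup>2)" .
  have "(\<Sum>j<n. (v j)\<^sup>2) = (\<Sum>j<n. \<Sum>i<n. \<Sum>i'<n. (E i j * a i) * (E i' j * a i'))"
    by (simp add: v_def power2_eq_square sum_product)
  also have "\<dots> = (\<Sum>i<n. \<Sum>i'<n. \<Sum>j<n. (E i j * a i) * (E i' j * a i'))"
    by (subst sum.swap, rule sum.cong[OF refl], subst sum.swap, simp)
  also have "\<dots> = (\<Sum>i<n. \<Sum>i'<n. a i * a i' * (\<Sum>j<n. E i j * E i' j))"
    by (simp add: sum_distrib_left mult_ac)
  also have "\<dots> = (\<Sum>p\<in>I. (a (fst p) * a (snd p)) * u p)"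
    by (simp add: u_def I_def sum.cartesian_product split_def)
  finally have T: "(\<Sum>j<n. (v j)\<^sup>2) = (\<Sum>p\<in>I. (a (fst p) * a (snd p)) * u p)" .
  have "(\<Sum>j<n. (v j)\<^sup>2)\<^sup>2 \<le> (\<Sum>p\<in>I. (a (fst p) * a (snd p))\<^sup>2) * (\<Sum>p\<in>I. (u p)\<^sup>2)"
    unfolding T by (rule Cauchy_Schwarz_ineq_sum)
  also have "\<dots> \<le> (real n)\<^sup>2 * (\<Sum>p\<in>I. (u p)\<^sup>2)"
  proof (rule mult_right_mono)
    have "(a i * a j)\<^sup>2 \<le> 1" for i j
      using a[of i] a[of j] by (intro sq1) (simp add: abs_mult mult_le_one)
    then have "(\<Sum>p\<in>I. (a (fst p) * a (snd p))\<^sup>2) \<le> (\<Sum>p\<in>I. 1)"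
      by (intro sum_mono) auto
    also have "\<dots> = (real n)\<^sup>2" by (simp add: I_def power2_eq_square)
    finally show "(\<Sum>p\<in>I. (a (fst p) * a (snd p))\<^sup>2) \<le> (real n)\<^sup>2" .
  qed (simp add: sum_nonneg)
  also have "(\<Sum>p\<in>I. (u p)\<^sup>2) = C4 E n"
    by (simp add: C4_def I_def u_def sum.cartesian_product split_def)
  finally have v2: "(\<Sum>j<n. (v j)\<^sup>2)\<^sup>2 \<le> (real n)\<^sup>2 * C4 E n" .
  have "(\<Sum>i<n. \<Sum>j<n. E i j * a i * b j) ^ 4 = ((\<Sum>i<n. \<Sum>j<n. E i j * a i * b j)\<^sup>2)\<^sup>2"
    by simp
  also have "\<dots> \<le> (real n * (\<Sum>j<n. (v j)\<^sup>2))\<^sup>2"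
    using s2 by (intro power_mono) auto
  also have "\<dots> = (real n)\<^sup>2 * (\<Sum>j<n. (v j)\<^sup>2)\<^sup>2" by (simp add: power_mult_distrib)
  also have "\<dots> \<le> (real n)\<^sup>2 * ((real n)\<^sup>2 * C4 E n)"
    using v2 by (intro mult_left_mono) auto
  also have "\<dots> = real n ^ 4 * C4 E n" by (simp add: power2_eq_square power4_eq_xxxx)
  finally show ?thesis .
qed

text \<open>The integrand sees only the coordinates in \<open>J\<close>, so it lives on a finite
  product, where independence factorizes it.\<close>

lemma (in product_prob_space) integral_PiM_prod:
  fixes f :: "'i \<Rightarrow> 'a \<Rightarrow> real"
  assumes J: "finite J" "J \<subseteq> I" and f: "\<And>i. i \<in> J \<Longrightarrow> integrable (M i) (f i)"
  shows "(\<integral>x. (\<Prod>i\<in>J. f i (x i)) \<partial>PiM I M) = (\<Prod>i\<in>J. integral\<^sup>L (M i) (f i))"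
proof -
  have fm: "f i \<in> borel_measurable (M i)" if "i \<in> J" for i using f[OF that] by simp
  have "(\<Prod>i\<in>J. integral\<^sup>L (M i) (f i)) = (\<integral>x. (\<Prod>i\<in>J. f i (x i)) \<partial>PiM J M)"
    by (rule product_integral_prod[symmetric]) (use J f in auto)
  also have "\<dots> = (\<integral>x. (\<Prod>i\<in>J. f i (x i)) \<partial>distr (PiM I M) (PiM J M) (\<lambda>x. restrict x J))"
    using distr_PiM_restrict_finite[OF J] by simp
  also have "\<dots> = (\<integral>x. (\<Prod>i\<in>J. f i (restrict x J i)) \<partial>PiM I M)"
  proof (rule integral_distr)
    show "(\<lambda>x. restrict x J) \<in> Pi\<^sub>M I M \<rightarrow>\<^sub>M Pi\<^sub>M J M"
      by (rule measurable_restrict_subset[OF J(2)])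
    show "(\<lambda>x. \<Prod>i\<in>J. f i (x i)) \<in> borel_measurable (Pi\<^sub>M J M)"
      by (rule borel_measurable_prod, rule measurable_compose[OF measurable_component_singleton])
        (auto intro: fm)
  qed
  also have "\<dots> = (\<integral>x. (\<Prod>i\<in>J. f i (x i)) \<partial>PiM I M)"
    by (intro Bochner_Integration.integral_cong prod.cong) auto
  finally show ?thesis by simp
qed

lemma (in prob_space) distr_PiM_pair:
  fixes i j :: 'i
  assumes "i \<noteq> j"
  shows "distr (PiM UNIV (\<lambda>_::'i. M)) (square M) (\<lambda>x. (x i, x j)) = square M"
proof -
  interpret P: product_prob_space "\<lambda>_::'i. M" UNIV ..
  have m: "(\<lambda>x. (x i, x j)) \<in> PiM UNIV (\<lambda>_::'i. M) \<rightarrow>\<^sub>M square M" by measurable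
  show ?thesis
  proof (rule pair_measure_eqI[symmetric])
    fix A B assume AB: "A \<in> sets M" "B \<in> sets M"
    have "emeasure (distr (PiM UNIV (\<lambda>_::'i. M)) (square M) (\<lambda>x. (x i, x j))) (A \<times> B) =
      emeasure (PiM UNIV (\<lambda>_::'i. M)) {x \<in> space (PiM UNIV (\<lambda>_::'i. M)). \<forall>k\<in>{i, j}. x k \<in> (if k = i then A else B)}"
      using AB assms by (subst emeasure_distr[OF m]) (auto intro!: arg_cong2[where f=emeasure])
    also have "\<dots> = (\<Prod>k\<in>{i, j}. emeasure M (if k = i then A else B))"
      using AB by (intro P.emeasure_PiM_Collect) auto
    finally show "emeasure M A * emeasure M B =
      emeasure (distr (PiM UNIV (\<lambda>_::'i. M)) (square M) (\<lambda>x. (x i, x j))) (A \<times> B)"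
      using assms by simp
  qed (auto simp: sigma_finite_measure_axioms)
qed

section \<open>The space of distance matrices\<close>

lemma space_M_inf: "space M_inf = {D. \<forall>i j. 0 \<le> D i j \<and> D i j \<le> 1 \<and> D i j = D j i \<and> D i i = 0}"
  by (simp add: M_inf_def space_restrict_space)

lemma M_inf_entry [measurable]: "(\<lambda>D. D i j) \<in> borel_measurable M_inf"
proof -
  have "(\<lambda>D :: nat \<Rightarrow> nat \<Rightarrow> real. D i) \<in> borel_measurable borel"
    by (rule measurable_product_then_coordinatewise) simp
  then have "(\<lambda>D :: nat \<Rightarrow> nat \<Rightarrow> real. D i j) \<in> borel_measurable borel"
    by (rule measurable_product_then_coordinatewise)
  then show ?thesis
    unfolding M_inf_def by (rule measurable_restrict_space1)
qed

lemma measurable_M_infI: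
  assumes "\<And>i j. (\<lambda>x. f x i j) \<in> borel_measurable M" "\<And>x. x \<in> space M \<Longrightarrow> f x \<in> space M_inf"
  shows "f \<in> M \<rightarrow>\<^sub>M M_inf"
proof -
  have "f \<in> borel_measurable M"
    using assms(1) by (intro measurable_coordinatewise_then_product)
  then show ?thesis
    unfolding M_inf_def using assms(2) by (intro measurable_restrict_space2) (auto simp: space_M_inf)
qed

lemma measurable_symmetric_matrix:
  "symmetric_matrix \<in> PiM {(i, j). i < j} (\<lambda>_. I01) \<rightarrow>\<^sub>M M_inf"
proof (rule measurable_M_infI)
  have c: "(\<lambda>x. x p) \<in> borel_measurable (PiM {(i, j). i < j} (\<lambda>_. I01))" if "p \<in> {(i, j). i < j}" for p :: "nat \<times> nat"
    using measurable_compose[OF measurable_component_singleton[OF that, of "\<lambda>_. I01"] measurable_I01[OF measurable_ident_sets[OF refl]]] by simp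
  show "(\<lambda>x. symmetric_matrix x i j) \<in> borel_measurable (PiM {(i, j). i < j} (\<lambda>_. I01))" for i j
    unfolding symmetric_matrix_def by (cases i j rule: linorder_cases) (auto intro!: c)
next
  fix e :: "nat \<times> nat \<Rightarrow> real" assume e: "e \<in> space (PiM {(i, j). i < j} (\<lambda>_. I01))"
  have "0 \<le> e p \<and> e p \<le> 1" if "p \<in> {(i, j). i < j}" for p
    using e PiE_mem[OF _ that, of e "\<lambda>_. {0..1}"] by (simp add: space_PiM)
  then show "symmetric_matrix e \<in> space M_inf"
    unfolding space_M_inf symmetric_matrix_def mem_Collect_eq by (intro allI conjI) auto
qed

text \<open>The setting in which random matrices are analysed. Measurability refers to the Giry
  sigma-algebra, which fits kernels and binds; weak-* Borel kernels enter through
  \<open>P01_ident_measurable\<close>.\<close>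

locale kernel_space = prob_space \<mu> for \<mu> :: "'a measure" +
  fixes d :: "'a \<Rightarrow> 'a \<Rightarrow> real measure"
  assumes measurable_kernel: "(\<lambda>(x, y). d x y) \<in> square \<mu> \<rightarrow>\<^sub>M prob_algebra I01"
    and d_sym: "x \<in> space \<mu> \<Longrightarrow> y \<in> space \<mu> \<Longrightarrow> d x y = d y x"
begin

abbreviation "PX \<equiv> PiM (UNIV :: nat set) (\<lambda>_. \<mu>)"

abbreviation edges :: "(nat \<Rightarrow> 'a) \<Rightarrow> (nat \<times> nat \<Rightarrow> real) measure" where
  "edges x \<equiv> PiM {(i, j). i < j} (\<lambda>(i, j). d (x i) (x j))"

abbreviation W :: "real \<Rightarrow> 'a \<Rightarrow> 'a \<Rightarrow> real" where "W t x y \<equiv> cdf01 (d x y) t"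

sublocale PX: product_prob_space "\<lambda>_. \<mu>" "UNIV :: nat set" ..

lemma kernel_in: "x \<in> space \<mu> \<Longrightarrow> y \<in> space \<mu> \<Longrightarrow> d x y \<in> space (prob_algebra I01)"
  using measurable_space[OF measurable_kernel, of "(x, y)"] by (simp add: space_pair_measure)

lemma space_PX_D: "x \<in> space PX \<Longrightarrow> x i \<in> space \<mu>"
  by (auto simp: space_PiM)

lemma kernel_in_PX: "x \<in> space PX \<Longrightarrow> d (x i) (x j) \<in> space (prob_algebra I01)"
  by (intro kernel_in space_PX_D)

lemma W_measurable: "(\<lambda>(x, y). W t x y) \<in> borel_measurable (square \<mu>)"
proof -
  have "{0..1} \<inter> {..t} \<in> sets I01" by (rule Int_sets_I01) simp
  from measurable_compose[OF measurable_kernel measurable_measure_prob_algebra[OF this]]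
  show ?thesis unfolding cdf01_def split_def .
qed

lemma product_prob_space_edges:
  assumes "x \<in> space PX"
  shows "product_prob_space (\<lambda>(i, j). d (x i) (x j))"
  by (rule product_prob_spaceI) (auto intro: P_I01D kernel_in_PX assms)

text \<open>The mass of a cylinder is a finite product of masses of single entries, each measurable
  in \<open>x\<close>, and cylinders form an intersection-stable generator. This measurability is
  what makes the bind in \<open>tau\<close> the intended average.\<close>

lemma edges_measurable: "edges \<in> PX \<rightarrow>\<^sub>M prob_algebra (PiM {(i, j). i < j} (\<lambda>_. I01))"
proof (rule measurable_prob_algebra_generated[OF sets_PiM Int_stable_prod_algebra prod_algebra_sets_into_space])
  fix x assume x: "x \<in> space PX"
  interpret product_prob_space "\<lambda>(i, j). d (x i) (x j)" using x by (rule product_prob_space_edges)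
  show "prob_space (edges x)" by (intro prob_space_PiM) (auto intro: P_I01D kernel_in_PX x)
  show "sets (edges x) = sets (PiM {(i, j). i < j} (\<lambda>_. I01))"
    by (intro sets_PiM_cong) (auto simp: P_I01D[OF kernel_in_PX[OF x]])
next
  fix A :: "(nat \<times> nat \<Rightarrow> real) set" assume "A \<in> prod_algebra {(i, j). i < j} (\<lambda>_. I01)"
  then obtain J E where A: "A = prod_emb {(i, j). i < j} (\<lambda>_. I01) J (\<Pi>\<^sub>E j\<in>J. E j)"
    and J: "finite J" "J \<subseteq> {(i, j). i < j}" and E: "\<And>i. i \<in> J \<Longrightarrow> E i \<in> sets I01"
    by (elim prod_algebraE) metis
  have "emeasure (edges x) A = (\<Prod>p\<in>J. emeasure (d (x (fst p)) (x (snd p))) (E p))" if x: "x \<in> space PX" for x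
  proof -
    interpret product_prob_space "\<lambda>(i, j). d (x i) (x j)" "{(i, j). i < j}" using x by (rule product_prob_space_edges)
    have "A = prod_emb {(i, j). i < j} (\<lambda>(i, j). d (x i) (x j)) J (\<Pi>\<^sub>E j\<in>J. E j)"
      unfolding A by (auto simp: prod_emb_def P_I01D[OF kernel_in_PX[OF x]] split_def)
    then show ?thesis
      using emeasure_PiM_emb[OF J(2,1), of E] E by (simp add: split_def P_I01D[OF kernel_in_PX[OF x]])
  qed
  moreover have "(\<lambda>x. \<Prod>p\<in>J. emeasure (d (x (fst p)) (x (snd p))) (E p)) \<in> borel_measurable PX"
  proof (rule borel_measurable_prod_ennreal)
    fix p assume "p \<in> J"
    have 1: "(\<lambda>x. (x (fst p), x (snd p))) \<in> PX \<rightarrow>\<^sub>M square \<mu>" by measurable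
    show "(\<lambda>x. emeasure (d (x (fst p)) (x (snd p))) (E p)) \<in> borel_measurable PX"
      using measurable_compose[OF measurable_compose[OF 1 measurable_prob_algebraD[OF measurable_kernel]]
          measurable_emeasure_subprob_algebra[OF E[OF \<open>p \<in> J\<close>]]] by simp
  qed
  ultimately show "(\<lambda>x. emeasure (edges x) A) \<in> borel_measurable PX"
    by (subst measurable_cong[where g="\<lambda>x. \<Prod>p\<in>J. emeasure (d (x (fst p)) (x (snd p))) (E p)"])
qed

lemma sets_edges: "x \<in> space PX \<Longrightarrow> sets (edges x) = sets (PiM {(i, j). i < j} (\<lambda>_. I01))"
  using measurable_space[OF edges_measurable] by (simp add: space_prob_algebra)

lemma symmetric_matrix_edges: "x \<in> space PX \<Longrightarrow> symmetric_matrix \<in> edges x \<rightarrow>\<^sub>M M_inf"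
  by (subst measurable_cong_sets[OF sets_edges refl]) (assumption, rule measurable_symmetric_matrix)

lemma random_matrix_measurable: "random_matrix d \<in> PX \<rightarrow>\<^sub>M prob_algebra M_inf"
  unfolding random_matrix_def[abs_def]
  by (rule measurable_compose[OF edges_measurable measurable_distr_prob_space[OF measurable_symmetric_matrix]])

lemma random_matrix_in: "x \<in> space PX \<Longrightarrow> random_matrix d x \<in> space (prob_algebra M_inf)"
  by (rule measurable_space[OF random_matrix_measurable])

lemma prob_space_random_matrix: "x \<in> space PX \<Longrightarrow> prob_space (random_matrix d x)"
  using random_matrix_in by (simp add: space_prob_algebra)

lemma sets_random_matrix: "sets (random_matrix d x) = sets M_inf"
  by (simp add: random_matrix_def)

lemma space_random_matrix: "space (random_matrix d x) = space M_inf"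
  by (simp add: random_matrix_def)

lemma PX_in: "PX \<in> space (prob_algebra PX)"
  by (simp add: space_prob_algebra PX.prob_space_axioms)

lemma emeasure_tau:
  assumes "A \<in> sets M_inf"
  shows "emeasure (tau \<mu> d) A = (\<integral>\<^sup>+x. emeasure (random_matrix d x) A \<partial>PX)"
  unfolding tau_def by (rule emeasure_bind_prob_algebra[OF PX_in random_matrix_measurable assms])

lemma prob_space_tau: "prob_space (tau \<mu> d)"
  unfolding tau_def by (rule prob_space_bind'[OF PX_in random_matrix_measurable])

lemma sets_tau: "sets (tau \<mu> d) = sets M_inf"
  unfolding tau_def by (rule sets_bind'[OF PX_in random_matrix_measurable])

text \<open>Conditional independence given the sample. Restricting \<open>J\<close> to pairs above
  the diagonal ensures that no entry is used twice under the names \<open>D i j\<close> and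
  \<open>D j i\<close>.\<close>

lemma integral_random_matrix_prod:
  fixes f :: "nat \<times> nat \<Rightarrow> real \<Rightarrow> real"
  assumes x: "x \<in> space PX" and J: "finite J" "J \<subseteq> {(i, j). i < j}"
    and f: "\<And>p. p \<in> J \<Longrightarrow> f p \<in> borel_measurable borel" "\<And>p r. p \<in> J \<Longrightarrow> \<bar>f p r\<bar> \<le> c"
  shows "(\<integral>D. (\<Prod>p\<in>J. f p (D (fst p) (snd p))) \<partial>random_matrix d x) =
    (\<Prod>p\<in>J. \<integral>r. f p r \<partial>d (x (fst p)) (x (snd p)))"
proof -
  interpret product_prob_space "\<lambda>(i, j). d (x i) (x j)" "{(i, j). i < j}"
    using x by (rule product_prob_space_edges)
  have "(\<integral>D. (\<Prod>p\<in>J. f p (D (fst p) (snd p))) \<partial>random_matrix d x) =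
    (\<integral>\<omega>. (\<Prod>p\<in>J. f p (symmetric_matrix \<omega> (fst p) (snd p))) \<partial>edges x)"
    unfolding random_matrix_def
  proof (rule integral_distr[OF symmetric_matrix_edges[OF x]])
    show "(\<lambda>D. \<Prod>p\<in>J. f p (D (fst p) (snd p))) \<in> borel_measurable M_inf"
      by (intro borel_measurable_prod measurable_compose[OF M_inf_entry f(1)])
  qed
  also have "\<dots> = (\<integral>\<omega>. (\<Prod>p\<in>J. f p (\<omega> p)) \<partial>edges x)"
    using J(2) by (intro Bochner_Integration.integral_cong refl prod.cong)
      (auto simp: symmetric_matrix_def)
  also have "\<dots> = (\<Prod>p\<in>J. integral\<^sup>L (case p of (i, j) \<Rightarrow> d (x i) (x j)) (f p))"
    by (rule integral_PiM_prod[OF J])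
      (auto intro!: integrable_P_I01[where c=c] kernel_in_PX x measurable_I01 f)
  finally show ?thesis by (simp add: split_def)
qed

section \<open>Fourth-order noise estimates\<close>

abbreviation noise :: "real \<Rightarrow> (nat \<Rightarrow> 'a) \<Rightarrow> (nat \<Rightarrow> nat \<Rightarrow> real) \<Rightarrow> nat \<Rightarrow> nat \<Rightarrow> real" where
  "noise t x D \<equiv> resid (\<lambda>i j. D i j \<le> t) (\<lambda>i j. W t (x i) (x j))"

lemma noise_bound:
  assumes "x \<in> space PX" shows "\<bar>noise t x D i j\<bar> \<le> 1"
  using cdf01_bounds[OF kernel_in_PX[OF assms], of i j t] by (auto simp: resid_def)

lemma noise_measurable [measurable]: "(\<lambda>D. noise t x D i j) \<in> borel_measurable M_inf"
proof -
  have "Measurable.pred M_inf (\<lambda>D. D i j \<le> t)" by measurable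
  then have "(\<lambda>D. of_bool (D i j \<le> t) :: real) \<in> borel_measurable M_inf" by measurable
  then show ?thesis by (simp add: resid_def)
qed

lemma noise_sym:
  assumes "x \<in> space PX" "D \<in> space M_inf"
  shows "noise t x D i j = noise t x D j i"
proof -
  have "D i j = D j i" using assms(2) by (simp add: space_M_inf)
  moreover have "d (x i) (x j) = d (x j) (x i)"
    using assms(1) by (intro d_sym space_PX_D)
  ultimately show ?thesis unfolding resid_def by simp
qed

text \<open>If a row index equals a column index, a diagonal factor 0 occurs. Otherwise the walk is
  a genuine 4-cycle with four distinct edges, and a product of independent centred factors has mean
  0.\<close>

lemma noise_cycle:
  assumes x: "x \<in> space PX" and ne: "i \<noteq> i'" "j \<noteq> j'"
  shows "(\<integral>D. noise t x D i j * noise t x D i' j * (noise t x D i j' * noise t x D i' j') \<partial>random_matrix d x) = 0"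
proof (cases "j \<in> {i, i'} \<or> j' \<in> {i, i'}")
  case True
  then have "noise t x D i j * noise t x D i' j * (noise t x D i j' * noise t x D i' j') = 0" for D
    by (auto simp: resid_def)
  then have "(\<lambda>D. noise t x D i j * noise t x D i' j * (noise t x D i j' * noise t x D i' j')) = (\<lambda>_. 0)"
    by (intro ext)
  then show ?thesis by (simp only: Bochner_Integration.integral_zero)
next
  case False
  \<comment> \<open>Entries are independent only up to symmetry, so every edge is named by its
    representative above the diagonal.\<close>
  define P where "P a b = (if a < b then (a, b) else (b, a))" for a b :: nat
  define f where "f p r = indicator {..t} r - W t (x (fst p)) (x (snd p))" for p :: "nat \<times> nat" and r :: real
  define J where "J = {P i j, P i' j, P i j', P i' j'}"
  have J: "finite J" "J \<subseteq> {(i, j). i < j}"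
    using False by (auto simp: J_def P_def split: if_splits)
  have fb: "\<bar>f p r\<bar> \<le> 1" for p r
    using cdf01_bounds[OF kernel_in_PX[OF x], of "fst p" "snd p" t] by (auto simp: f_def indicator_def)
  have nP: "noise t x D a b = f (P a b) (D (fst (P a b)) (snd (P a b)))"
    if "a \<noteq> b" "D \<in> space M_inf" for a b D
  proof (cases "a < b")
    case True
    then show ?thesis by (simp add: P_def f_def resid_def indicator_def)
  next
    case False
    then show ?thesis using that(1)
      by (subst noise_sym[OF x that(2)]) (simp add: P_def f_def resid_def indicator_def)
  qed
  have fm: "f p \<in> borel_measurable borel" for p
    unfolding f_def by measurable
  have zero: "(\<integral>r. f p r \<partial>d (x (fst p)) (x (snd p))) = 0" for p
  proof -
    let ?q = "d (x (fst p)) (x (snd p))"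
    have q: "?q \<in> space (prob_algebra I01)" by (rule kernel_in_PX[OF x])
    interpret q: prob_space ?q using q by (rule P_I01D)
    have int: "integrable ?q (indicator {..t} :: real \<Rightarrow> real)"
      by (rule integrable_P_I01[OF q, where c=1]) (auto intro!: measurable_I01)
    have "(\<integral>r. f p r \<partial>?q) = (\<integral>r. indicator {..t} r \<partial>?q) - cdf01 ?q t"
      unfolding f_def using int by (simp add: q.prob_space)
    also have "(\<integral>r. indicator {..t} r \<partial>?q) = (\<integral>r. indicator ({0..1} \<inter> {..t}) r \<partial>?q :: real)"
      by (rule Bochner_Integration.integral_cong) (auto simp: P_I01D[OF q] indicator_def)
    also have "\<dots> = cdf01 ?q t"
      by (simp add: cdf01_def P_I01D[OF q])
    finally show ?thesis by simp
  qed
  have P_eq: "P a b = P a' b' \<longleftrightarrow> a = a' \<and> b = b' \<or> a = b' \<and> b = a'" for a b a' b'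
    unfolding P_def by (cases "a < b"; cases "a' < b'") auto
  have "noise t x D i j * noise t x D i' j * (noise t x D i j' * noise t x D i' j') =
      (\<Prod>p\<in>J. f p (D (fst p) (snd p)))" if "D \<in> space M_inf" for D
  proof -
    have "P i j \<noteq> P i' j" "P i j \<noteq> P i j'" "P i j \<noteq> P i' j'" "P i' j \<noteq> P i j'" "P i' j \<noteq> P i' j'" "P i j' \<noteq> P i' j'"
      using ne False unfolding P_eq by auto
    then have prodJ: "(\<Prod>p\<in>J. g p) = g (P i j) * (g (P i' j) * (g (P i j') * g (P i' j')))" for g :: "nat \<times> nat \<Rightarrow> real"
      unfolding J_def by simp
    have ne4: "i \<noteq> j" "i' \<noteq> j" "i \<noteq> j'" "i' \<noteq> j'" using False by auto
    show ?thesis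
      unfolding prodJ nP[OF ne4(1) that] nP[OF ne4(2) that] nP[OF ne4(3) that] nP[OF ne4(4) that] mult.assoc ..
  qed
  then have "(\<integral>D. noise t x D i j * noise t x D i' j * (noise t x D i j' * noise t x D i' j') \<partial>random_matrix d x) =
      (\<integral>D. (\<Prod>p\<in>J. f p (D (fst p) (snd p))) \<partial>random_matrix d x)"
    by (intro Bochner_Integration.integral_cong) (auto simp: space_random_matrix)
  also have "\<dots> = (\<Prod>p\<in>J. \<integral>r. f p r \<partial>d (x (fst p)) (x (snd p)))"
    by (rule integral_random_matrix_prod[OF x J, where c=1]) (rule fm fb)+
  also have "\<dots> = 0"
    by (rule prod_zero[OF J(1)]) (use zero in \<open>simp_all only: J_def bex_simps, blast\<close>)
  finally show ?thesis .
qed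

text \<open>Only walks with \<open>i = i'\<close> or \<open>j = j'\<close> can have nonzero mean.
  There are at most \<open>2 * n ^ 3\<close> of them, and each contributes at most 1.\<close>

lemma noise_C4:
  assumes x: "x \<in> space PX"
  shows "(\<integral>D. C4 (noise t x D) n \<partial>random_matrix d x) \<le> 2 * real n ^ 3"
proof -
  interpret R: prob_space "random_matrix d x" using x by (rule prob_space_random_matrix)
  note [measurable_cong] = sets_random_matrix
  define g where "g i i' j j' D = noise t x D i j * noise t x D i' j * (noise t x D i j' * noise t x D i' j')" for i i' j j' D
  have gb: "\<bar>g i i' j j' D\<bar> \<le> 1" for i i' j j' D
    unfolding g_def abs_mult using noise_bound[OF x] by (intro mult_le_one) auto
  have gm: "g i i' j j' \<in> borel_measurable (random_matrix d x)" for i i' j j'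
    unfolding g_def by measurable
  have gi: "integrable (random_matrix d x) (g i i' j j')" for i i' j j'
    by (rule R.integrable_const_bound[where B=1]) (auto simp: gb gm)
  have diag: "(\<Sum>k'<n. of_bool (k = k') :: real) = 1" if "k < n" for k
    using that by (simp add: of_bool_def)
  have "(\<integral>D. C4 (noise t x D) n \<partial>random_matrix d x) =
      (\<integral>D. (\<Sum>i<n. \<Sum>i'<n. \<Sum>j<n. \<Sum>j'<n. g i i' j j' D) \<partial>random_matrix d x)"
    by (simp add: C4_def g_def power2_eq_square sum_product)
  also have "\<dots> = (\<Sum>i<n. \<Sum>i'<n. \<Sum>j<n. \<Sum>j'<n. \<integral>D. g i i' j j' D \<partial>random_matrix d x)"
    by (simp add: gi)
  also have "\<dots> \<le> (\<Sum>i<n. \<Sum>i'<n. \<Sum>j<n. \<Sum>j'<n. of_bool (i = i') + of_bool (j = j'))"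
  proof (intro sum_mono)
    fix i i' j j' :: nat
    show "(\<integral>D. g i i' j j' D \<partial>random_matrix d x) \<le> of_bool (i = i') + of_bool (j = j')"
    proof (cases "i \<noteq> i' \<and> j \<noteq> j'")
      case True
      then show ?thesis using noise_cycle[OF x, of i i' j j' t] by (simp add: g_def)
    next
      case False
      have "(\<integral>D. g i i' j j' D \<partial>random_matrix d x) \<le> 1"
        by (intro R.integral_le_const gi AE_I2) (use gb in \<open>auto simp: abs_le_iff\<close>)
      then show ?thesis using False by auto
    qed
  qed
  also have "\<dots> = (\<Sum>i<n. \<Sum>i'<n. (real n)\<^sup>2 * of_bool (i = i') + real n)"
  proof (intro sum.cong refl)
    fix i i' assume "i \<in> {..<n}" "i' \<in> {..<n}"
    have "(\<Sum>j<n. \<Sum>j'<n. of_bool (i = i') + of_bool (j = j') :: real) = (\<Sum>j<n. real n * of_bool (i = i') + 1)"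
      using diag by (intro sum.cong refl) (simp add: sum.distrib)
    then show "(\<Sum>j<n. \<Sum>j'<n. of_bool (i = i') + of_bool (j = j')) = (real n)\<^sup>2 * of_bool (i = i') + real n"
      by (simp add: sum.distrib power2_eq_square algebra_simps)
  qed
  also have "\<dots> = (\<Sum>i<n. (real n)\<^sup>2 * 1 + real n * real n)"
  proof (intro sum.cong refl)
    fix i assume "i \<in> {..<n}"
    then show "(\<Sum>i'<n. (real n)\<^sup>2 * of_bool (i = i') + real n) = (real n)\<^sup>2 * 1 + real n * real n"
      using diag[of i] by (simp add: sum.distrib sum_distrib_left[symmetric])
  qed
  also have "\<dots> = 2 * real n ^ 3"
    by (simp add: power2_eq_square power3_eq_cube)
  finally show ?thesis .
qed

lemma noise_C4_tail:
  assumes x: "x \<in> space PX" and c: "0 < c"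
  shows "measure (random_matrix d x) {D \<in> space M_inf. c < C4 (noise t x D) n} \<le> 2 * real n ^ 3 / c"
proof -
  interpret R: prob_space "random_matrix d x" using x by (rule prob_space_random_matrix)
  note [measurable_cong] = sets_random_matrix
  have m: "(\<lambda>D. C4 (noise t x D) n) \<in> borel_measurable M_inf"
    unfolding C4_def by measurable
  have "\<bar>C4 (noise t x D) n\<bar> \<le> real n ^ 4" for D
  proof -
    have "\<bar>\<Sum>j<n. noise t x D i j * noise t x D i' j\<bar> \<le> (\<Sum>j<n. 1)" for i i'
      using noise_bound[OF x] by (intro order_trans[OF sum_abs] sum_mono) (auto simp: abs_mult intro!: mult_le_one)
    then have "(\<Sum>j<n. noise t x D i j * noise t x D i' j)\<^sup>2 \<le> (real n)\<^sup>2" for i i'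
      by (simp add: abs_le_square_iff[symmetric])
    then have "C4 (noise t x D) n \<le> (\<Sum>i<n. \<Sum>i'<n. (real n)\<^sup>2)"
      unfolding C4_def by (intro sum_mono) auto
    then show ?thesis using C4_nonneg[of "noise t x D" n] by (simp add: power2_eq_square power4_eq_xxxx)
  qed
  then have int: "integrable (random_matrix d x) (\<lambda>D. C4 (noise t x D) n)"
    using m by (intro R.integrable_const_bound[where B="real n ^ 4"]) auto
  have "measure (random_matrix d x) {D \<in> space M_inf. c < C4 (noise t x D) n} \<le>
     measure (random_matrix d x) {D \<in> space (random_matrix d x). c \<le> C4 (noise t x D) n}"
    using m by (intro R.finite_measure_mono) (auto simp: space_random_matrix sets_random_matrix)
  also have "\<dots> \<le> (\<integral>D. C4 (noise t x D) n \<partial>random_matrix d x) / c"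
    using int c by (intro integral_Markov_inequality_measure[where A="space (random_matrix d x)"]) (auto simp: C4_nonneg)
  also have "\<dots> \<le> 2 * real n ^ 3 / c"
    using noise_C4[OF x] c by (intro divide_right_mono) auto
  finally show ?thesis .
qed

end

section \<open>Measures on bit sequences\<close>

definition bits :: "(nat \<Rightarrow> bool) \<Rightarrow> nat \<Rightarrow> bool list" where
  "bits b k = map b [0..<k]"

lemma length_prefix [simp]: "length (bits b k) = k"
  by (simp add: bits_def)

lemma take_prefix: "k \<le> n \<Longrightarrow> take k (bits b n) = bits b k"
  by (simp add: bits_def take_map)

lemma nth_prefix: "n < k \<Longrightarrow> bits b k ! n = b n"
  by (simp add: bits_def)

lemma prefix_Suc: "bits b (Suc k) = bits b k @ [b k]"
  by (simp add: bits_def)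

lemma finite_bool_lists: "finite {s :: bool list. length s = k}"
  using finite_lists_length_eq[of "UNIV :: bool set" k] by simp

lemma Bits_component [measurable]: "(\<lambda>b. b n) \<in> Bits \<rightarrow>\<^sub>M count_space UNIV"
  by (rule measurable_component_singleton) simp

lemma prefix_measurable [measurable]: "(\<lambda>b. bits b k) \<in> Bits \<rightarrow>\<^sub>M count_space UNIV"
proof (induction k)
  case (Suc k)
  show ?case unfolding prefix_Suc
    by (rule measurable_compose_countable[OF _ Suc, where f="\<lambda>s b. s @ [b k]"],
        rule measurable_compose[OF Bits_component]) simp
qed (simp add: bits_def)

text \<open>Left end points of nested intervals of lengths \<open>p s\<close>.\<close>

definition lower :: "(bool list \<Rightarrow> real) \<Rightarrow> bool list \<Rightarrow> real" where
  "lower p s = (\<Sum>k<length s. if s ! k then p (take k s @ [False]) else 0)"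

lemma lower_snoc: "lower p (s @ [b]) = lower p s + (if b then p (s @ [False]) else 0)"
proof -
  have "(\<Sum>k<length s. if (s @ [b]) ! k then p (take k (s @ [b]) @ [False]) else 0) = lower p s"
    unfolding lower_def by (intro sum.cong refl) (simp add: nth_append)
  then show ?thesis by (simp add: lower_def)
qed

text \<open>Address of the interval containing \<open>t\<close>: the split point of an interval is
  the right end of its \<open>False\<close> part.\<close>

primrec walk :: "(bool list \<Rightarrow> real) \<Rightarrow> real \<Rightarrow> nat \<Rightarrow> bool list" where
  "walk p t 0 = []"
| "walk p t (Suc k) = walk p t k @ [lower p (walk p t k) + p (walk p t k @ [False]) \<le> t]"

text \<open>The intervals of each level partition \<open>[0, 1)\<close>. They are half open, so
  words of weight 0 get the empty interval and no point has two addresses.\<close>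

lemma walk_eq_iff:
  assumes p: "p [] = 1" "\<And>s. 0 \<le> p s" "\<And>s. p s = p (s @ [False]) + p (s @ [True])"
    and t: "0 \<le> t" "t < 1"
  shows "walk p t k = s \<longleftrightarrow> length s = k \<and> lower p s \<le> t \<and> t < lower p s + p s"
proof (induction k arbitrary: s)
  case 0
  then show ?case using p(1) t by (auto simp: lower_def)
next
  case (Suc k)
  show ?case
  proof (cases s rule: rev_cases)
    case (snoc s' b)
    then show ?thesis
      using Suc[of s'] p(2)[of "s' @ [False]"] p(2)[of "s' @ [True]"] p(3)[of s']
      by (cases b) (auto simp: lower_snoc)
  qed simp
qed

lemma walk_measurable: "(\<lambda>t. walk p t k) \<in> borel \<rightarrow>\<^sub>M count_space UNIV"
proof (induction k)
  case (Suc k)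
  show ?case unfolding walk.simps
    by (rule measurable_compose_countable[OF _ Suc, where f="\<lambda>s t. s @ [lower p s + p (s @ [False]) \<le> t]"])
      (rule measurable_compose[where N="count_space UNIV" and g="\<lambda>b. _ @ [b]"], measurable)
qed simp

section \<open>Realizing cylinder weights by Lebesgue measure\<close>

lemma space_lambda01 [simp]: "space lambda01 = {0..1}"
  by (simp add: lambda01_def space_restrict_space)

lemma prob_space_lambda01: "prob_space lambda01"
  by (rule prob_spaceI) (simp add: lambda01_def space_restrict_space emeasure_restrict_space)

lemma measurable_lambda01: "f \<in> borel \<rightarrow>\<^sub>M M \<Longrightarrow> f \<in> lambda01 \<rightarrow>\<^sub>M M"
  by (simp add: lambda01_def measurable_restrict_space1)

text \<open>Reading off the address of \<open>t\<close> gives a random bit sequence, and the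
  interval of a word has its weight as length. This yields a measure with given cylinder weights and
  its realization by Lebesgue measure at the same time.\<close>

lemma bits_from_cylinders:
  assumes p: "p [] = 1" "\<And>s. 0 \<le> p s" "\<And>s. p s = p (s @ [False]) + p (s @ [True])"
  obtains \<Psi> :: "real \<Rightarrow> nat \<Rightarrow> bool" where "\<Psi> \<in> lambda01 \<rightarrow>\<^sub>M Bits"
    "\<And>s. measure lambda01 {t \<in> space lambda01. bits (\<Psi> t) (length s) = s} = p s"
proof -
  define \<Psi> where "\<Psi> t k \<longleftrightarrow> lower p (walk p t k) + p (walk p t k @ [False]) \<le> t" for t k
  have pre: "bits (\<Psi> t) k = walk p t k" for t k
    by (induction k) (simp_all add: prefix_Suc \<Psi>_def, simp add: bits_def)
  have m: "\<Psi> \<in> borel \<rightarrow>\<^sub>M Bits"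
  proof (rule measurable_PiM_single')
    fix k
    show "(\<lambda>t. \<Psi> t k) \<in> borel \<rightarrow>\<^sub>M count_space UNIV"
      unfolding \<Psi>_def
      by (rule measurable_compose_countable[OF _ walk_measurable, where f="\<lambda>s t. lower p s + p (s @ [False]) \<le> t"]) measurable
  qed simp
  have "measure lambda01 {t \<in> space lambda01. bits (\<Psi> t) (length s) = s} = p s" for s
  proof -
    have pos: "0 \<le> lower p s" unfolding lower_def using p(2) by (intro sum_nonneg) auto
    have le1: "lower p s + p s \<le> 1"
    proof (induction s rule: rev_induct)
      case (snoc b s)
      then show ?case using p(3)[of s] p(2)[of "s @ [True]"] by (cases b) (auto simp: lower_snoc)
    qed (simp add: lower_def p(1))
    have "{t \<in> {0..1}. walk p t (length s) = s} \<in> sets borel"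
    proof -
      have "(\<lambda>t. walk p t (length s)) -` {s} \<inter> space borel \<in> sets borel"
        by (rule measurable_sets[OF walk_measurable]) simp
      then have "{0..1} \<inter> ((\<lambda>t. walk p t (length s)) -` {s}) \<in> sets borel"
        by (intro sets.Int) auto
      moreover have "{t \<in> {0..1}. walk p t (length s) = s} = {0..1} \<inter> ((\<lambda>t. walk p t (length s)) -` {s})"
        by auto
      ultimately show ?thesis by simp
    qed
    then have "emeasure lborel {t \<in> {0..1}. walk p t (length s) = s} = emeasure lborel {lower p s ..< lower p s + p s}"
    proof (intro emeasure_eq_AE)
      \<comment> \<open>The end point 1 lies in no half-open interval and is discarded as a null
        set.\<close>
      have "AE t in lborel. t \<noteq> (1::real)" by (rule AE_lborel_singleton)
      then show "AE t in lborel. t \<in> {t \<in> {0..1}. walk p t (length s) = s} \<longleftrightarrow> t \<in> {lower p s ..< lower p s + p s}"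
      proof (rule AE_mp, intro AE_I2 impI)
        fix t :: real assume "t \<noteq> 1"
        then show "t \<in> {t \<in> {0..1}. walk p t (length s) = s} \<longleftrightarrow> t \<in> {lower p s ..< lower p s + p s}"
          using walk_eq_iff[OF p, of t "length s" s] pos le1 by (cases "0 \<le> t \<and> t < 1") auto
      qed
    qed auto
    also have "\<dots> = ennreal (p s)" using p(2)[of s] by simp
    finally show ?thesis
      unfolding measure_def lambda01_def
      by (subst emeasure_restrict_space) (auto simp: pre space_restrict_space p(2))
  qed
  then show thesis using that[OF measurable_lambda01[OF m]] by blast
qed

text \<open>Approximation in \<open>L^1\<close> by bounded step functions, with one depth for both
  arguments. Such step functions are what frequencies of words in finite samples can test.\<close>

definition prefix_approx :: "(nat \<Rightarrow> bool) measure \<Rightarrow> ((nat \<Rightarrow> bool) \<times> (nat \<Rightarrow> bool) \<Rightarrow> real) \<Rightarrow> bool" where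
  "prefix_approx \<kappa> f \<longleftrightarrow> (\<forall>\<epsilon>>0. \<exists>k c C. (\<forall>s s'. \<bar>c s s'\<bar> \<le> C) \<and>
     (\<integral>z. \<bar>f z - c (bits (fst z) k) (bits (snd z) k)\<bar> \<partial>(square \<kappa>)) < \<epsilon>)"

locale bits_measure = prob_space \<kappa> for \<kappa> :: "(nat \<Rightarrow> bool) measure" +
  assumes sets_\<kappa>: "sets \<kappa> = sets Bits"
begin

sublocale K: pair_prob_space \<kappa> \<kappa> ..

lemma prefix_measurable_\<kappa>: "(\<lambda>b. bits b k) \<in> \<kappa> \<rightarrow>\<^sub>M count_space UNIV"
  by (subst measurable_cong_sets[OF sets_\<kappa> refl]) (rule prefix_measurable)

lemma prefix_fst: "(\<lambda>z. bits (fst z) k) \<in> square \<kappa> \<rightarrow>\<^sub>M count_space UNIV"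
  and prefix_snd: "(\<lambda>z. bits (snd z) k) \<in> square \<kappa> \<rightarrow>\<^sub>M count_space UNIV"
  by (auto intro: measurable_compose[OF _ prefix_measurable_\<kappa>])

lemma prefix_fun_measurable:
  "(\<lambda>z. c (bits (fst z) k) (bits (snd z) k) :: real) \<in> borel_measurable (square \<kappa>)"
  by (rule measurable_compose_countable[OF _ prefix_fst[of k], where f="\<lambda>s z. c s (bits (snd z) k)"],
      rule measurable_compose[OF prefix_snd[of k]]) simp

lemma prefix_fun_integrable:
  assumes "\<forall>s s'. \<bar>c s s'\<bar> \<le> (C::real)"
  shows "integrable (square \<kappa>) (\<lambda>z. c (bits (fst z) k) (bits (snd z) k))"
  by (rule K.P.integrable_const_bound[where B=C]) (auto simp: assms prefix_fun_measurable)

lemma prefix_approx_add: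
  assumes f: "prefix_approx \<kappa> f" "integrable (square \<kappa>) f" and g: "prefix_approx \<kappa> g" "integrable (square \<kappa>) g"
  shows "prefix_approx \<kappa> (\<lambda>z. f z + g z)"
  unfolding prefix_approx_def
proof (intro allI impI)
  fix \<epsilon> :: real assume "0 < \<epsilon>"
  then have "0 < \<epsilon> / 2" by simp
  then obtain k c C l e E where
    c: "\<forall>s s'. \<bar>c s s'\<bar> \<le> C" "(\<integral>z. \<bar>f z - c (bits (fst z) k) (bits (snd z) k)\<bar> \<partial>(square \<kappa>)) < \<epsilon> / 2" and
    e: "\<forall>s s'. \<bar>e s s'\<bar> \<le> E" "(\<integral>z. \<bar>g z - e (bits (fst z) l) (bits (snd z) l)\<bar> \<partial>(square \<kappa>)) < \<epsilon> / 2"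
    using f(1) g(1) unfolding prefix_approx_def by meson
  \<comment> \<open>Step functions of different depths are brought to the common depth
    \<open>k + l\<close> by truncating the prefixes.\<close>
  define h where "h s s' = c (take k s) (take k s') + e (take l s) (take l s')" for s s'
  have h: "h (bits b (k + l)) (bits b' (k + l)) = c (bits b k) (bits b' k) + e (bits b l) (bits b' l)" for b b'
    by (simp add: h_def take_prefix)
  note ci = Bochner_Integration.integrable_diff[OF f(2) prefix_fun_integrable[OF c(1), of k]]
  note ei = Bochner_Integration.integrable_diff[OF g(2) prefix_fun_integrable[OF e(1), of l]]
  have "(\<integral>z. \<bar>f z + g z - h (bits (fst z) (k + l)) (bits (snd z) (k + l))\<bar> \<partial>(square \<kappa>)) \<le>
    (\<integral>z. \<bar>f z - c (bits (fst z) k) (bits (snd z) k)\<bar> + \<bar>g z - e (bits (fst z) l) (bits (snd z) l)\<bar> \<partial>(square \<kappa>))"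
  proof (rule integral_mono)
    show "integrable (square \<kappa>) (\<lambda>z. \<bar>f z - c (bits (fst z) k) (bits (snd z) k)\<bar> + \<bar>g z - e (bits (fst z) l) (bits (snd z) l)\<bar>)"
      using ci ei by auto
    have "integrable (square \<kappa>) (\<lambda>z. \<bar>(f z - c (bits (fst z) k) (bits (snd z) k)) + (g z - e (bits (fst z) l) (bits (snd z) l))\<bar>)"
      using ci ei by auto
    then show "integrable (square \<kappa>) (\<lambda>z. \<bar>f z + g z - h (bits (fst z) (k + l)) (bits (snd z) (k + l))\<bar>)"
      by (simp add: h algebra_simps)
  qed (simp add: h)
  also have "\<dots> < \<epsilon>" using c(2) e(2) ci ei by simp
  finally show "\<exists>k c C. (\<forall>s s'. \<bar>c s s'\<bar> \<le> C) \<and>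
     (\<integral>z. \<bar>f z + g z - c (bits (fst z) k) (bits (snd z) k)\<bar> \<partial>(square \<kappa>)) < \<epsilon>"
    using c(1) e(1) by (intro exI[of _ "k + l"] exI[of _ h] exI[of _ "C + E"])
      (auto simp: h_def intro!: order_trans[OF abs_triangle_ineq] add_mono)
qed

lemma prefix_approx_scale:
  assumes f: "prefix_approx \<kappa> f"
  shows "prefix_approx \<kappa> (\<lambda>z. a * f z)"
  unfolding prefix_approx_def
proof (intro allI impI)
  fix \<epsilon> :: real assume "0 < \<epsilon>"
  then have "0 < \<epsilon> / (\<bar>a\<bar> + 1)" by simp
  then obtain k c C where
    c: "\<forall>s s'. \<bar>c s s'\<bar> \<le> C" "(\<integral>z. \<bar>f z - c (bits (fst z) k) (bits (snd z) k)\<bar> \<partial>(square \<kappa>)) < \<epsilon> / (\<bar>a\<bar> + 1)"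
    using f unfolding prefix_approx_def by meson
  have "(\<integral>z. \<bar>a * f z - a * c (bits (fst z) k) (bits (snd z) k)\<bar> \<partial>(square \<kappa>)) =
     \<bar>a\<bar> * (\<integral>z. \<bar>f z - c (bits (fst z) k) (bits (snd z) k)\<bar> \<partial>(square \<kappa>))"
    by (simp add: abs_mult flip: right_diff_distrib)
  also have "\<dots> \<le> \<bar>a\<bar> * (\<epsilon> / (\<bar>a\<bar> + 1))" using c(2) by (intro mult_left_mono) auto
  also have "\<dots> < \<epsilon>" using \<open>0 < \<epsilon>\<close> by (simp add: field_simps)
  finally show "\<exists>k c C. (\<forall>s s'. \<bar>c s s'\<bar> \<le> C) \<and>
     (\<integral>z. \<bar>a * f z - c (bits (fst z) k) (bits (snd z) k)\<bar> \<partial>(square \<kappa>)) < \<epsilon>"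
    using c(1) by (intro exI[of _ k] exI[of _ "\<lambda>s s'. a * c s s'"] exI[of _ "\<bar>a\<bar> * C"])
      (auto simp: abs_mult mult_left_mono)
qed

lemma prefix_approx_lim:
  assumes f: "\<And>n. prefix_approx \<kappa> (f n)" "\<And>n. integrable (square \<kappa>) (f n :: _ \<Rightarrow> real)"
    and g: "integrable (square \<kappa>) g" and w: "integrable (square \<kappa>) w"
    and lim: "\<And>z. z \<in> space (square \<kappa>) \<Longrightarrow> (\<lambda>n. f n z) \<longlonglongrightarrow> g z"
    and bd: "\<And>n z. z \<in> space (square \<kappa>) \<Longrightarrow> \<bar>f n z\<bar> \<le> w z"
  shows "prefix_approx \<kappa> g"
  unfolding prefix_approx_def
proof (intro allI impI)
  fix \<epsilon> :: real assume \<epsilon>: "0 < \<epsilon>"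
  have "(\<lambda>n. \<integral>z. \<bar>g z - f n z\<bar> \<partial>(square \<kappa>)) \<longlonglongrightarrow> (\<integral>z. 0 \<partial>(square \<kappa>))"
  proof (rule integral_dominated_convergence[where w="\<lambda>z. \<bar>g z\<bar> + w z"])
    show "AE z in square \<kappa>. (\<lambda>n. \<bar>g z - f n z\<bar>) \<longlonglongrightarrow> 0"
    proof (intro AE_I2)
      fix z assume "z \<in> space (square \<kappa>)"
      from tendsto_rabs[OF tendsto_diff[OF tendsto_const lim[OF this], of "g z"]]
      show "(\<lambda>n. \<bar>g z - f n z\<bar>) \<longlonglongrightarrow> 0" by simp
    qed
    show "AE z in square \<kappa>. norm \<bar>g z - f n z\<bar> \<le> \<bar>g z\<bar> + w z" for n
    proof (intro AE_I2)
      fix z assume "z \<in> space (square \<kappa>)"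
      from bd[OF this, of n] show "norm \<bar>g z - f n z\<bar> \<le> \<bar>g z\<bar> + w z" by simp
    qed
  qed (use f(2) g w in auto)
  then have "eventually (\<lambda>n. (\<integral>z. \<bar>g z - f n z\<bar> \<partial>(square \<kappa>)) < \<epsilon> / 2) sequentially"
    using order_tendstoD(2)[of _ 0 sequentially "\<epsilon> / 2"] \<epsilon> by simp
  then obtain n where n: "(\<integral>z. \<bar>g z - f n z\<bar> \<partial>(square \<kappa>)) < \<epsilon> / 2"
    by (auto simp: eventually_sequentially)
  obtain k c C where
    c: "\<forall>s s'. \<bar>c s s'\<bar> \<le> C" "(\<integral>z. \<bar>f n z - c (bits (fst z) k) (bits (snd z) k)\<bar> \<partial>(square \<kappa>)) < \<epsilon> / 2"
    using f(1)[of n] \<epsilon> unfolding prefix_approx_def by (meson half_gt_zero)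
  note ci = prefix_fun_integrable[OF c(1), of k]
  have "(\<integral>z. \<bar>g z - c (bits (fst z) k) (bits (snd z) k)\<bar> \<partial>(square \<kappa>)) \<le>
    (\<integral>z. \<bar>g z - f n z\<bar> + \<bar>f n z - c (bits (fst z) k) (bits (snd z) k)\<bar> \<partial>(square \<kappa>))"
    using f(2)[of n] g ci by (intro integral_mono) auto
  also have "\<dots> = (\<integral>z. \<bar>g z - f n z\<bar> \<partial>(square \<kappa>)) + (\<integral>z. \<bar>f n z - c (bits (fst z) k) (bits (snd z) k)\<bar> \<partial>(square \<kappa>))"
    using f(2)[of n] g ci by (intro Bochner_Integration.integral_add) auto
  also have "\<dots> < \<epsilon>" using n c(2) by simp
  finally show "\<exists>k c C. (\<forall>s s'. \<bar>c s s'\<bar> \<le> C) \<and>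
     (\<integral>z. \<bar>g z - c (bits (fst z) k) (bits (snd z) k)\<bar> \<partial>(square \<kappa>)) < \<epsilon>"
    using c(1) by (intro exI conjI)
qed

text \<open>Arbitrary predicates \<open>R\<close> on prefixes are allowed, so the generator is
  closed under intersections by passing to a common depth, and its indicators are themselves step
  functions.\<close>

lemma sets_pair_Bits:
  "sets (square \<kappa>) = sigma_sets UNIV {{z. R (bits (fst z) k) (bits (snd z) k)} | R (k :: nat). True}" (is "_ = sigma_sets UNIV ?G")
proof
  have sp: "space (square \<kappa>) = UNIV"
    using sets_eq_imp_space_eq[OF sets_\<kappa>] by (simp add: space_pair_measure)
  define S where "S = sigma UNIV ?G"
  have sS: "sets S = sigma_sets UNIV ?G" "space S = UNIV" by (auto simp: S_def)
  have f: "fst \<in> S \<rightarrow>\<^sub>M Bits"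
  proof (rule measurable_PiM_single')
    fix n
    have "{z. (\<lambda>s s'. s ! n) (bits (fst z) (Suc n)) (bits (snd z) (Suc n))} \<in> sets S"
      unfolding sS by (intro sigma_sets.Basic CollectI exI[of _ "\<lambda>s s'. s ! n"] exI[of _ "Suc n"] conjI refl TrueI)
    then show "(\<lambda>z. fst z n) \<in> S \<rightarrow>\<^sub>M count_space UNIV"
      by (simp add: nth_prefix pred_def sS)
  qed (simp add: sS)
  have s: "snd \<in> S \<rightarrow>\<^sub>M Bits"
  proof (rule measurable_PiM_single')
    fix n
    have "{z. (\<lambda>s s'. s' ! n) (bits (fst z) (Suc n)) (bits (snd z) (Suc n))} \<in> sets S"
      unfolding sS by (intro sigma_sets.Basic CollectI exI[of _ "\<lambda>s s'. s' ! n"] exI[of _ "Suc n"] conjI refl TrueI)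
    then show "(\<lambda>z. snd z n) \<in> S \<rightarrow>\<^sub>M count_space UNIV"
      by (simp add: nth_prefix pred_def sS)
  qed (simp add: sS)
  have "(\<lambda>z. (fst z, snd z)) \<in> S \<rightarrow>\<^sub>M square \<kappa>"
    using f s sets_\<kappa> by (intro measurable_Pair) (auto cong: measurable_cong_sets)
  from measurable_sets[OF this] show "sets (square \<kappa>) \<subseteq> sigma_sets UNIV ?G"
    by (auto simp: sS)
  show "sigma_sets UNIV ?G \<subseteq> sets (square \<kappa>)"
  proof -
    have "?G \<subseteq> sets (square \<kappa>)"
    proof safe
      fix R k
      have "Measurable.pred (square \<kappa>) (\<lambda>z. R (bits (fst z) k) (bits (snd z) k))"
        by (rule pred_countable2[OF prefix_fst prefix_snd])
      then show "{z. R (bits (fst z) k) (bits (snd z) k)} \<in> sets (square \<kappa>)"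
        by (simp add: pred_def sp)
    qed
    from sets.sigma_sets_subset[OF this] show ?thesis by (simp add: sp)
  qed
qed

lemma prefix_approx_indicator:
  assumes "A \<in> sets (square \<kappa>)"
  shows "prefix_approx \<kappa> (indicator A)"
proof -
  let ?G = "{{z. R (bits (fst z) k) (bits (snd z) k)} | R (k :: nat). True}"
  have sp: "space (square \<kappa>) = UNIV"
    using sets_eq_imp_space_eq[OF sets_\<kappa>] by (simp add: space_pair_measure)
  have basic: "prefix_approx \<kappa> (indicator {z. R (bits (fst z) k) (bits (snd z) k)})" for R k
    unfolding prefix_approx_def
    by (intro allI impI exI[of _ k] exI[of _ "\<lambda>s s'. of_bool (R s s')"] exI[of _ 1]) (auto simp: indicator_def)
  have "Int_stable ?G"
  proof (rule Int_stableI)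
    fix a b assume "a \<in> ?G" "b \<in> ?G"
    then obtain R k R' k' where ab: "a = {z. R (bits (fst z) k) (bits (snd z) k)}"
      "b = {z. R' (bits (fst z) k') (bits (snd z) k')}" by auto
    have "a \<inter> b = {z. (\<lambda>s s'. R (take k s) (take k s') \<and> R' (take k' s) (take k' s'))
       (bits (fst z) (k + k')) (bits (snd z) (k + k'))}"
      by (auto simp: ab take_prefix)
    then show "a \<inter> b \<in> ?G" by (intro CollectI exI conjI TrueI)
  qed
  moreover have "?G \<subseteq> Pow UNIV" by simp
  moreover have "A \<in> sigma_sets UNIV ?G" using assms sets_pair_Bits by simp
  ultimately show ?thesis
  proof (induction rule: sigma_sets_induct_disjoint)
    case (basic A)
    then show ?case using \<open>\<And>R k. prefix_approx \<kappa> (indicator {z. R (bits (fst z) k) (bits (snd z) k)})\<close> by auto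
  next
    case empty
    have "{z :: (nat \<Rightarrow> bool) \<times> (nat \<Rightarrow> bool). False} = {}" by simp
    then show ?case using basic[of "\<lambda>_ _. False" 0] by (simp only:)
  next
    case (compl A)
    then have A: "A \<in> sets (square \<kappa>)" by (simp add: sets_pair_Bits)
    have "prefix_approx \<kappa> (\<lambda>z. 1)"
      unfolding prefix_approx_def by (intro allI impI exI[of _ 0] exI[of _ "\<lambda>_ _. 1"] exI[of _ 1]) auto
    then have "prefix_approx \<kappa> (\<lambda>z. 1 + (- 1) * indicator A z)"
      using compl A by (intro prefix_approx_add prefix_approx_scale) (auto simp: K.P.emeasure_eq_measure)
    also have "(\<lambda>z. 1 + (- 1) * indicator A z) = (indicator (UNIV - A) :: _ \<Rightarrow> real)"
      by (auto simp: indicator_def fun_eq_iff)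
    finally show ?case .
  next
    case (union A)
    then have A: "A i \<in> sets (square \<kappa>)" for i by (auto simp: sets_pair_Bits)
    define f where "f n = (\<lambda>z. \<Sum>i<n. indicator (A i) z :: real)" for n :: nat
    have fi: "integrable (square \<kappa>) (f n)" for n
      unfolding f_def using A by (auto simp: K.P.emeasure_eq_measure)
    have ff: "f n z = indicator (\<Union>i<n. A i) z" for n z
      unfolding f_def using union(1) by (subst indicator_UN_disjoint[symmetric]) (auto simp: disjoint_family_on_def)
    show ?case
    proof (rule prefix_approx_lim[of f _ "\<lambda>_. 1"])
      show "prefix_approx \<kappa> (f n)" for n
      proof (induction n)
        case 0
        show ?case unfolding prefix_approx_def
          by (intro allI impI exI[of _ 0] exI[of _ "\<lambda>_ _. 0"] exI[of _ 1]) (auto simp: f_def)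
      next
        case (Suc n)
        have "prefix_approx \<kappa> (\<lambda>z. f n z + indicator (A n) z)"
          using Suc fi[of n] union A by (intro prefix_approx_add) (auto simp: K.P.emeasure_eq_measure)
        then show ?case by (simp add: f_def)
      qed
      show "integrable (square \<kappa>) (indicator (\<Union>i. A i) :: _ \<Rightarrow> real)"
        using A by (auto simp: K.P.emeasure_eq_measure)
      show "(\<lambda>n. f n z) \<longlonglongrightarrow> indicator (\<Union>i. A i) z" for z
        unfolding ff by (rule LIMSEQ_indicator_UN)
      show "\<bar>f n z\<bar> \<le> 1" for n z by (simp add: ff indicator_def)
    qed (auto simp: fi)
  qed
qed

lemma prefix_approx_integrable:
  assumes "integrable (square \<kappa>) f"
  shows "prefix_approx \<kappa> f"
  using assms
proof (induction rule: integrable_induct)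
  case (base A c)
  then show ?case using prefix_approx_scale[OF prefix_approx_indicator[of A], of c] by (simp add: mult.commute)
next
  case (add f g)
  then show ?case by (intro prefix_approx_add) auto
next
  case (lim f s)
  show ?case
    by (rule prefix_approx_lim[of s f "\<lambda>z. 2 * \<bar>f z\<bar>"]) (use lim in auto)
qed

lemma prefix_fun_sum:
  "c (bits b k) (bits b' k) = (\<Sum>s | length s = k. \<Sum>s' | length s' = k.
     c s s' * (of_bool (bits b k = s) * of_bool (bits b' k = s')) :: real)"
proof -
  have "(\<Sum>s | length s = k. \<Sum>s' | length s' = k. c s s' * (of_bool (bits b k = s) * of_bool (bits b' k = s'))) =
    (\<Sum>s | length s = k. if bits b k = s then (\<Sum>s' | length s' = k. if bits b' k = s' then c s s' else 0) else 0)"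
    by (intro sum.cong refl) (auto intro!: sum.cong)
  also have "\<dots> = c (bits b k) (bits b' k)"
    using finite_bool_lists by (simp add: sum.delta')
  finally show ?thesis by simp
qed

text \<open>Orthogonality to cylinder rectangles gives orthogonality to every step function
  \<open>g\<close>. Then the integral of \<open>H^2\<close> equals that of \<open>H (H - g)\<close>,
  which is at most the \<open>L^1\<close> distance of \<open>H\<close> and \<open>g\<close> because
  \<open>H\<close> is bounded by 1, and this distance can be made arbitrarily small.\<close>

lemma AE_zero_if_orthogonal:
  fixes H :: "_ \<Rightarrow> real"
  assumes H: "H \<in> borel_measurable (square \<kappa>)" "\<And>z. z \<in> space (square \<kappa>) \<Longrightarrow> \<bar>H z\<bar> \<le> 1"
    and orth: "\<And>k s s'. length s = k \<Longrightarrow> length s' = k \<Longrightarrow>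
      (\<integral>z. H z * (of_bool (bits (fst z) k = s) * of_bool (bits (snd z) k = s')) \<partial>(square \<kappa>)) = 0"
  shows "AE z in square \<kappa>. H z = 0"
proof -
  have Hi: "integrable (square \<kappa>) H"
    using H by (intro K.P.integrable_const_bound[where B=1]) auto
  have HH: "integrable (square \<kappa>) (\<lambda>z. H z * H z)"
  proof (rule K.P.integrable_const_bound[where B=1])
    show "AE z in square \<kappa>. norm (H z * H z) \<le> 1"
    proof (intro AE_I2)
      fix z assume "z \<in> space (square \<kappa>)"
      then have "\<bar>H z\<bar> * \<bar>H z\<bar> \<le> 1" using H(2) by (intro mult_le_one) auto
      then show "norm (H z * H z) \<le> 1" by (simp add: abs_mult)
    qed
  qed (use H(1) in auto)
  have "(\<integral>z. H z * H z \<partial>(square \<kappa>)) \<le> 0"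
  proof (rule field_le_epsilon)
    fix \<epsilon> :: real assume "0 < \<epsilon>"
    then obtain k c C where
      c: "\<forall>s s'. \<bar>c s s'\<bar> \<le> C" "(\<integral>z. \<bar>H z - c (bits (fst z) k) (bits (snd z) k)\<bar> \<partial>(square \<kappa>)) < \<epsilon>"
      using prefix_approx_integrable[OF Hi] unfolding prefix_approx_def by meson
    define g where "g z = c (bits (fst z) k) (bits (snd z) k)" for z
    have gi: "integrable (square \<kappa>) g" unfolding g_def by (rule prefix_fun_integrable[OF c(1)])
    have indm: "(\<lambda>z. of_bool (bits (fst z) k = s) * of_bool (bits (snd z) k = s') :: real) \<in> borel_measurable (square \<kappa>)" for s s'
      by (rule prefix_fun_measurable[of "\<lambda>u v. of_bool (u = s) * of_bool (v = s')"])
    have Hind: "integrable (square \<kappa>) (\<lambda>z. H z * (of_bool (bits (fst z) k = s) * of_bool (bits (snd z) k = s')))" for s s'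
      using H indm by (intro K.P.integrable_const_bound[where B=1]) (auto intro!: AE_I2)
    have Hg_eq: "H z * g z = (\<Sum>s | length s = k. \<Sum>s' | length s' = k.
        c s s' * (H z * (of_bool (bits (fst z) k = s) * of_bool (bits (snd z) k = s'))))" for z
      unfolding g_def by (subst prefix_fun_sum) (simp add: sum_distrib_left mult_ac)
    have Hgi: "integrable (square \<kappa>) (\<lambda>z. H z * g z)"
      unfolding Hg_eq using Hind by (intro Bochner_Integration.integrable_sum) auto
    have Hg: "(\<integral>z. H z * g z \<partial>(square \<kappa>)) = 0"
      unfolding Hg_eq using Hind orth
      by (subst Bochner_Integration.integral_sum, (intro Bochner_Integration.integrable_sum; simp),
          intro sum.neutral ballI, subst Bochner_Integration.integral_sum) auto
    have "(\<integral>z. H z * H z \<partial>(square \<kappa>)) = (\<integral>z. H z * H z - H z * g z \<partial>(square \<kappa>))"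
      using HH Hgi Hg by simp
    also have "\<dots> \<le> (\<integral>z. \<bar>H z - g z\<bar> \<partial>(square \<kappa>))"
    proof (rule integral_mono)
      fix z assume "z \<in> space (square \<kappa>)"
      then have "\<bar>H z\<bar> * \<bar>H z - g z\<bar> \<le> 1 * \<bar>H z - g z\<bar>"
        using H(2) by (intro mult_right_mono) auto
      then have "\<bar>H z * (H z - g z)\<bar> \<le> \<bar>H z - g z\<bar>" by (simp add: abs_mult)
      then show "H z * H z - H z * g z \<le> \<bar>H z - g z\<bar>" by (simp add: right_diff_distrib)
    qed (use HH Hgi Hi gi in auto)
    also have "\<dots> \<le> 0 + \<epsilon>" using c(2) by (simp add: g_def)
    finally show "(\<integral>z. H z * H z \<partial>(square \<kappa>)) \<le> 0 + \<epsilon>" .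
  qed
  then have "(\<integral>z. H z * H z \<partial>(square \<kappa>)) = 0"
    by (intro antisym integral_nonneg) auto
  then have "AE z in square \<kappa>. H z * H z = 0"
    using HH by (subst (asm) integral_nonneg_eq_0_iff_AE) auto
  then show ?thesis by auto
qed

end

section \<open>Typical samples\<close>

text \<open>A countable power of \<open>{0..1}\<close> is compact by Tychonoff and metrizable, hence
  sequentially compact; this takes the place of a diagonal argument.\<close>

lemma convergent_subseq_pointwise:
  fixes p :: "nat \<Rightarrow> 'a :: countable \<Rightarrow> real"
  assumes "\<And>N s. 0 \<le> p N s" "\<And>N s. p N s \<le> 1"
  obtains r l where "strict_mono r" "\<And>s. (\<lambda>N. p (r N) s) \<longlonglongrightarrow> l s"
proof -
  have "compactin (product_topology (\<lambda>_. euclidean) UNIV) (PiE UNIV (\<lambda>_ :: 'a. {0..1 :: real}))"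
    by (subst compactin_PiE) auto
  then have "compact (PiE UNIV (\<lambda>_ :: 'a. {0..1 :: real}))"
    by (simp add: euclidean_product_topology)
  then have "seq_compact (PiE UNIV (\<lambda>_ :: 'a. {0..1 :: real}))"
    by (simp add: compact_eq_seq_compact_metric)
  moreover have "\<forall>N. p N \<in> PiE UNIV (\<lambda>_ :: 'a. {0..1 :: real})"
    using assms by auto
  ultimately obtain l r where r: "strict_mono r" "(p \<circ> r) \<longlonglongrightarrow> l"
    unfolding seq_compact_def by metis
  have "(\<lambda>N. p (r N) s) \<longlonglongrightarrow> l s" for s
  proof -
    have "continuous_on UNIV (\<lambda>x :: 'a \<Rightarrow> real. x s)" by (rule continuous_on_product_coordinates)
    from continuous_on_tendsto_compose[OF this r(2)] show ?thesis by (simp add: o_def)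
  qed
  with r(1) show thesis by (rule that)
qed

text \<open>Chebyshev's inequality: centred indicators at distinct coordinates are uncorrelated, so
  the second moment of their sum is at most \<open>n\<close>.\<close>

lemma (in prob_space) frequency_tail:
  fixes n :: nat
  assumes A: "A \<in> sets M" and n: "0 < n" and \<eta>: "0 < \<eta>"
  shows "measure (PiM (UNIV :: nat set) (\<lambda>_. M))
    {x \<in> space (PiM UNIV (\<lambda>_. M)). \<eta> < \<bar>(\<Sum>i<n. indicator A (x i)) / real n - prob A\<bar>} \<le> 1 / (real n * \<eta>\<^sup>2)"
proof -
  interpret P: product_prob_space "\<lambda>_. M" "UNIV :: nat set" ..
  let ?P = "PiM (UNIV :: nat set) (\<lambda>_. M)"
  define f where "f y = indicator A y - prob A" for y
  have fb: "\<bar>f y\<bar> \<le> 1" for y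
    using prob_le_1[of A] by (auto simp: f_def indicator_def)
  have fm [measurable]: "f \<in> borel_measurable M" unfolding f_def using A by measurable
  have fi: "integrable M f" by (rule integrable_const_bound[where B=1]) (auto simp: fb)
  have f0: "(\<integral>y. f y \<partial>M) = 0"
    unfolding f_def using A by (subst Bochner_Integration.integral_diff) (auto simp: prob_space emeasure_eq_measure)
  define g where "g i j x = f (x i) * f (x j)" for i j and x :: "nat \<Rightarrow> 'a"
  have gm [measurable]: "g i j \<in> borel_measurable ?P" for i j unfolding g_def by measurable
  have gb: "\<bar>g i j x\<bar> \<le> 1" for i j x unfolding g_def abs_mult using fb by (intro mult_le_one) auto
  have gi: "integrable ?P (g i j)" for i j
    by (rule P.P.integrable_const_bound[where B=1]) (auto simp: gb)
  have gz: "(\<integral>x. g i j x \<partial>?P) = 0" if "i \<noteq> j" for i j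
  proof -
    have "(\<integral>x. g i j x \<partial>?P) = (\<integral>x. (\<Prod>k\<in>{i, j}. f (x k)) \<partial>?P)"
      using that by (simp add: g_def)
    also have "\<dots> = (\<Prod>k\<in>{i, j}. \<integral>y. f y \<partial>M)"
      by (rule P.integral_PiM_prod) (auto simp: fi)
    finally show ?thesis using that f0 by simp
  qed
  define S where "S x = (\<Sum>i<n. \<Sum>j<n. g i j x)" for x
  have Si: "integrable ?P S" unfolding S_def by (intro Bochner_Integration.integrable_sum gi)
  have S_sq: "S x = (\<Sum>i<n. f (x i))\<^sup>2" for x
    by (simp add: S_def g_def power2_eq_square sum_product)
  have dev: "(\<Sum>i<n. f (x i)) = real n * ((\<Sum>i<n. indicator A (x i)) / real n - prob A)" for x
    using n by (simp add: f_def sum_subtractf right_diff_distrib)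
  have "(\<integral>x. S x \<partial>?P) = (\<Sum>i<n. \<Sum>j<n. \<integral>x. g i j x \<partial>?P)"
    unfolding S_def by (simp add: gi)
  also have "\<dots> \<le> (\<Sum>i<n. \<Sum>j<n. of_bool (i = j))"
  proof (intro sum_mono)
    fix i j
    have "(\<integral>x. g i j x \<partial>?P) \<le> 1"
      by (intro P.P.integral_le_const gi AE_I2) (use gb in \<open>auto simp: abs_le_iff\<close>)
    then show "(\<integral>x. g i j x \<partial>?P) \<le> of_bool (i = j)" using gz[of i j] by auto
  qed
  also have "\<dots> = real n" by (simp add: of_bool_def)
  finally have ES: "(\<integral>x. S x \<partial>?P) \<le> real n" .
  have "measure ?P {x \<in> space ?P. \<eta> < \<bar>(\<Sum>i<n. indicator A (x i)) / real n - prob A\<bar>} \<le>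
    measure ?P {x \<in> space ?P. (real n * \<eta>)\<^sup>2 \<le> S x}"
  proof (rule P.P.finite_measure_mono)
    show "{x \<in> space ?P. \<eta> < \<bar>(\<Sum>i<n. indicator A (x i)) / real n - prob A\<bar>} \<subseteq> {x \<in> space ?P. (real n * \<eta>)\<^sup>2 \<le> S x}"
    proof safe
      fix x assume "\<eta> < \<bar>(\<Sum>i<n. indicator A (x i)) / real n - prob A\<bar>"
      then have "real n * \<eta> \<le> \<bar>\<Sum>i<n. f (x i)\<bar>"
        using n unfolding dev abs_mult by simp
      then have "\<bar>real n * \<eta>\<bar> \<le> \<bar>\<Sum>i<n. f (x i)\<bar>" using \<eta> by (simp add: abs_mult)
      then show "(real n * \<eta>)\<^sup>2 \<le> S x" unfolding S_sq by (simp add: abs_le_square_iff)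
    qed
    show "{x \<in> space ?P. (real n * \<eta>)\<^sup>2 \<le> S x} \<in> sets ?P" using Si by measurable
  qed
  also have "\<dots> \<le> (\<integral>x. S x \<partial>?P) / (real n * \<eta>)\<^sup>2"
    using n \<eta> by (intro integral_Markov_inequality_measure[where A="space ?P"] Si) (auto simp: S_sq)
  also have "\<dots> \<le> real n / (real n * \<eta>)\<^sup>2" by (intro divide_right_mono ES) simp
  also have "\<dots> = 1 / (real n * \<eta>\<^sup>2)" using n by (simp add: power2_eq_square)
  finally show ?thesis .
qed

text \<open>Coinciding indices are left out since \<open>(x i, x i)\<close> is not distributed like
  an independent pair.\<close>

definition offdiag :: "(nat \<Rightarrow> nat \<Rightarrow> real) \<Rightarrow> nat \<Rightarrow> real" where
  "offdiag f n = (\<Sum>i<n. \<Sum>j<n. if i = j then 0 else f i j)"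

text \<open>Markov's inequality for the mean, which is linear and hence indifferent to the
  dependence among pairs sharing an index.\<close>

lemma (in prob_space) offdiag_tail:
  fixes n :: nat and f :: "'a \<Rightarrow> 'a \<Rightarrow> real"
  assumes f: "integrable (square M) (\<lambda>(x, y). f x y)" "\<And>x y. 0 \<le> f x y"
    and n: "0 < n" and \<epsilon>: "0 < \<epsilon>"
  shows "measure (PiM (UNIV :: nat set) (\<lambda>_. M))
    {x \<in> space (PiM UNIV (\<lambda>_. M)). \<epsilon> * (real n)\<^sup>2 < offdiag (\<lambda>i j. f (x i) (x j)) n} \<le>
    (\<integral>(x, y). f x y \<partial>(square M)) / \<epsilon>"
proof -
  interpret P: product_prob_space "\<lambda>_. M" "UNIV :: nat set" ..
  let ?P = "PiM (UNIV :: nat set) (\<lambda>_. M)"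
  let ?v = "\<integral>(x, y). f x y \<partial>(square M)"
  have m: "(\<lambda>x. (x i, x j)) \<in> ?P \<rightarrow>\<^sub>M square M" for i j by measurable
  have d: "distr ?P (square M) (\<lambda>x. (x i, x j)) = square M" if "i \<noteq> j" for i j
    using that by (rule distr_PiM_pair)
  have fi: "integrable ?P (\<lambda>x. f (x i) (x j))" if "i \<noteq> j" for i j
    using integrable_distr[OF m[of i j], of "\<lambda>(x, y). f x y"] f(1) d[OF that] by simp
  have fe: "(\<integral>x. f (x i) (x j) \<partial>?P) = ?v" if "i \<noteq> j" for i j
    using integral_distr[OF m[of i j], of "\<lambda>(x, y). f x y"] f(1) d[OF that] by simp
  have v0: "0 \<le> ?v" using f(2) by (intro Bochner_Integration.integral_nonneg) auto
  define g where "g i j x = (if i = j then 0 else f (x i) (x j))" for i j :: nat and x :: "nat \<Rightarrow> 'a"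
  have gi: "integrable ?P (g i j)" for i j
    using fi[of i j] by (cases "i = j") (auto simp: g_def[abs_def])
  have od: "offdiag (\<lambda>i j. f (x i) (x j)) n = (\<Sum>i<n. \<Sum>j<n. g i j x)" for x
    by (simp add: offdiag_def g_def)
  have odi: "integrable ?P (\<lambda>x. offdiag (\<lambda>i j. f (x i) (x j)) n)"
    unfolding od by (intro Bochner_Integration.integrable_sum gi)
  have "(\<integral>x. offdiag (\<lambda>i j. f (x i) (x j)) n \<partial>?P) = (\<Sum>i<n. \<Sum>j<n. \<integral>x. g i j x \<partial>?P)"
    unfolding od by (simp add: gi)
  also have "\<dots> \<le> (\<Sum>i<n. \<Sum>j<n. ?v)"
  proof (intro sum_mono)
    fix i j show "(\<integral>x. g i j x \<partial>?P) \<le> ?v"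
      using fe[of i j] v0 by (cases "i = j") (simp_all add: g_def)
  qed
  also have "\<dots> = (real n)\<^sup>2 * ?v" by (simp add: power2_eq_square)
  finally have E: "(\<integral>x. offdiag (\<lambda>i j. f (x i) (x j)) n \<partial>?P) \<le> (real n)\<^sup>2 * ?v" .
  have "measure ?P {x \<in> space ?P. \<epsilon> * (real n)\<^sup>2 < offdiag (\<lambda>i j. f (x i) (x j)) n} \<le>
    measure ?P {x \<in> space ?P. \<epsilon> * (real n)\<^sup>2 \<le> offdiag (\<lambda>i j. f (x i) (x j)) n}"
    using odi by (intro P.P.finite_measure_mono) auto
  also have "\<dots> \<le> (\<integral>x. offdiag (\<lambda>i j. f (x i) (x j)) n \<partial>?P) / (\<epsilon> * (real n)\<^sup>2)"
    using n \<epsilon> f(2)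
    by (intro integral_Markov_inequality_measure[where A="space ?P"] odi) (auto simp: offdiag_def intro!: sum_nonneg)
  also have "\<dots> \<le> ((real n)\<^sup>2 * ?v) / (\<epsilon> * (real n)\<^sup>2)" using \<epsilon> by (intro divide_right_mono E) simp
  also have "\<dots> = ?v / \<epsilon>" using n by simp
  finally show ?thesis .
qed

lemma measurable_map_countable:
  fixes f :: "'i \<Rightarrow> 'a \<Rightarrow> 'b :: countable"
  assumes "\<And>i. f i \<in> M \<rightarrow>\<^sub>M count_space UNIV"
  shows "(\<lambda>x. map (\<lambda>i. f i x) xs) \<in> M \<rightarrow>\<^sub>M count_space UNIV"
proof (induction xs)
  case (Cons i xs)
  have "(\<lambda>x. f i x # map (\<lambda>i. f i x) xs) \<in> M \<rightarrow>\<^sub>M count_space UNIV"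
    by (rule measurable_compose_countable[OF _ Cons, where f="\<lambda>ys x. f i x # ys"],
        rule measurable_compose[OF assms]) simp
  then show ?case by simp
qed simp

text \<open>A property that factors through a countable discrete space is the preimage of a subset
  of it, and every such subset is measurable, however complicated the property.\<close>

lemma sets_Collect_of_countable:
  fixes L :: "'a \<Rightarrow> 'b :: countable"
  assumes L: "L \<in> M \<rightarrow>\<^sub>M count_space UNIV"
    and P: "\<And>x y. x \<in> space M \<Longrightarrow> y \<in> space M \<Longrightarrow> L x = L y \<Longrightarrow> P x \<longleftrightarrow> P y"
  shows "{x \<in> space M. P x} \<in> sets M"
proof -
  have "{x \<in> space M. P x} = L -` (L ` {x \<in> space M. P x}) \<inter> space M"
    using P by auto
  then show ?thesis using measurable_sets[OF L, of "L ` {x \<in> space M. P x}"] by simp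
qed

section \<open>Matrices that admit a typical sample\<close>

context kernel_space
begin

text \<open>As \<open>L\<close> has countable range, the set of matrices without a witness \<open>x\<close> is measurable although it is
  the complement of a projection.\<close>

lemma tau_no_witness:
  fixes L :: "(nat \<Rightarrow> nat \<Rightarrow> real) \<Rightarrow> 'c :: countable"
  assumes L: "L \<in> M_inf \<rightarrow>\<^sub>M count_space UNIV"
    and R: "\<And>x D D'. D \<in> space M_inf \<Longrightarrow> D' \<in> space M_inf \<Longrightarrow> L D = L D' \<Longrightarrow> R x D \<longleftrightarrow> R x D'"
    and Z: "Z \<in> sets PX"
    and b: "\<And>x. x \<in> space PX \<Longrightarrow> x \<notin> Z \<Longrightarrow> measure (random_matrix d x) {D \<in> space M_inf. \<not> R x D} \<le> \<beta>"
    and \<beta>: "0 \<le> \<beta>"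
  shows "{D \<in> space M_inf. \<forall>x\<in>space PX. \<not> R x D} \<in> sets M_inf"
    and "measure (tau \<mu> d) {D \<in> space M_inf. \<forall>x\<in>space PX. \<not> R x D} \<le> measure PX Z + \<beta>"
proof -
  interpret T: prob_space "tau \<mu> d" by (rule prob_space_tau)
  let ?S = "{D \<in> space M_inf. \<forall>x\<in>space PX. \<not> R x D}"
  show S: "?S \<in> sets M_inf"
    by (rule sets_Collect_of_countable[OF L]) (use R in blast)
  have "emeasure (tau \<mu> d) ?S = (\<integral>\<^sup>+x. emeasure (random_matrix d x) ?S \<partial>PX)"
    by (rule emeasure_tau[OF S])
  also have "\<dots> \<le> (\<integral>\<^sup>+x. indicator Z x + ennreal \<beta> \<partial>PX)"
  proof (rule nn_integral_mono)
    fix x assume x: "x \<in> space PX"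
    interpret Rx: prob_space "random_matrix d x" using x by (rule prob_space_random_matrix)
    show "emeasure (random_matrix d x) ?S \<le> indicator Z x + ennreal \<beta>"
    proof (cases "x \<in> Z")
      case True
      then show ?thesis using Rx.emeasure_le_1[of ?S] by (simp add: add_increasing2)
    next
      case False
      have "{D \<in> space M_inf. \<not> R x D} \<in> sets M_inf"
        by (rule sets_Collect_of_countable[OF L]) (use R in blast)
      \<comment> \<open>A matrix without any witness in particular does not have the sample
        \<open>x\<close> that generated it as a witness.\<close>
      then have "measure (random_matrix d x) ?S \<le> measure (random_matrix d x) {D \<in> space M_inf. \<not> R x D}"
        using x by (intro Rx.finite_measure_mono) (auto simp: sets_random_matrix)
      also have "\<dots> \<le> \<beta>" by (rule b[OF x False])
      finally show ?thesis using False by (simp add: Rx.emeasure_eq_measure \<beta>)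
    qed
  qed
  also have "\<dots> = emeasure PX Z + ennreal \<beta>"
    using Z by (subst nn_integral_add) (auto simp: PX.P.emeasure_space_1)
  finally show "measure (tau \<mu> d) ?S \<le> measure PX Z + \<beta>"
    using \<beta> by (simp add: T.emeasure_eq_measure PX.P.emeasure_eq_measure flip: ennreal_plus)
qed

text \<open>\<open>N\<close> bounds the number of constraints and sets the precision of the first
  two. The third has a fixed precision \<open>\<epsilon> m\<close> because its normalized mean does
  not decrease with \<open>n\<close>. The matrix enters only through the noise.\<close>

definition typical ::
  "(nat \<Rightarrow> real) \<Rightarrow> (nat \<Rightarrow> 'a set) \<Rightarrow> (nat \<Rightarrow> 'a \<Rightarrow> 'a \<Rightarrow> real) \<Rightarrow> (nat \<Rightarrow> real) \<Rightarrow>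
    nat \<Rightarrow> nat \<Rightarrow> (nat \<Rightarrow> 'a) \<Rightarrow> (nat \<Rightarrow> nat \<Rightarrow> real) \<Rightarrow> bool" where
  "typical t A f \<epsilon> N n x D \<longleftrightarrow> (\<forall>m\<le>N.
     C4 (noise (t m) x D) n \<le> real n ^ 4 / real (Suc N) \<and>
     \<bar>(\<Sum>i<n. indicator (A m) (x i)) / real n - measure \<mu> (A m)\<bar> \<le> 1 / real (Suc N) \<and>
     offdiag (\<lambda>i j. f m (x i) (x j)) n \<le> \<epsilon> m * (real n)\<^sup>2)"

text \<open>Union bound over \<open>N + 1\<close> constraints of each kind: frequencies cost
  \<open>(N + 1) ^ 3 / n\<close>, step errors at most \<open>1 / 4\<close> thanks to the summable
  weights \<open>1 / 2 ^ (m + 3)\<close>, and noise at most \<open>2 * (N + 1) ^ 3 / n\<close>. The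
  total is below one half as soon as \<open>n\<close> exceeds
  \<open>12 * (N + 1) ^ 3\<close>.\<close>

lemma tau_untypical:
  fixes n N :: nat
  assumes A: "\<And>m. A m \<in> sets \<mu>"
    and f: "\<And>m. integrable (square \<mu>) (\<lambda>(x, y). f m x y)" "\<And>m x y. 0 \<le> f m x y"
    and \<epsilon>: "\<And>m. 0 < \<epsilon> m" "\<And>m. (\<integral>(x, y). f m x y \<partial>(square \<mu>)) \<le> \<epsilon> m / 2 ^ (m + 3)"
    and n: "12 * Suc N ^ 3 < n"
  shows "{D \<in> space M_inf. \<forall>x\<in>space PX. \<not> typical t A f \<epsilon> N n x D} \<in> sets M_inf"
    and "measure (tau \<mu> d) {D \<in> space M_inf. \<forall>x\<in>space PX. \<not> typical t A f \<epsilon> N n x D} < 1 / 2"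
proof -
  have n0: "0 < n" using n by simp
  define \<eta> where "\<eta> = 1 / real (Suc N)"
  have \<eta>: "0 < \<eta>" by (simp add: \<eta>_def)
  define Z1 where "Z1 m = {x \<in> space PX. \<eta> < \<bar>(\<Sum>i<n. indicator (A m) (x i)) / real n - measure \<mu> (A m)\<bar>}" for m
  define Z2 where "Z2 m = {x \<in> space PX. \<epsilon> m * (real n)\<^sup>2 < offdiag (\<lambda>i j. f m (x i) (x j)) n}" for m
  define Z where "Z = (\<Union>m\<le>N. Z1 m \<union> Z2 m)"
  have Z1s: "Z1 m \<in> sets PX" for m unfolding Z1_def using A[of m] by measurable
  have fm [measurable]: "(\<lambda>x. f m (x i) (x j)) \<in> borel_measurable PX" for m i j
  proof -
    have "(\<lambda>x. (x i, x j)) \<in> PX \<rightarrow>\<^sub>M square \<mu>" by measurable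
    from measurable_compose[OF this borel_measurable_integrable[OF f(1)[of m]]] show ?thesis by simp
  qed
  have Z2s: "Z2 m \<in> sets PX" for m unfolding Z2_def offdiag_def by measurable
  have Zs: "Z \<in> sets PX" unfolding Z_def using Z1s Z2s by auto
  have m1: "measure PX (Z1 m) \<le> real (Suc N) ^ 2 / real n" for m
    using frequency_tail[OF A[of m] n0 \<eta>] by (simp add: Z1_def \<eta>_def power_divide)
  have m2: "measure PX (Z2 m) \<le> 1 / 2 ^ (m + 3)" for m
  proof -
    have "measure PX (Z2 m) \<le> (\<integral>(x, y). f m x y \<partial>(square \<mu>)) / \<epsilon> m"
      unfolding Z2_def by (rule offdiag_tail[OF f n0 \<epsilon>(1)])
    also have "\<dots> \<le> (\<epsilon> m / 2 ^ (m + 3)) / \<epsilon> m" using \<epsilon>(1)[of m] by (intro divide_right_mono \<epsilon>) simp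
    finally show ?thesis using \<epsilon>(1)[of m] by simp
  qed
  have "measure PX Z \<le> (\<Sum>m\<le>N. measure PX (Z1 m \<union> Z2 m))"
    unfolding Z_def using Z1s Z2s by (intro PX.P.finite_measure_subadditive_finite) auto
  also have "\<dots> \<le> (\<Sum>m\<le>N. real (Suc N) ^ 2 / real n + 1 / 2 ^ (m + 3))"
    using m1 m2 Z1s Z2s by (intro sum_mono order_trans[OF measure_Un_le] add_mono) auto
  also have "\<dots> = real (Suc N) ^ 3 / real n + (\<Sum>m\<le>N. 1 / 2 ^ (m + 3))"
    by (simp add: sum.distrib power3_eq_cube power2_eq_square)
  also have "(\<Sum>m\<le>N. 1 / 2 ^ (m + 3) :: real) \<le> 1 / 4"
  proof -
    have "(\<Sum>m\<le>k. 1 / 2 ^ (m + 3) :: real) = 1 / 4 - 1 / 2 ^ (k + 3)" for k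
    proof (induction k)
      case (Suc k)
      have "(\<Sum>m\<le>Suc k. 1 / 2 ^ (m + 3) :: real) = (1 / 4 - 1 / 2 ^ (k + 3)) + 1 / 2 ^ (Suc k + 3)"
        using Suc by simp
      also have "\<dots> = 1 / 4 - 1 / 2 ^ (Suc k + 3)" by (simp add: power_add divide_simps)
      finally show ?case .
    qed simp
    then show ?thesis by simp
  qed
  finally have mZ: "measure PX Z \<le> real (Suc N) ^ 3 / real n + 1 / 4" by simp
  \<comment> \<open>There are \<open>N + 1\<close> noise events, each of probability at most
    \<open>2 * n ^ 3\<close> divided by \<open>n ^ 4 / (N + 1)\<close>.\<close>
  define \<beta> where "\<beta> = 2 * real (Suc N) ^ 2 / real n"
  have b: "measure (random_matrix d x) {D \<in> space M_inf. \<not> typical t A f \<epsilon> N n x D} \<le> \<beta>"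
    if x: "x \<in> space PX" "x \<notin> Z" for x
  proof -
    interpret Rx: prob_space "random_matrix d x" using x(1) by (rule prob_space_random_matrix)
    let ?c = "real n ^ 4 / real (Suc N)"
    let ?B = "\<lambda>m. {D \<in> space M_inf. ?c < C4 (noise (t m) x D) n}"
    have Bs: "?B m \<in> sets (random_matrix d x)" for m
      unfolding C4_def sets_random_matrix by measurable
    have "{D \<in> space M_inf. \<not> typical t A f \<epsilon> N n x D} \<subseteq> (\<Union>m\<le>N. ?B m)"
      using x unfolding typical_def Z_def Z1_def Z2_def \<eta>_def by (force simp: not_le not_less)
    then have "measure (random_matrix d x) {D \<in> space M_inf. \<not> typical t A f \<epsilon> N n x D} \<le>
        measure (random_matrix d x) (\<Union>m\<le>N. ?B m)"
      using Bs by (intro Rx.finite_measure_mono) auto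
    also have "\<dots> \<le> (\<Sum>m\<le>N. measure (random_matrix d x) (?B m))"
      using Bs by (intro Rx.finite_measure_subadditive_finite) auto
    also have "\<dots> \<le> (\<Sum>m\<le>N. 2 * real n ^ 3 / ?c)"
      using n0 by (intro sum_mono noise_C4_tail[OF x(1)]) simp
    also have "\<dots> = \<beta>"
      using n0 by (simp add: \<beta>_def power2_eq_square power3_eq_cube power4_eq_xxxx)
    finally show ?thesis .
  qed
  \<comment> \<open>All that typicality knows about \<open>D\<close> is this finite table of bits,
    an element of a countable type.\<close>
  define L where "L D = map (\<lambda>m. map (\<lambda>i. map (\<lambda>j. D i j \<le> t m) [0..<n]) [0..<n]) [0..<Suc N]"
    for D :: "nat \<Rightarrow> nat \<Rightarrow> real"
  have L: "L \<in> M_inf \<rightarrow>\<^sub>M count_space UNIV"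
    unfolding L_def by (intro measurable_map_countable) measurable
  have R: "typical t A f \<epsilon> N n x D \<longleftrightarrow> typical t A f \<epsilon> N n x D'" if "D \<in> space M_inf" "D' \<in> space M_inf" "L D = L D'" for x D D'
  proof -
    have "(D i j \<le> t m) = (D' i j \<le> t m)" if "i < n" "j < n" "m \<le> N" for i j m
    proof -
      have "L D ! m ! i ! j = L D' ! m ! i ! j" using \<open>L D = L D'\<close> by simp
      then show ?thesis using that by (simp add: L_def del: upt_Suc)
    qed
    then have "C4 (noise (t m) x D) n = C4 (noise (t m) x D') n" if "m \<le> N" for m
      unfolding C4_def resid_def using that by (intro sum.cong refl arg_cong[where f="\<lambda>u. u\<^sup>2"]) auto
    then show ?thesis unfolding typical_def by auto
  qed
  have \<beta>0: "0 \<le> \<beta>" by (simp add: \<beta>_def)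
  show "{D \<in> space M_inf. \<forall>x\<in>space PX. \<not> typical t A f \<epsilon> N n x D} \<in> sets M_inf"
    by (rule tau_no_witness(1)[where R="typical t A f \<epsilon> N n", OF L R Zs b \<beta>0])
  have "measure (tau \<mu> d) {D \<in> space M_inf. \<forall>x\<in>space PX. \<not> typical t A f \<epsilon> N n x D} \<le> measure PX Z + \<beta>"
    by (rule tau_no_witness(2)[where R="typical t A f \<epsilon> N n", OF L R Zs b \<beta>0])
  also have "\<dots> \<le> real (Suc N) ^ 3 / real n + 1 / 4 + 2 * real (Suc N) ^ 3 / real n"
  proof (rule add_mono[OF mZ])
    show "\<beta> \<le> 2 * real (Suc N) ^ 3 / real n"
      unfolding \<beta>_def by (intro divide_right_mono mult_left_mono power_increasing) auto
  qed
  also have "\<dots> = 3 * real (Suc N) ^ 3 / real n + 1 / 4" by (simp add: field_simps)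
  also have "\<dots> < 1 / 2"
  proof -
    have "real (12 * Suc N ^ 3) < real n" using n by (simp only: of_nat_less_iff)
    then have "12 * real (Suc N) ^ 3 < real n" by simp
    then show ?thesis using n0 by (simp add: field_simps)
  qed
  finally show "measure (tau \<mu> d) {D \<in> space M_inf. \<forall>x\<in>space PX. \<not> typical t A f \<epsilon> N n x D} < 1 / 2" .
qed

end

section \<open>Empirical measures of bit sequences\<close>

text \<open>A pair of codes is stored as one bit sequence, so a coupling is again a measure on bit
  sequences, and a realization by Lebesgue measure yields both coordinates at once.\<close>

definition evens :: "(nat \<Rightarrow> bool) \<Rightarrow> nat \<Rightarrow> bool" where "evens b n = b (2 * n)"
definition odds :: "(nat \<Rightarrow> bool) \<Rightarrow> nat \<Rightarrow> bool" where "odds b n = b (Suc (2 * n))"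
definition interleave :: "(nat \<Rightarrow> bool) \<Rightarrow> (nat \<Rightarrow> bool) \<Rightarrow> nat \<Rightarrow> bool" where
  "interleave a b n = (if even n then a (n div 2) else b (n div 2))"

lemma evens_interleave [simp]: "evens (interleave a b) = a"
  and odds_interleave [simp]: "odds (interleave a b) = b"
  by (simp_all add: evens_def odds_def interleave_def fun_eq_iff)

lemma evens_measurable: "evens \<in> Bits \<rightarrow>\<^sub>M Bits"
  and odds_measurable: "odds \<in> Bits \<rightarrow>\<^sub>M Bits"
  unfolding evens_def[abs_def] odds_def[abs_def]
  by (rule measurable_PiM_single', auto)+

lemma prefix_evens: "2 * k \<le> l \<Longrightarrow> bits (evens b) k = map (\<lambda>n. bits b l ! (2 * n)) [0..<k]"
  by (simp add: bits_def evens_def)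

lemma prefix_odds: "2 * k \<le> l \<Longrightarrow> bits (odds b) k = map (\<lambda>n. bits b l ! (Suc (2 * n))) [0..<k]"
  unfolding bits_def odds_def by (rule map_cong) auto

lemma prefix_pred_sets: "{b. R (bits b k)} \<in> sets Bits"
  using pred_countable2[OF prefix_measurable[of k] prefix_measurable[of k], of "\<lambda>s _. R s"]
  by (simp add: pred_def)

lemma sets_Bits_generator: "sets Bits = sigma_sets UNIV {{b. R (bits b k)} | R (k :: nat). True}"
  (is "_ = sigma_sets UNIV ?G")
proof
  define S where "S = sigma UNIV ?G"
  have sS: "sets S = sigma_sets UNIV ?G" "space S = UNIV"
    unfolding S_def by (simp_all add: space_measure_of_conv)
  have "(\<lambda>b. b) \<in> S \<rightarrow>\<^sub>M Bits"
  proof (rule measurable_PiM_single')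
    fix n
    have "{b. (\<lambda>s. s ! n) (bits b (Suc n))} \<in> sets S"
      unfolding sS
      by (intro sigma_sets.Basic CollectI exI[of _ "\<lambda>s. s ! n"] exI[of _ "Suc n"] conjI refl TrueI)
    then show "(\<lambda>b. b n) \<in> S \<rightarrow>\<^sub>M count_space UNIV"
      by (simp add: nth_prefix pred_def sS)
  qed (simp add: sS)
  then have m: "(\<lambda>b. b) -` X \<inter> space S \<in> sets S" if "X \<in> sets Bits" for X
    using that by (rule measurable_sets)
  show "sets Bits \<subseteq> sigma_sets UNIV ?G"
  proof
    fix X :: "(nat \<Rightarrow> bool) set" assume "X \<in> sets Bits"
    then show "X \<in> sigma_sets UNIV ?G" using m[of X] unfolding sS by simp
  qed
  have "?G \<subseteq> sets Bits" using prefix_pred_sets by auto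
  from sets.sigma_sets_subset[OF this] show "sigma_sets UNIV ?G \<subseteq> sets Bits" by simp
qed

lemma (in bits_measure) space_\<kappa>: "space \<kappa> = UNIV"
  using sets_eq_imp_space_eq[OF sets_\<kappa>] by simp

lemma (in bits_measure) cylinder_sets: "{b. bits b k = s} \<in> sets \<kappa>"
  unfolding sets_\<kappa> by (rule prefix_pred_sets)

lemma (in bits_measure) measure_prefix_pred:
  "measure \<kappa> {b. R (bits b k)} =
    (\<Sum>s | length s = k. of_bool (R s) * measure \<kappa> {b. bits b (length s) = s})"
proof -
  have "{b. R (bits b k)} = (\<Union>s\<in>{s. length s = k \<and> R s}. {b. bits b (length s) = s})"
    by auto
  also have "measure \<kappa> \<dots> = (\<Sum>s | length s = k \<and> R s. measure \<kappa> {b. bits b (length s) = s})"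
  proof (rule finite_measure_finite_Union)
    show "finite {s :: bool list. length s = k \<and> R s}"
      by (rule finite_subset[OF _ finite_bool_lists[of k]]) auto
  qed (auto simp: disjoint_family_on_def intro: cylinder_sets)
  also have "\<dots> = (\<Sum>s | length s = k. if R s then measure \<kappa> {b. bits b (length s) = s} else 0)"
    using finite_bool_lists[of k] by (simp add: sum.inter_filter[symmetric])
  also have "\<dots> = (\<Sum>s | length s = k. of_bool (R s) * measure \<kappa> {b. bits b (length s) = s})"
    by (intro sum.cong) auto
  finally show ?thesis .
qed

lemma bits_measure_eqI:
  assumes "bits_measure \<kappa>" "bits_measure \<kappa>'"
    and eq: "\<And>s. measure \<kappa> {b. bits b (length s) = s} = measure \<kappa>' {b. bits b (length s) = s}"
  shows "\<kappa> = \<kappa>'"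
proof -
  interpret K: bits_measure \<kappa> by fact
  interpret K': bits_measure \<kappa>' by fact
  let ?G = "{{b. R (bits b k)} | R (k :: nat). True}"
  show ?thesis
  proof (rule measure_eqI_generator_eq[where E="?G" and \<Omega>=UNIV and A="\<lambda>_. UNIV"])
    show "Int_stable ?G"
    proof (rule Int_stableI)
      fix a b assume "a \<in> ?G" "b \<in> ?G"
      then obtain R k R' k' where ab: "a = {z. R (bits z k)}" "b = {z. R' (bits z k')}"
        by auto
      have "a \<inter> b = {z. (\<lambda>s. R (take k s) \<and> R' (take k' s)) (bits z (k + k'))}"
        by (auto simp: ab take_prefix)
      then show "a \<inter> b \<in> ?G" by (intro CollectI exI conjI TrueI)
    qed
    show "emeasure \<kappa> X = emeasure \<kappa>' X" if XG: "X \<in> ?G" for X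
    proof -
      obtain R k where X: "X = {b. R (bits b k)}" using XG by auto
      show ?thesis
        unfolding K.emeasure_eq_measure K'.emeasure_eq_measure X
          K.measure_prefix_pred K'.measure_prefix_pred eq ..
    qed
    show "range (\<lambda>_ :: nat. UNIV) \<subseteq> ?G"
    proof -
      have "UNIV = {b. (\<lambda>_. True) (bits b 0)}" by simp
      then have "UNIV \<in> ?G" by (intro CollectI exI conjI TrueI)
      then show ?thesis by blast
    qed
    show "sets \<kappa> = sigma_sets UNIV ?G" "sets \<kappa>' = sigma_sets UNIV ?G"
      unfolding K.sets_\<kappa> K'.sets_\<kappa> by (rule sets_Bits_generator)+
    show "emeasure \<kappa> UNIV \<noteq> \<infinity>" for i :: nat
      by simp
  qed simp_all
qed

text \<open>Averages of step functions are linear in the frequencies of words, so convergence of the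
  frequencies carries over to them.\<close>

lemma sum_prefix_frequency:
  fixes c :: "bool list \<Rightarrow> real" and n :: nat
  shows "(\<Sum>i<n. c (bits (B i) k)) / real n =
    (\<Sum>s | length s = k. c s * ((\<Sum>i<n. of_bool (bits (B i) (length s) = s)) / real n))"
proof -
  have "c (bits (B i) k) = (\<Sum>s | length s = k. c s * of_bool (bits (B i) (length s) = s))" for i
  proof -
    have "(\<Sum>s | length s = k. c s * of_bool (bits (B i) (length s) = s)) =
      (\<Sum>s | length s = k. if bits (B i) k = s then c s else 0)"
      by (intro sum.cong refl) auto
    then show ?thesis using finite_bool_lists[of k] by (simp add: sum.delta')
  qed
  then have "(\<Sum>i<n. c (bits (B i) k)) = (\<Sum>s | length s = k. \<Sum>i<n. c s * of_bool (bits (B i) (length s) = s))"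
    by (simp only: sum.swap[of _ _ "{..<n}"])
  then show ?thesis
    by (simp only: sum_divide_distrib sum_distrib_left times_divide_eq_right)
qed

text \<open>The factorization into products of frequencies holds because the diagonal terms are
  included; this is why they are restored when the kernels are compared.\<close>

lemma sum2_prefix_frequency:
  fixes c :: "bool list \<Rightarrow> bool list \<Rightarrow> real" and n :: nat
  shows "(\<Sum>i<n. \<Sum>j<n. c (bits (B i) k) (bits (B j) k)) / (real n)\<^sup>2 =
    (\<Sum>s | length s = k. \<Sum>s' | length s' = k. c s s' *
      (((\<Sum>i<n. of_bool (bits (B i) (length s) = s)) / real n) *
       ((\<Sum>i<n. of_bool (bits (B i) (length s') = s')) / real n)))"
proof -
  have "(\<Sum>i<n. \<Sum>j<n. c (bits (B i) k) (bits (B j) k)) / (real n)\<^sup>2 =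
    (\<Sum>i<n. (\<Sum>j<n. c (bits (B i) k) (bits (B j) k)) / real n) / real n"
    by (simp add: sum_divide_distrib power2_eq_square)
  also have "\<dots> = (\<Sum>i<n. (\<lambda>u. \<Sum>s' | length s' = k. c u s' *
       ((\<Sum>j<n. of_bool (bits (B j) (length s') = s')) / real n)) (bits (B i) k)) / real n"
    by (subst sum_prefix_frequency) simp
  also have "\<dots> = (\<Sum>s | length s = k. (\<Sum>s' | length s' = k. c s s' *
       ((\<Sum>j<n. of_bool (bits (B j) (length s') = s')) / real n)) *
       ((\<Sum>i<n. of_bool (bits (B i) (length s) = s)) / real n))"
    by (rule sum_prefix_frequency)
  finally show ?thesis by (simp add: sum_distrib_left sum_distrib_right mult_ac)
qed

context bits_measure
begin

lemma integral_prefix_fun2: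
  "(\<integral>z. c (bits (fst z) k) (bits (snd z) k) \<partial>(square \<kappa>)) =
    (\<Sum>s | length s = k. \<Sum>s' | length s' = k. c s s' *
      (measure \<kappa> {b. bits b (length s) = s} * measure \<kappa> {b. bits b (length s') = s'}))"
proof -
  have i: "integrable (square \<kappa>) (\<lambda>z. of_bool (bits (fst z) k = s) * of_bool (bits (snd z) k = s') :: real)" for s s'
    by (rule prefix_fun_integrable[of "\<lambda>u v. of_bool (u = s) * of_bool (v = s')" 1]) simp
  define E where "E s = {b. bits b k = s}" for s
  have E: "E s \<in> sets \<kappa>" for s unfolding E_def by (rule cylinder_sets)
  have e: "(\<integral>z. of_bool (bits (fst z) k = s) * of_bool (bits (snd z) k = s') \<partial>(square \<kappa>)) =
     measure \<kappa> (E s) * measure \<kappa> (E s')" for s s'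
  proof -
    have "(\<integral>z. of_bool (bits (fst z) k = s) * of_bool (bits (snd z) k = s') \<partial>(square \<kappa>)) =
      (\<integral>z. indicat_real (E s \<times> E s') z \<partial>(square \<kappa>))"
      by (rule Bochner_Integration.integral_cong[OF refl]) (simp add: indicator_def E_def mem_Times_iff)
    also have "\<dots> = measure (square \<kappa>) (E s \<times> E s')"
      by (simp add: space_pair_measure space_\<kappa>)
    also have "\<dots> = measure \<kappa> (E s) * measure \<kappa> (E s')"
      unfolding measure_def emeasure_pair_measure_Times[OF E E] by (rule enn2real_mult)
    finally show ?thesis .
  qed
  have "(\<integral>z. c (bits (fst z) k) (bits (snd z) k) \<partial>(square \<kappa>)) =
    (\<integral>z. (\<Sum>s | length s = k. \<Sum>s' | length s' = k.
       c s s' * (of_bool (bits (fst z) k = s) * of_bool (bits (snd z) k = s'))) \<partial>(square \<kappa>))"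
    by (subst prefix_fun_sum) simp
  also have "\<dots> = (\<Sum>s | length s = k. \<Sum>s' | length s' = k. c s s' *
      (measure \<kappa> (E s) * measure \<kappa> (E s')))"
    by (simp add: i e)
  also have "\<dots> = (\<Sum>s | length s = k. \<Sum>s' | length s' = k. c s s' *
      (measure \<kappa> {b. bits b (length s) = s} * measure \<kappa> {b. bits b (length s') = s'}))"
    by (intro sum.cong) (auto simp: E_def)
  finally show ?thesis .
qed

end

text \<open>After normalization by \<open>n ^ 2\<close>, the fourth power of the form is divided by
  \<open>n ^ 8\<close>, which cancels both factors \<open>n ^ 4\<close> of the bound.\<close>

lemma abs_average_le:
  fixes u :: real
  assumes "u ^ 4 \<le> real n ^ 4 * C" "C \<le> real n ^ 4 / real (Suc N)" "0 < n"
  shows "\<bar>u\<bar> / (real n)\<^sup>2 \<le> root 4 (1 / real (Suc N))"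
proof -
  have "u ^ 4 \<le> real n ^ 4 * (real n ^ 4 / real (Suc N))"
    using assms(1) mult_left_mono[OF assms(2), of "real n ^ 4"] by simp
  then have "(\<bar>u\<bar> / (real n)\<^sup>2) ^ 4 \<le> 1 / real (Suc N)"
    using assms(3) by (simp add: power_divide field_simps power_mult[symmetric] power_add[symmetric])
  then have "root 4 ((\<bar>u\<bar> / (real n)\<^sup>2) ^ 4) \<le> root 4 (1 / real (Suc N))"
    by (simp only: real_root_le_iff zero_less_numeral)
  then show ?thesis by (simp add: real_root_power_cancel)
qed

section \<open>Matched samples and the coupling\<close>

lemma (in prob_space) distr_square:
  assumes f: "f \<in> M \<rightarrow>\<^sub>M N"
  shows "distr M N f \<Otimes>\<^sub>M distr M N f = distr (square M) (square N) (\<lambda>z. (f (fst z), f (snd z)))"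
proof -
  interpret D: prob_space "distr M N f" using f by (rule prob_space_distr)
  show ?thesis
    using pair_measure_distr[OF f f D.sigma_finite_measure_axioms] by (simp add: split_def)
qed

lemma (in prob_space) square_measurable:
  assumes f: "f \<in> M \<rightarrow>\<^sub>M N"
  shows "(\<lambda>z. (f (fst z), f (snd z))) \<in> square M \<rightarrow>\<^sub>M square N"
  by (intro measurable_Pair measurable_compose[OF _ f]) auto

lemma (in prob_space) integral_square:
  fixes F :: "_ \<Rightarrow> real"
  assumes f: "f \<in> M \<rightarrow>\<^sub>M N" and F: "F \<in> borel_measurable (square N)"
  shows "(\<integral>z. F z \<partial>(distr M N f \<Otimes>\<^sub>M distr M N f)) = (\<integral>z. F (f (fst z), f (snd z)) \<partial>(square M))"
  unfolding distr_square[OF f] by (rule integral_distr[OF square_measurable[OF f] F])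

text \<open>Matrices that are typical for some sample of \<open>\<mu>\<close> have probability more than one half, and likewise
  for \<open>\<nu>\<close>. As the two laws agree, some matrix is typical for both; no coupling is needed here.\<close>

lemma matched_samples:
  fixes N :: nat
  assumes X: "kernel_space \<mu> d" and Y: "kernel_space \<nu> d'" and tau: "tau \<mu> d = tau \<nu> d'"
    and A: "\<And>m. A m \<in> sets \<mu>" and A': "\<And>m. A' m \<in> sets \<nu>"
    and f: "\<And>m. integrable (square \<mu>) (\<lambda>(x, y). f m x y)" "\<And>m x y. 0 \<le> f m x y"
    and f': "\<And>m. integrable (square \<nu>) (\<lambda>(x, y). f' m x y)" "\<And>m x y. 0 \<le> f' m x y"
    and \<epsilon>: "\<And>m. 0 < \<epsilon> m" "\<And>m. (\<integral>(x, y). f m x y \<partial>(square \<mu>)) \<le> \<epsilon> m / 2 ^ (m + 3)"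
      "\<And>m. (\<integral>(x, y). f' m x y \<partial>(square \<nu>)) \<le> \<epsilon> m / 2 ^ (m + 3)"
  shows "\<exists>n x y D. N < n \<and> x \<in> space (PiM UNIV (\<lambda>_. \<mu>)) \<and> y \<in> space (PiM UNIV (\<lambda>_. \<nu>)) \<and>
    kernel_space.typical \<mu> d t A f \<epsilon> N n x D \<and> kernel_space.typical \<nu> d' t A' f' \<epsilon> N n y D"
proof -
  interpret X: kernel_space \<mu> d by fact
  interpret Y: kernel_space \<nu> d' by fact
  interpret T: prob_space "tau \<mu> d" by (rule X.prob_space_tau)
  define n where "n = Suc (12 * Suc N ^ 3)"
  have n: "12 * Suc N ^ 3 < n" by (simp add: n_def)
  have "Suc N \<le> Suc N ^ 3" by (rule self_le_power) auto
  then have Nn: "N < n" unfolding n_def by linarith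
  let ?S = "{D \<in> space M_inf. \<forall>x\<in>space X.PX. \<not> X.typical t A f \<epsilon> N n x D}"
  let ?S' = "{D \<in> space M_inf. \<forall>x\<in>space Y.PX. \<not> Y.typical t A' f' \<epsilon> N n x D}"
  note u = X.tau_untypical[where A=A and f=f and \<epsilon>=\<epsilon> and t=t, OF A f \<epsilon>(1,2) n]
  note u' = Y.tau_untypical[where A=A' and f=f' and \<epsilon>=\<epsilon> and t=t, OF A' f' \<epsilon>(1,3) n]
  have "measure (tau \<mu> d) (?S \<union> ?S') \<le> measure (tau \<mu> d) ?S + measure (tau \<mu> d) ?S'"
    using u(1) u'(1) by (intro measure_Un_le) (auto simp: X.sets_tau)
  also have "\<dots> < 1" using u(2) u'(2) by (simp add: tau)
  finally have "?S \<union> ?S' \<noteq> space (tau \<mu> d)" using T.prob_space by auto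
  moreover have "space (tau \<mu> d) = space M_inf"
    using sets_eq_imp_space_eq[OF X.sets_tau] .
  ultimately obtain D where "D \<in> space M_inf" "D \<notin> ?S" "D \<notin> ?S'" by blast
  then obtain x y where "x \<in> space X.PX" "X.typical t A f \<epsilon> N n x D" "y \<in> space Y.PX" "Y.typical t A' f' \<epsilon> N n y D"
    by blast
  then show ?thesis using Nn by blast
qed

section \<open>Kernels seen through bit codes\<close>

locale coded_kernel = kernel_space \<mu> d for \<mu> :: "'a measure" and d +
  fixes e :: "'a \<Rightarrow> nat \<Rightarrow> bool" and g :: "(nat \<Rightarrow> bool) \<Rightarrow> 'a"
  assumes e: "e \<in> \<mu> \<rightarrow>\<^sub>M Bits" and g: "g \<in> Bits \<rightarrow>\<^sub>M \<mu>" and g_e: "x \<in> space \<mu> \<Longrightarrow> g (e x) = x"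
begin

text \<open>Going through \<open>g\<close> extends the kernel from codes of points to all pairs of
  bit sequences, so that it can be evaluated on any coupling.\<close>

definition coded_cdf :: "real \<Rightarrow> (nat \<Rightarrow> bool) \<times> (nat \<Rightarrow> bool) \<Rightarrow> real" where
  "coded_cdf t z = W t (g (fst z)) (g (snd z))"

abbreviation "K \<equiv> distr \<mu> Bits e"

lemma g_space: "g b \<in> space \<mu>"
  using measurable_space[OF g] by simp

lemma bits_measure_K: "bits_measure K"
  by (intro bits_measure.intro prob_space_distr e bits_measure_axioms.intro) simp

lemma coded_cdf_measurable: "coded_cdf t \<in> borel_measurable (square Bits)"
proof -
  have "(\<lambda>z. (g (fst z), g (snd z))) \<in> square Bits \<rightarrow>\<^sub>M square \<mu>"
    by (intro measurable_Pair measurable_compose[OF _ g]) auto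
  from measurable_compose[OF this W_measurable[of t]] show ?thesis by (simp add: coded_cdf_def[abs_def])
qed

lemma coded_cdf_bounds: "0 \<le> coded_cdf t z" "coded_cdf t z \<le> 1"
  unfolding coded_cdf_def by (rule cdf01_bounds[OF kernel_in[OF g_space g_space]])+

lemma coded_cdf_e: "x \<in> space \<mu> \<Longrightarrow> y \<in> space \<mu> \<Longrightarrow> coded_cdf t (e x, e y) = W t x y"
  by (simp add: coded_cdf_def g_e)

lemma step_measurable:
  "(\<lambda>z. c (bits (fst z) k) (bits (snd z) k) :: real) \<in> borel_measurable (square Bits)"
  by (rule measurable_compose_countable[OF _ measurable_compose[OF measurable_fst prefix_measurable[of k]],
        where f="\<lambda>s z. c s (bits (snd z) k)"],
      rule measurable_compose[OF measurable_compose[OF measurable_snd prefix_measurable[of k]]]) simp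

lemma step_approx:
  assumes "0 < \<epsilon>"
  shows "\<exists>k c C. (\<forall>s s'. \<bar>c s s'\<bar> \<le> C) \<and>
    (\<integral>z. \<bar>coded_cdf t z - c (bits (fst z) k) (bits (snd z) k)\<bar> \<partial>(square K)) < \<epsilon>"
proof -
  interpret K: bits_measure K by (rule bits_measure_K)
  have "coded_cdf t \<in> borel_measurable (square K)"
    using coded_cdf_measurable by (simp cong: measurable_cong_sets)
  then have "integrable (square K) (coded_cdf t)"
    using coded_cdf_bounds by (intro K.K.P.integrable_const_bound[where B=1]) auto
  from K.prefix_approx_integrable[OF this] show ?thesis
    using assms unfolding prefix_approx_def by blast
qed

definition step_error :: "real \<Rightarrow> nat \<Rightarrow> (bool list \<Rightarrow> bool list \<Rightarrow> real) \<Rightarrow> 'a \<Rightarrow> 'a \<Rightarrow> real" where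
  "step_error t k c x y = \<bar>W t x y - c (bits (e x) k) (bits (e y) k)\<bar>"

lemma step_error_integrable:
  assumes c: "\<forall>s s'. \<bar>c s s'\<bar> \<le> C"
  shows "integrable (square \<mu>) (\<lambda>(x, y). step_error t k c x y)"
    and "(\<integral>(x, y). step_error t k c x y \<partial>(square \<mu>)) =
      (\<integral>z. \<bar>coded_cdf t z - c (bits (fst z) k) (bits (snd z) k)\<bar> \<partial>(square K))"
proof -
  interpret P: pair_prob_space \<mu> \<mu> ..
  have m: "(\<lambda>z. \<bar>coded_cdf t z - c (bits (fst z) k) (bits (snd z) k)\<bar>) \<in> borel_measurable (square Bits)"
    using coded_cdf_measurable step_measurable by measurable
  have eq: "(case z of (x, y) \<Rightarrow> step_error t k c x y) =
      \<bar>coded_cdf t (e (fst z), e (snd z)) - c (bits (fst (e (fst z), e (snd z))) k) (bits (snd (e (fst z), e (snd z))) k)\<bar>"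
    if "z \<in> space (square \<mu>)" for z
    using that by (auto simp: step_error_def space_pair_measure coded_cdf_e)
  have "(\<lambda>z. case z of (x, y) \<Rightarrow> step_error t k c x y) \<in> borel_measurable (square \<mu>)"
    using measurable_compose[OF square_measurable[OF e] m] by (subst measurable_cong[OF eq])
  then show "integrable (square \<mu>) (\<lambda>(x, y). step_error t k c x y)"
  proof (rule P.P.integrable_const_bound[where B="1 + C", rotated])
    have "\<bar>coded_cdf t z - c s s'\<bar> \<le> 1 + C" for z s s'
      using coded_cdf_bounds[of t z] c[rule_format, of s s'] by linarith
    then show "AE z in square \<mu>. norm (case z of (x, y) \<Rightarrow> step_error t k c x y) \<le> 1 + C"
      by (intro AE_I2) (simp add: eq)
  qed
  show "(\<integral>(x, y). step_error t k c x y \<partial>(square \<mu>)) =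
      (\<integral>z. \<bar>coded_cdf t z - c (bits (fst z) k) (bits (snd z) k)\<bar> \<partial>(square K))"
    unfolding integral_square[OF e m] by (rule Bochner_Integration.integral_cong[OF refl eq])
qed

end

text \<open>Word frequencies converge along one subsequence for all words simultaneously. Their
  limits inherit total mass 1 and additivity over the two extensions of a word, so they are the
  cylinder weights of an image of Lebesgue measure.\<close>

lemma empirical_limit:
  fixes nn :: "nat \<Rightarrow> nat" and B :: "nat \<Rightarrow> nat \<Rightarrow> nat \<Rightarrow> bool"
  assumes nn: "\<And>N. 0 < nn N"
  obtains r \<Psi> where "strict_mono r" "\<Psi> \<in> lambda01 \<rightarrow>\<^sub>M Bits"
    "\<And>k c. (\<lambda>N. (\<Sum>i<nn (r N). \<Sum>j<nn (r N). c (bits (B (r N) i) k) (bits (B (r N) j) k)) / (real (nn (r N)))\<^sup>2)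
      \<longlonglongrightarrow> (\<integral>z. c (bits (fst z) k) (bits (snd z) k) \<partial>(distr lambda01 Bits \<Psi> \<Otimes>\<^sub>M distr lambda01 Bits \<Psi>))"
    "\<And>k R. (\<lambda>N. (\<Sum>i<nn (r N). of_bool (R (bits (B (r N) i) k))) / real (nn (r N)))
      \<longlonglongrightarrow> measure (distr lambda01 Bits \<Psi>) {b. R (bits b k)}"
proof -
  define p where "p N s = (\<Sum>i<nn N. of_bool (bits (B N i) (length s) = s)) / real (nn N)" for N s
  have p0: "0 \<le> p N s" for N s by (simp add: p_def sum_nonneg)
  have p1: "p N s \<le> 1" for N s
  proof -
    have "(\<Sum>i<nn N. of_bool (bits (B N i) (length s) = s)) \<le> (\<Sum>i<nn N. 1 :: real)"
      by (rule sum_mono) simp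
    then show ?thesis using nn[of N] by (simp add: p_def)
  qed
  obtain r l where r: "strict_mono r" and l: "\<And>s. (\<lambda>N. p (r N) s) \<longlonglongrightarrow> l s"
    using convergent_subseq_pointwise[of p, OF p0 p1] by blast
  have "p N [] = 1" for N using nn[of N] by (simp add: p_def bits_def)
  then have l_Nil: "l [] = 1" using LIMSEQ_unique[OF l[of "[]"]] by simp
  have l0: "0 \<le> l s" for s using LIMSEQ_le_const[OF l[of s]] p0 by blast
  have l_add: "l s = l (s @ [False]) + l (s @ [True])" for s
  proof -
    have "(of_bool (bits (B N i) (length s) = s) :: real) =
        of_bool (bits (B N i) (length (s @ [False])) = s @ [False]) +
        of_bool (bits (B N i) (length (s @ [True])) = s @ [True])" for N i
      by (auto simp: prefix_Suc)
    then have "p N s = p N (s @ [False]) + p N (s @ [True])" for N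
      unfolding p_def by (simp only: sum.distrib add_divide_distrib)
    then have "(\<lambda>N. p (r N) s) \<longlonglongrightarrow> l (s @ [False]) + l (s @ [True])"
      using tendsto_add[OF l[of "s @ [False]"] l[of "s @ [True]"]] by simp
    then show ?thesis by (rule LIMSEQ_unique[OF l])
  qed
  obtain \<Psi> where \<Psi>: "\<Psi> \<in> lambda01 \<rightarrow>\<^sub>M Bits"
    and \<Psi>l: "\<And>s. measure lambda01 {t \<in> space lambda01. bits (\<Psi> t) (length s) = s} = l s"
    using bits_from_cylinders[of l, OF l_Nil l0 l_add] by blast
  define \<kappa> where "\<kappa> = distr lambda01 Bits \<Psi>"
  interpret bits_measure \<kappa>
    unfolding \<kappa>_def
    by (intro bits_measure.intro prob_space.prob_space_distr prob_space_lambda01 \<Psi> bits_measure_axioms.intro) simp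
  have \<kappa>l: "measure \<kappa> {b. bits b (length s) = s} = l s" for s
  proof -
    have "measure \<kappa> {b. bits b (length s) = s} =
        measure lambda01 (\<Psi> -` {b. bits b (length s) = s} \<inter> space lambda01)"
      unfolding \<kappa>_def using \<Psi> prefix_pred_sets[of "\<lambda>u. u = s"] by (intro measure_distr) auto
    also have "\<Psi> -` {b. bits b (length s) = s} \<inter> space lambda01 = {t \<in> space lambda01. bits (\<Psi> t) (length s) = s}"
      by auto
    finally show ?thesis using \<Psi>l by simp
  qed
  show thesis
  proof (rule that[OF r \<Psi>])
    fix k :: nat and c :: "bool list \<Rightarrow> bool list \<Rightarrow> real"
    show "(\<lambda>N. (\<Sum>i<nn (r N). \<Sum>j<nn (r N). c (bits (B (r N) i) k) (bits (B (r N) j) k)) / (real (nn (r N)))\<^sup>2)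
      \<longlonglongrightarrow> (\<integral>z. c (bits (fst z) k) (bits (snd z) k) \<partial>(distr lambda01 Bits \<Psi> \<Otimes>\<^sub>M distr lambda01 Bits \<Psi>))"
      unfolding \<kappa>_def[symmetric] integral_prefix_fun2 sum2_prefix_frequency p_def[symmetric] \<kappa>l
      by (intro tendsto_sum tendsto_mult tendsto_const l)
  next
    fix k :: nat and R :: "bool list \<Rightarrow> bool"
    show "(\<lambda>N. (\<Sum>i<nn (r N). of_bool (R (bits (B (r N) i) k))) / real (nn (r N)))
      \<longlonglongrightarrow> measure (distr lambda01 Bits \<Psi>) {b. R (bits b k)}"
      unfolding \<kappa>_def[symmetric] measure_prefix_pred
        sum_prefix_frequency[of "\<lambda>s. of_bool (R s)"] p_def[symmetric] \<kappa>l
      by (intro tendsto_sum tendsto_mult tendsto_const l)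
  qed
qed

text \<open>Off the diagonal the errors are controlled on average. On the diagonal only a uniform
  bound is available, but its \<open>n\<close> terms disappear against \<open>n ^ 2\<close>.\<close>

lemma sum_diff_le_offdiag:
  fixes F G h h' :: "nat \<Rightarrow> nat \<Rightarrow> real"
  assumes "\<And>i j. i \<noteq> j \<Longrightarrow> \<bar>F i j - G i j\<bar> \<le> h i j + h' i j" and "\<And>i. \<bar>F i i - G i i\<bar> \<le> C"
  shows "\<bar>(\<Sum>i<n. \<Sum>j<n. F i j) - (\<Sum>i<n. \<Sum>j<n. G i j)\<bar> \<le> offdiag h n + offdiag h' n + real n * C"
proof -
  have "\<bar>(\<Sum>i<n. \<Sum>j<n. F i j) - (\<Sum>i<n. \<Sum>j<n. G i j)\<bar> = \<bar>\<Sum>i<n. \<Sum>j<n. F i j - G i j\<bar>"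
    by (simp add: sum_subtractf)
  also have "\<dots> \<le> (\<Sum>i<n. \<Sum>j<n. \<bar>F i j - G i j\<bar>)"
    by (rule order_trans[OF sum_abs]) (intro sum_mono sum_abs)
  also have "\<dots> \<le> (\<Sum>i<n. \<Sum>j<n. (if i = j then 0 else h i j) + (if i = j then 0 else h' i j) + (if i = j then C else 0))"
    by (intro sum_mono) (use assms in auto)
  also have "\<dots> = offdiag h n + offdiag h' n + real n * C"
    by (simp add: offdiag_def sum.distrib sum.delta)
  finally show ?thesis .
qed

text \<open>Both residuals contain the same Boolean entry of \<open>D\<close>, which cancels in
  their difference and leaves the difference of the two kernels. The bound collects two noise terms,
  two step errors and the diagonal.\<close>

lemma empirical_bound:
  fixes x :: "nat \<Rightarrow> 'a" and y :: "nat \<Rightarrow> 'b" and n N :: nat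
  assumes X: "coded_kernel \<mu> d e g" and Y: "coded_kernel \<nu> d' e' g'"
    and x: "x \<in> space (PiM UNIV (\<lambda>_. \<mu>))" and y: "y \<in> space (PiM UNIV (\<lambda>_. \<nu>))"
    and C4X: "C4 (resid (\<lambda>i j. D i j \<le> t) (\<lambda>i j. cdf01 (d (x i) (x j)) t)) n \<le> real n ^ 4 / real (Suc N)"
    and C4Y: "C4 (resid (\<lambda>i j. D i j \<le> t) (\<lambda>i j. cdf01 (d' (y i) (y j)) t)) n \<le> real n ^ 4 / real (Suc N)"
    and oX: "offdiag (\<lambda>i j. coded_kernel.step_error d e t k c (x i) (x j)) n \<le> \<epsilon> * (real n)\<^sup>2"
    and oY: "offdiag (\<lambda>i j. coded_kernel.step_error d' e' t k' c' (y i) (y j)) n \<le> \<epsilon> * (real n)\<^sup>2"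
    and c: "\<forall>s s'. \<bar>c s s'\<bar> \<le> C" "\<forall>s s'. \<bar>c' s s'\<bar> \<le> C'"
    and U: "\<And>i. \<bar>U i\<bar> \<le> 1" "\<And>i. \<bar>V i\<bar> \<le> 1" and n: "0 < n"
  shows "\<bar>\<Sum>i<n. \<Sum>j<n. (c (bits (e (x i)) k) (bits (e (x j)) k) - c' (bits (e' (y i)) k') (bits (e' (y j)) k')) * (U i * V j)\<bar>
     / (real n)\<^sup>2 \<le> 2 * root 4 (1 / real (Suc N)) + 2 * \<epsilon> + (C + C') / real n"
proof -
  interpret X: coded_kernel \<mu> d e g by fact
  interpret Y: coded_kernel \<nu> d' e' g' by fact
  define F where "F i j = (c (bits (e (x i)) k) (bits (e (x j)) k) - c' (bits (e' (y i)) k') (bits (e' (y j)) k')) * (U i * V j)" for i j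
  define SX where "SX = (\<Sum>i<n. \<Sum>j<n. X.noise t x D i j * U i * V j)"
  define SY where "SY = (\<Sum>i<n. \<Sum>j<n. Y.noise t y D i j * U i * V j)"
  \<comment> \<open>The order is reversed because \<open>resid\<close> subtracts the kernel: off the
    diagonal \<open>G\<close> contains the kernel of the first space minus that of the
    second.\<close>
  define G where "G i j = Y.noise t y D i j * U i * V j - X.noise t x D i j * U i * V j" for i j
  have UV: "\<bar>U i * V j\<bar> \<le> 1" for i j
    using U by (simp add: abs_mult mult_le_one)
  have bX: "\<bar>SX\<bar> / (real n)\<^sup>2 \<le> root 4 (1 / real (Suc N))"
    unfolding SX_def by (rule abs_average_le[OF bilinear_le_C4 C4X n]) (rule U)+
  have bY: "\<bar>SY\<bar> / (real n)\<^sup>2 \<le> root 4 (1 / real (Suc N))"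
    unfolding SY_def by (rule abs_average_le[OF bilinear_le_C4 C4Y n]) (rule U)+
  have "\<bar>F i j - G i j\<bar> \<le> X.step_error t k c (x i) (x j) + Y.step_error t k' c' (y i) (y j)" if "i \<noteq> j" for i j
  proof -
    have "F i j - G i j = ((c (bits (e (x i)) k) (bits (e (x j)) k) - X.W t (x i) (x j)) -
        (c' (bits (e' (y i)) k') (bits (e' (y j)) k') - Y.W t (y i) (y j))) * (U i * V j)"
      using that by (simp add: F_def G_def resid_def algebra_simps)
    also have "\<bar>\<dots>\<bar> \<le> \<bar>(c (bits (e (x i)) k) (bits (e (x j)) k) - X.W t (x i) (x j)) -
        (c' (bits (e' (y i)) k') (bits (e' (y j)) k') - Y.W t (y i) (y j))\<bar> * 1"
      unfolding abs_mult[of _ "U i * V j"] by (intro mult_left_mono UV) simp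
    also have "\<dots> \<le> X.step_error t k c (x i) (x j) + Y.step_error t k' c' (y i) (y j)"
    proof -
      have "\<bar>a - b - (a' - b')\<bar> * 1 \<le> \<bar>b - a\<bar> + \<bar>b' - a'\<bar>" for a b a' b' :: real
        using abs_triangle_ineq4[of "a - b" "a' - b'"] by (simp add: abs_minus_commute)
      then show ?thesis unfolding X.step_error_def Y.step_error_def .
    qed
    finally show ?thesis .
  qed
  moreover have "\<bar>F i i - G i i\<bar> \<le> C + C'" for i
  proof -
    have "\<bar>F i i - G i i\<bar> = \<bar>c (bits (e (x i)) k) (bits (e (x i)) k) - c' (bits (e' (y i)) k') (bits (e' (y i)) k')\<bar> * \<bar>U i * V i\<bar>"
      by (simp add: F_def G_def resid_def abs_mult)
    also have "\<dots> \<le> (C + C') * 1"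
    proof (rule mult_mono)
      show "\<bar>c (bits (e (x i)) k) (bits (e (x i)) k) - c' (bits (e' (y i)) k') (bits (e' (y i)) k')\<bar> \<le> C + C'"
        using c(1)[rule_format, of "bits (e (x i)) k" "bits (e (x i)) k"]
          c(2)[rule_format, of "bits (e' (y i)) k'" "bits (e' (y i)) k'"] by linarith
      then show "0 \<le> C + C'" by linarith
    qed (simp_all add: UV)
    finally show ?thesis by simp
  qed
  ultimately have "\<bar>(\<Sum>i<n. \<Sum>j<n. F i j) - (\<Sum>i<n. \<Sum>j<n. G i j)\<bar> \<le>
      offdiag (\<lambda>i j. X.step_error t k c (x i) (x j)) n + offdiag (\<lambda>i j. Y.step_error t k' c' (y i) (y j)) n + real n * (C + C')"
    by (rule sum_diff_le_offdiag)
  also have "\<dots> \<le> \<epsilon> * (real n)\<^sup>2 + \<epsilon> * (real n)\<^sup>2 + real n * (C + C')"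
    by (intro add_mono oX oY order_refl)
  finally have "\<bar>(\<Sum>i<n. \<Sum>j<n. F i j)\<bar> \<le> \<bar>\<Sum>i<n. \<Sum>j<n. G i j\<bar> + 2 * \<epsilon> * (real n)\<^sup>2 + real n * (C + C')"
    by linarith
  also have "(\<Sum>i<n. \<Sum>j<n. G i j) = SY - SX"
    by (simp add: G_def SX_def SY_def sum_subtractf)
  finally have "\<bar>(\<Sum>i<n. \<Sum>j<n. F i j)\<bar> \<le> \<bar>SX\<bar> + \<bar>SY\<bar> + 2 * \<epsilon> * (real n)\<^sup>2 + real n * (C + C')"
    by linarith
  then have "\<bar>(\<Sum>i<n. \<Sum>j<n. F i j)\<bar> / (real n)\<^sup>2 \<le>
      (\<bar>SX\<bar> + \<bar>SY\<bar> + 2 * \<epsilon> * (real n)\<^sup>2 + real n * (C + C')) / (real n)\<^sup>2"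
    by (rule divide_right_mono) simp
  also have "\<dots> = \<bar>SX\<bar> / (real n)\<^sup>2 + \<bar>SY\<bar> / (real n)\<^sup>2 + 2 * \<epsilon> + (C + C') / real n"
    using n by (simp add: add_divide_distrib power2_eq_square)
  finally show ?thesis using bX bY unfolding F_def by linarith
qed

text \<open>Stage \<open>N\<close> controls the words with code at most \<open>N\<close>, so each
  word is controlled from some stage on and its frequency tends to its probability. The assumption
  on \<open>R\<close> says that a prefix of \<open>\<pi> b\<close> is determined by a longer prefix
  of \<open>b\<close>, which makes it visible in the limit of frequencies.\<close>

lemma empirical_marginal:
  fixes \<rho> :: "'c measure" and w :: "nat \<Rightarrow> nat \<Rightarrow> 'c"
  assumes \<kappa>: "bits_measure \<kappa>" and \<pi>: "\<pi> \<in> Bits \<rightarrow>\<^sub>M Bits" and \<gamma>: "\<gamma> \<in> \<rho> \<rightarrow>\<^sub>M Bits" and \<rho>: "prob_space \<rho>"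
    and \<pi>B: "\<And>N i. \<pi> (B N i) = \<gamma> (w N i)" and w: "\<And>N i. w N i \<in> space \<rho>"
    and R: "\<And>k u. \<exists>R l. \<forall>b. bits (\<pi> b) k = u \<longleftrightarrow> R (bits b l)"
    and freq: "\<And>N u. to_nat u \<le> N \<Longrightarrow> \<bar>(\<Sum>i<nn N. indicator {x \<in> space \<rho>. bits (\<gamma> x) (length u) = u} (w N i)) / real (nn N)
        - measure \<rho> {x \<in> space \<rho>. bits (\<gamma> x) (length u) = u}\<bar> \<le> 1 / real (Suc N)"
    and r: "strict_mono r"
    and lim1: "\<And>k R. (\<lambda>N. (\<Sum>i<nn (r N). of_bool (R (bits (B (r N) i) k))) / real (nn (r N)))
      \<longlonglongrightarrow> measure \<kappa> {b. R (bits b k)}"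
  shows "distr \<kappa> Bits \<pi> = distr \<rho> Bits \<gamma>"
proof (rule bits_measure_eqI)
  interpret \<kappa>: bits_measure \<kappa> by fact
  have rN: "N \<le> r N" for N using r by (rule seq_suble)
  have \<pi>': "\<pi> \<in> \<kappa> \<rightarrow>\<^sub>M Bits"
    using \<pi> by (subst measurable_cong_sets[OF \<kappa>.sets_\<kappa> refl])
  show "bits_measure (distr \<kappa> Bits \<pi>)"
    by (intro bits_measure.intro \<kappa>.prob_space_distr \<pi>' bits_measure_axioms.intro) simp
  show "bits_measure (distr \<rho> Bits \<gamma>)"
    by (intro bits_measure.intro prob_space.prob_space_distr \<rho> \<gamma> bits_measure_axioms.intro) simp
  fix u :: "bool list"
  define m where "m = to_nat u"
  obtain R l where Rl: "\<And>b. bits (\<pi> b) (length u) = u \<longleftrightarrow> R (bits b l)" using R by metis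
  define U where "U = {x \<in> space \<rho>. bits (\<gamma> x) (length u) = u}"
  have "measure (distr \<kappa> Bits \<pi>) {b. bits b (length u) = u} = measure \<kappa> (\<pi> -` {b. bits b (length u) = u} \<inter> space \<kappa>)"
    by (intro measure_distr \<pi>') (use prefix_pred_sets[of "\<lambda>v. v = u"] in simp)
  also have "\<pi> -` {b. bits b (length u) = u} \<inter> space \<kappa> = {b. R (bits b l)}"
    using Rl by (auto simp: \<kappa>.space_\<kappa>)
  finally have 1: "measure (distr \<kappa> Bits \<pi>) {b. bits b (length u) = u} = measure \<kappa> {b. R (bits b l)}" .
  have "measure (distr \<rho> Bits \<gamma>) {b. bits b (length u) = u} = measure \<rho> (\<gamma> -` {b. bits b (length u) = u} \<inter> space \<rho>)"
    by (intro measure_distr \<gamma>) (use prefix_pred_sets[of "\<lambda>v. v = u"] in simp)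
  also have "\<gamma> -` {b. bits b (length u) = u} \<inter> space \<rho> = U" by (auto simp: U_def)
  finally have 2: "measure (distr \<rho> Bits \<gamma>) {b. bits b (length u) = u} = measure \<rho> U" .
  have "(\<lambda>N. (\<Sum>i<nn (r N). of_bool (R (bits (B (r N) i) l))) / real (nn (r N))) \<longlonglongrightarrow> measure \<rho> U"
  proof (rule LIMSEQ_I)
    fix q :: real assume "0 < q"
    then obtain M where M: "1 / real (Suc M) < q" using nat_approx_posE by blast
    have "norm ((\<Sum>i<nn (r N). of_bool (R (bits (B (r N) i) l))) / real (nn (r N)) - measure \<rho> U) < q"
      if N: "max m M \<le> N" for N
    proof -
      have "(\<Sum>i<nn (r N). of_bool (R (bits (B (r N) i) l))) = (\<Sum>i<nn (r N). indicator U (w (r N) i) :: real)"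
        unfolding Rl[symmetric] \<pi>B using w by (intro sum.cong) (auto simp: U_def indicator_def)
      moreover have "\<bar>(\<Sum>i<nn (r N). indicator U (w (r N) i)) / real (nn (r N)) - measure \<rho> U\<bar> \<le> 1 / real (Suc (r N))"
        using freq[of u "r N"] rN[of N] N unfolding m_def U_def by simp
      moreover have "1 / real (Suc (r N)) \<le> 1 / real (Suc M)"
        using rN[of N] N by (intro divide_left_mono) auto
      ultimately show ?thesis using M by simp
    qed
    then show "\<exists>no. \<forall>N\<ge>no. norm ((\<Sum>i<nn (r N). of_bool (R (bits (B (r N) i) l))) / real (nn (r N)) - measure \<rho> U) < q"
      by blast
  qed
  then have "measure \<kappa> {b. R (bits b l)} = measure \<rho> U"
    using LIMSEQ_unique[OF lim1[where k=l and R=R]] by blast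
  then show "measure (distr \<kappa> Bits \<pi>) {b. bits b (length u) = u} = measure (distr \<rho> Bits \<gamma>) {b. bits b (length u) = u}"
    using 1 2 by simp
qed

text \<open>The two step functions approximating the kernels have equal empirical sums up to noise along the
  matched samples, hence equal integrals in the limit.\<close>

lemma coupling_exists:
  fixes t :: "nat \<Rightarrow> real"
  assumes X: "coded_kernel \<mu> d e g" and Y: "coded_kernel \<nu> d' e' g'" and tau: "tau \<mu> d = tau \<nu> d'"
  obtains \<Psi> where "\<Psi> \<in> lambda01 \<rightarrow>\<^sub>M Bits"
    "distr lambda01 Bits (\<lambda>s. evens (\<Psi> s)) = distr \<mu> Bits e"
    "distr lambda01 Bits (\<lambda>s. odds (\<Psi> s)) = distr \<nu> Bits e'"
    "AE z in square lambda01. \<forall>a.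
       coded_kernel.coded_cdf d g (t a) (evens (\<Psi> (fst z)), evens (\<Psi> (snd z))) =
       coded_kernel.coded_cdf d' g' (t a) (odds (\<Psi> (fst z)), odds (\<Psi> (snd z)))"
proof -
  interpret X: coded_kernel \<mu> d e g by fact
  interpret Y: coded_kernel \<nu> d' e' g' by fact
  \<comment> \<open>The index \<open>m\<close> codes a threshold together with an accuracy, so every
    threshold occurs with every accuracy \<open>1 / (q + 1)\<close>.\<close>
  define \<epsilon> where "\<epsilon> m = 1 / real (Suc (snd (prod_decode m)))" for m
  have \<epsilon>0: "0 < \<epsilon> m" for m by (simp add: \<epsilon>_def)
  define th where "th m = t (fst (prod_decode m))" for m
  \<comment> \<open>The extra factor \<open>1 / 2 ^ (m + 3)\<close> pays for the union bound over
    all step errors.\<close>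
  have pos: "0 < \<epsilon> m / 2 ^ (m + 3)" for m using \<epsilon>0[of m] by simp
  define QX where "QX m k c C \<longleftrightarrow> (\<forall>s s'. \<bar>c s s'\<bar> \<le> (C :: real)) \<and>
      (\<integral>z. \<bar>X.coded_cdf (th m) z - c (bits (fst z) k) (bits (snd z) k)\<bar> \<partial>(square X.K)) < \<epsilon> m / 2 ^ (m + 3)" for m k c C
  have "\<forall>m. \<exists>k c C. QX m k c C"
    unfolding QX_def by (intro allI X.step_approx pos)
  then obtain k c C where QX: "\<And>m. QX m (k m) (c m) (C m)" by metis
  have c: "\<And>m. \<forall>s s'. \<bar>c m s s'\<bar> \<le> C m"
    "\<And>m. (\<integral>z. \<bar>X.coded_cdf (th m) z - c m (bits (fst z) (k m)) (bits (snd z) (k m))\<bar> \<partial>(square X.K)) < \<epsilon> m / 2 ^ (m + 3)"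
    using QX unfolding QX_def by blast+
  define QY where "QY m k c C \<longleftrightarrow> (\<forall>s s'. \<bar>c s s'\<bar> \<le> (C :: real)) \<and>
      (\<integral>z. \<bar>Y.coded_cdf (th m) z - c (bits (fst z) k) (bits (snd z) k)\<bar> \<partial>(square Y.K)) < \<epsilon> m / 2 ^ (m + 3)" for m k c C
  have "\<forall>m. \<exists>k c C. QY m k c C"
    unfolding QY_def by (intro allI Y.step_approx pos)
  then obtain k' c' C' where QY: "\<And>m. QY m (k' m) (c' m) (C' m)" by metis
  have c': "\<And>m. \<forall>s s'. \<bar>c' m s s'\<bar> \<le> C' m"
    "\<And>m. (\<integral>z. \<bar>Y.coded_cdf (th m) z - c' m (bits (fst z) (k' m)) (bits (snd z) (k' m))\<bar> \<partial>(square Y.K)) < \<epsilon> m / 2 ^ (m + 3)"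
    using QY unfolding QY_def by blast+
  \<comment> \<open>Enumerates all words; the word \<open>u\<close> is handled at index
    \<open>to_nat u\<close>.\<close>
  define s where "s m = (from_nat m :: bool list)" for m
  define A where "A m = {x \<in> space \<mu>. bits (e x) (length (s m)) = s m}" for m
  define A' where "A' m = {y \<in> space \<nu>. bits (e' y) (length (s m)) = s m}" for m
  have A: "A m \<in> sets \<mu>" for m
  proof -
    have "A m = e -` {b. bits b (length (s m)) = s m} \<inter> space \<mu>" by (auto simp: A_def)
    then show ?thesis using measurable_sets[OF X.e prefix_pred_sets[of "\<lambda>u. u = s m"]] by simp
  qed
  have A': "A' m \<in> sets \<nu>" for m
  proof -
    have "A' m = e' -` {b. bits b (length (s m)) = s m} \<inter> space \<nu>" by (auto simp: A'_def)
    then show ?thesis using measurable_sets[OF Y.e prefix_pred_sets[of "\<lambda>u. u = s m"]] by simp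
  qed
  define f where "f m = X.step_error (th m) (k m) (c m)" for m
  define f' where "f' m = Y.step_error (th m) (k' m) (c' m)" for m
  have f: "integrable (square \<mu>) (\<lambda>(x, y). f m x y)" "0 \<le> f m x y"
    "(\<integral>(x, y). f m x y \<partial>(square \<mu>)) \<le> \<epsilon> m / 2 ^ (m + 3)" for m x y
    using X.step_error_integrable[where t="th m" and k="k m", OF c(1)[of m]] c(2)[of m]
    by (simp_all add: f_def X.step_error_def)
  have f': "integrable (square \<nu>) (\<lambda>(x, y). f' m x y)" "0 \<le> f' m x y"
    "(\<integral>(x, y). f' m x y \<partial>(square \<nu>)) \<le> \<epsilon> m / 2 ^ (m + 3)" for m x y
    using Y.step_error_integrable[where t="th m" and k="k' m", OF c'(1)[of m]] c'(2)[of m]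
    by (simp_all add: f'_def Y.step_error_def)
  define QS where "QS N n x y D \<longleftrightarrow> N < n \<and> x \<in> space X.PX \<and> y \<in> space Y.PX \<and>
      X.typical t A f \<epsilon> N n x D \<and> Y.typical t A' f' \<epsilon> N n y D" for N n x y D
  have "\<exists>n x y D. QS N n x y D" for N
    unfolding QS_def
    by (rule matched_samples[OF X.kernel_space_axioms Y.kernel_space_axioms tau]) (rule A A' f f' \<epsilon>0)+
  then obtain nn x y D where QS: "\<And>N. QS N (nn N) (x N) (y N) (D N)" by metis
  have nn: "N < nn N" and x: "x N \<in> space X.PX" and y: "y N \<in> space Y.PX"
    and tX: "X.typical t A f \<epsilon> N (nn N) (x N) (D N)" and tY: "Y.typical t A' f' \<epsilon> N (nn N) (y N) (D N)" for N
    using QS[of N] unfolding QS_def by blast+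
  have nn0: "0 < nn N" for N using nn[of N] by simp
  define B where "B N i = interleave (e (x N i)) (e' (y N i))" for N i
  obtain r \<Psi> where r: "strict_mono r" and \<Psi>: "\<Psi> \<in> lambda01 \<rightarrow>\<^sub>M Bits"
    and lim2: "\<And>k c. (\<lambda>N. (\<Sum>i<nn (r N). \<Sum>j<nn (r N). c (bits (B (r N) i) k) (bits (B (r N) j) k)) / (real (nn (r N)))\<^sup>2)
      \<longlonglongrightarrow> (\<integral>z. c (bits (fst z) k) (bits (snd z) k) \<partial>(distr lambda01 Bits \<Psi> \<Otimes>\<^sub>M distr lambda01 Bits \<Psi>))"
    and lim1: "\<And>k R. (\<lambda>N. (\<Sum>i<nn (r N). of_bool (R (bits (B (r N) i) k))) / real (nn (r N)))
      \<longlonglongrightarrow> measure (distr lambda01 Bits \<Psi>) {b. R (bits b k)}"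
    using empirical_limit[of nn B, OF nn0] by blast
  have rN: "N \<le> r N" for N using r by (rule seq_suble)
  define \<kappa> where "\<kappa> = distr lambda01 Bits \<Psi>"
  interpret \<kappa>: bits_measure \<kappa>
    unfolding \<kappa>_def
    by (intro bits_measure.intro prob_space.prob_space_distr prob_space_lambda01 \<Psi> bits_measure_axioms.intro) simp
  interpret KX: bits_measure X.K by (rule X.bits_measure_K)
  interpret KY: bits_measure Y.K by (rule Y.bits_measure_K)
  have meas\<kappa>: "h \<in> \<kappa> \<rightarrow>\<^sub>M M" if "h \<in> Bits \<rightarrow>\<^sub>M M" for h M
    using that by (subst measurable_cong_sets[OF \<kappa>.sets_\<kappa> refl])
  have mX: "distr \<kappa> Bits evens = X.K"
  proof (rule empirical_marginal[where w=x and B=B and nn=nn and r=r])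
    show "\<exists>R l. \<forall>b. bits (evens b) k = u \<longleftrightarrow> R (bits b l)" for k u
      using prefix_evens[of k "2 * k"]
      by (intro exI[of _ "\<lambda>v. map (\<lambda>n. v ! (2 * n)) [0..<k] = u"] exI[of _ "2 * k"]) simp
    show "\<bar>(\<Sum>i<nn N. indicator {x \<in> space \<mu>. bits (e x) (length u) = u} (x N i)) / real (nn N)
        - measure \<mu> {x \<in> space \<mu>. bits (e x) (length u) = u}\<bar> \<le> 1 / real (Suc N)" if "to_nat u \<le> N" for N u
    proof -
      have "A (to_nat u) = {x \<in> space \<mu>. bits (e x) (length u) = u}" by (simp add: A_def s_def)
      then show ?thesis using tX[of N] that unfolding X.typical_def by metis
    qed
    show "(\<lambda>N. (\<Sum>i<nn (r N). of_bool (R (bits (B (r N) i) k))) / real (nn (r N)))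
      \<longlonglongrightarrow> measure \<kappa> {b. R (bits b k)}" for k R
      unfolding \<kappa>_def by (rule lim1)
  qed (auto simp: B_def evens_measurable X.e X.prob_space_axioms \<kappa>.bits_measure_axioms r intro: X.space_PX_D[OF x])
  have mY: "distr \<kappa> Bits odds = Y.K"
  proof (rule empirical_marginal[where w=y and B=B and nn=nn and r=r])
    show "\<exists>R l. \<forall>b. bits (odds b) k = u \<longleftrightarrow> R (bits b l)" for k u
      using prefix_odds[of k "2 * k"]
      by (intro exI[of _ "\<lambda>v. map (\<lambda>n. v ! (Suc (2 * n))) [0..<k] = u"] exI[of _ "2 * k"]) simp
    show "\<bar>(\<Sum>i<nn N. indicator {x \<in> space \<nu>. bits (e' x) (length u) = u} (y N i)) / real (nn N)
        - measure \<nu> {x \<in> space \<nu>. bits (e' x) (length u) = u}\<bar> \<le> 1 / real (Suc N)" if "to_nat u \<le> N" for N u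
    proof -
      have "A' (to_nat u) = {x \<in> space \<nu>. bits (e' x) (length u) = u}" by (simp add: A'_def s_def)
      then show ?thesis using tY[of N] that unfolding Y.typical_def by metis
    qed
    show "(\<lambda>N. (\<Sum>i<nn (r N). of_bool (R (bits (B (r N) i) k))) / real (nn (r N)))
      \<longlonglongrightarrow> measure \<kappa> {b. R (bits b k)}" for k R
      unfolding \<kappa>_def by (rule lim1)
  qed (auto simp: B_def odds_measurable Y.e Y.prob_space_axioms \<kappa>.bits_measure_axioms r intro: Y.space_PX_D[OF y])
  define ev where "ev z = (evens (fst z), evens (snd z))" for z
  define od where "od z = (odds (fst z), odds (snd z))" for z
  have ev: "ev \<in> square \<kappa> \<rightarrow>\<^sub>M square Bits"
    unfolding ev_def[abs_def] by (rule \<kappa>.square_measurable[OF meas\<kappa>[OF evens_measurable]])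
  have od: "od \<in> square \<kappa> \<rightarrow>\<^sub>M square Bits"
    unfolding od_def[abs_def] by (rule \<kappa>.square_measurable[OF meas\<kappa>[OF odds_measurable]])
  have intX: "(\<integral>z. F z \<partial>(square X.K)) = (\<integral>z. F (ev z) \<partial>(square \<kappa>))"
    if "F \<in> borel_measurable (square Bits)" for F :: "_ \<Rightarrow> real"
    unfolding ev_def mX[symmetric] by (rule \<kappa>.integral_square[OF meas\<kappa>[OF evens_measurable] that])
  have intY: "(\<integral>z. F z \<partial>(square Y.K)) = (\<integral>z. F (od z) \<partial>(square \<kappa>))"
    if "F \<in> borel_measurable (square Bits)" for F :: "_ \<Rightarrow> real"
    unfolding od_def mY[symmetric] by (rule \<kappa>.integral_square[OF meas\<kappa>[OF odds_measurable] that])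
  have AEa: "AE z in square \<kappa>. X.coded_cdf (t a) (ev z) - Y.coded_cdf (t a) (od z) = 0" for a
  proof (rule \<kappa>.AE_zero_if_orthogonal)
    let ?G = "\<lambda>z. X.coded_cdf (t a) (ev z) - Y.coded_cdf (t a) (od z)"
    have Gm: "?G \<in> borel_measurable (square \<kappa>)"
      using measurable_compose[OF ev X.coded_cdf_measurable] measurable_compose[OF od Y.coded_cdf_measurable] by simp
    show "?G \<in> borel_measurable (square \<kappa>)" by (rule Gm)
    have Gb: "\<bar>?G z\<bar> \<le> 1" for z
      using X.coded_cdf_bounds[of "t a" "ev z"] Y.coded_cdf_bounds[of "t a" "od z"] by linarith
    show "\<bar>?G z\<bar> \<le> 1" for z by (rule Gb)
    fix k0 :: nat and u u' :: "bool list"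
    define v where "v z = (of_bool (bits (fst z) k0 = u) * of_bool (bits (snd z) k0 = u') :: real)" for z
    have vm: "v \<in> borel_measurable (square \<kappa>)"
      unfolding v_def[abs_def] by (rule \<kappa>.prefix_fun_measurable[of "\<lambda>p q. of_bool (p = u) * of_bool (q = u')"])
    have vb: "\<bar>v z\<bar> \<le> 1" for z by (simp add: v_def)
    \<comment> \<open>Two errors \<open>\<epsilon> m\<close> come from replacing the kernels by step
      functions on the coupling, two more from doing so along the samples; noise and diagonal vanish
      in the limit.\<close>
    have main: "\<bar>\<integral>z. ?G z * v z \<partial>(square \<kappa>)\<bar> \<le> 4 / real (Suc q)" for q
    proof -
      define m where "m = prod_encode (a, q)"
      have th_m: "th m = t a" and \<epsilon>m: "\<epsilon> m = 1 / real (Suc q)" by (simp_all add: th_def \<epsilon>_def m_def)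
      \<comment> \<open>Noise is listed under the threshold index \<open>a\<close>, step errors
        under \<open>m\<close>; by this inequality both constraints are active from stage
        \<open>m\<close> on.\<close>
      have am: "a \<le> m" unfolding m_def by (rule le_prod_encode_1)
      define SX where "SX z = c m (bits (fst z) (k m)) (bits (snd z) (k m))" for z
      define SY where "SY z = c' m (bits (fst z) (k' m)) (bits (snd z) (k' m))" for z
      have SXm: "SX \<in> borel_measurable (square Bits)" unfolding SX_def[abs_def] by (rule X.step_measurable)
      have SYm: "SY \<in> borel_measurable (square Bits)" unfolding SY_def[abs_def] by (rule Y.step_measurable)
      have SXb: "\<bar>SX z\<bar> \<le> C m" for z using c(1) by (simp add: SX_def)
      have SYb: "\<bar>SY z\<bar> \<le> C' m" for z using c'(1) by (simp add: SY_def)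
      define ErX where "ErX z = \<bar>X.coded_cdf (t a) z - SX z\<bar>" for z
      define ErY where "ErY z = \<bar>Y.coded_cdf (t a) z - SY z\<bar>" for z
      have EXm: "ErX \<in> borel_measurable (square Bits)" unfolding ErX_def[abs_def] using SXm X.coded_cdf_measurable by measurable
      have EYm: "ErY \<in> borel_measurable (square Bits)" unfolding ErY_def[abs_def] using SYm Y.coded_cdf_measurable by measurable
      have small: "\<epsilon> m / 2 ^ (m + 3) \<le> \<epsilon> m"
      proof -
        have "1 * \<epsilon> m \<le> 2 ^ (m + 3) * \<epsilon> m" using \<epsilon>0[of m] by (intro mult_right_mono) (auto simp: one_le_power)
        then show ?thesis by (simp add: field_simps)
      qed
      have IX: "(\<integral>z. ErX (ev z) \<partial>(square \<kappa>)) \<le> \<epsilon> m"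
        using intX[OF EXm] c(2)[of m] small by (simp add: ErX_def SX_def th_m)
      have IY: "(\<integral>z. ErY (od z) \<partial>(square \<kappa>)) \<le> \<epsilon> m"
        using intY[OF EYm] c'(2)[of m] small by (simp add: ErY_def SY_def th_m)
      have EXb: "\<bar>ErX z\<bar> \<le> 1 + C m" for z using SXb[of z] X.coded_cdf_bounds[of "t a" z] unfolding ErX_def by linarith
      have EYb: "\<bar>ErY z\<bar> \<le> 1 + C' m" for z using SYb[of z] Y.coded_cdf_bounds[of "t a" z] unfolding ErY_def by linarith
      have EXi: "integrable (square \<kappa>) (\<lambda>z. ErX (ev z))"
        using measurable_compose[OF ev EXm] EXb by (intro \<kappa>.K.P.integrable_const_bound[where B="1 + C m"]) auto
      have EYi: "integrable (square \<kappa>) (\<lambda>z. ErY (od z))"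
        using measurable_compose[OF od EYm] EYb by (intro \<kappa>.K.P.integrable_const_bound[where B="1 + C' m"]) auto
      define T where "T z = (SX (ev z) - SY (od z)) * v z" for z
      have Tb: "\<bar>T z\<bar> \<le> C m + C' m" for z
      proof -
        have "\<bar>T z\<bar> \<le> (C m + C' m) * 1" unfolding T_def abs_mult
        proof (rule mult_mono)
          show "\<bar>SX (ev z) - SY (od z)\<bar> \<le> C m + C' m"
            using SXb[of "ev z"] SYb[of "od z"] by linarith
          then show "0 \<le> C m + C' m" by linarith
        qed (simp_all add: vb)
        then show ?thesis by simp
      qed
      have Ti: "integrable (square \<kappa>) T"
        using measurable_compose[OF ev SXm] measurable_compose[OF od SYm] vm Tb
        by (intro \<kappa>.K.P.integrable_const_bound[where B="C m + C' m"]) (auto simp: T_def[abs_def])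
      have Gv: "integrable (square \<kappa>) (\<lambda>z. ?G z * v z)"
        using Gm vm
      proof (intro \<kappa>.K.P.integrable_const_bound[where B=1])
        show "AE z in square \<kappa>. norm (?G z * v z) \<le> 1"
          unfolding real_norm_def abs_mult by (intro AE_I2 mult_le_one Gb vb) simp
      qed simp
      have "\<bar>(\<integral>z. ?G z * v z \<partial>(square \<kappa>)) - (\<integral>z. T z \<partial>(square \<kappa>))\<bar> = \<bar>\<integral>z. ?G z * v z - T z \<partial>(square \<kappa>)\<bar>"
        using Gv Ti by simp
      also have "\<dots> \<le> (\<integral>z. \<bar>?G z * v z - T z\<bar> \<partial>(square \<kappa>))"
        by (rule integral_abs_bound)
      also have "\<dots> \<le> (\<integral>z. ErX (ev z) + ErY (od z) \<partial>(square \<kappa>))"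
      proof (rule integral_mono)
        fix z
        have "?G z * v z - T z = ((X.coded_cdf (t a) (ev z) - SX (ev z)) - (Y.coded_cdf (t a) (od z) - SY (od z))) * v z"
          by (simp add: T_def algebra_simps)
        also have "\<bar>\<dots>\<bar> \<le> \<bar>(X.coded_cdf (t a) (ev z) - SX (ev z)) - (Y.coded_cdf (t a) (od z) - SY (od z))\<bar> * 1"
          unfolding abs_mult[of _ "v z"] by (intro mult_left_mono vb) simp
        also have "\<dots> \<le> ErX (ev z) + ErY (od z)"
          unfolding ErX_def ErY_def mult_1_right by (rule abs_triangle_ineq4)
        finally show "\<bar>?G z * v z - T z\<bar> \<le> ErX (ev z) + ErY (od z)" .
      qed (use Gv Ti EXi EYi in auto)
      also have "\<dots> \<le> 2 * \<epsilon> m" using EXi EYi IX IY by simp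
      finally have GT: "\<bar>(\<integral>z. ?G z * v z \<partial>(square \<kappa>)) - (\<integral>z. T z \<partial>(square \<kappa>))\<bar> \<le> 2 * \<epsilon> m" .
      \<comment> \<open>Deep enough to read \<open>k0\<close> bits of the interleaved sequence,
        \<open>k m\<close> of its even and \<open>k' m\<close> of its odd positions.\<close>
      define l where "l = k0 + 2 * k m + 2 * k' m"
      define c2 where "c2 p p' = (c m (map (\<lambda>n. p ! (2 * n)) [0..<k m]) (map (\<lambda>n. p' ! (2 * n)) [0..<k m]) -
          c' m (map (\<lambda>n. p ! (Suc (2 * n))) [0..<k' m]) (map (\<lambda>n. p' ! (Suc (2 * n))) [0..<k' m])) *
          (of_bool (take k0 p = u) * of_bool (take k0 p' = u'))" for p p'
      have c2: "c2 (bits b l) (bits b' l) = (c m (bits (evens b) (k m)) (bits (evens b') (k m)) -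
          c' m (bits (odds b) (k' m)) (bits (odds b') (k' m))) * (of_bool (bits b k0 = u) * of_bool (bits b' k0 = u'))" for b b'
        by (simp add: c2_def prefix_evens[of "k m" l] prefix_odds[of "k' m" l] take_prefix l_def)
      have T_c2: "T z = c2 (bits (fst z) l) (bits (snd z) l)" for z
        by (simp add: T_def c2 SX_def SY_def ev_def od_def v_def)
      define S where "S N = (\<Sum>i<nn (r N). \<Sum>j<nn (r N). c2 (bits (B (r N) i) l) (bits (B (r N) j) l)) / (real (nn (r N)))\<^sup>2" for N
      have S_lim: "S \<longlonglongrightarrow> (\<integral>z. T z \<partial>(square \<kappa>))"
        unfolding S_def[abs_def] T_c2 \<kappa>_def by (rule lim2)
      have S_bd: "\<bar>S N\<bar> \<le> 2 * root 4 (1 / real (Suc (r N))) + 2 * \<epsilon> m + (C m + C' m) / real (nn (r N))" if "m \<le> N" for N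
      proof -
        let ?n = "nn (r N)"
        have mr: "m \<le> r N" using rN[of N] that by simp
        have tx: "C4 (X.noise (t a) (x (r N)) (D (r N))) ?n \<le> real ?n ^ 4 / real (Suc (r N))"
          "offdiag (\<lambda>i j. f m (x (r N) i) (x (r N) j)) ?n \<le> \<epsilon> m * (real ?n)\<^sup>2"
          using tX[of "r N"] mr am unfolding X.typical_def by (meson le_trans)+
        have ty: "C4 (Y.noise (t a) (y (r N)) (D (r N))) ?n \<le> real ?n ^ 4 / real (Suc (r N))"
          "offdiag (\<lambda>i j. f' m (y (r N) i) (y (r N) j)) ?n \<le> \<epsilon> m * (real ?n)\<^sup>2"
          using tY[of "r N"] mr am unfolding Y.typical_def by (meson le_trans)+
        \<comment> \<open>The test weights depend on both samples, which were selected together with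
          \<open>D\<close>; the estimate applies because it is uniform in the weights.\<close>
        have "\<bar>\<Sum>i<?n. \<Sum>j<?n. (c m (bits (e (x (r N) i)) (k m)) (bits (e (x (r N) j)) (k m)) -
             c' m (bits (e' (y (r N) i)) (k' m)) (bits (e' (y (r N) j)) (k' m))) *
             (of_bool (bits (B (r N) i) k0 = u) * of_bool (bits (B (r N) j) k0 = u'))\<bar> / (real ?n)\<^sup>2
           \<le> 2 * root 4 (1 / real (Suc (r N))) + 2 * \<epsilon> m + (C m + C' m) / real ?n"
          by (rule empirical_bound[OF X Y x y tx(1) ty(1) tx(2)[unfolded f_def th_m] ty(2)[unfolded f'_def th_m] c(1) c'(1) _ _ nn0])
            simp_all
        then show ?thesis by (simp add: S_def c2 B_def)
      qed
      have bd_lim: "(\<lambda>N. 2 * root 4 (1 / real (Suc (r N))) + 2 * \<epsilon> m + (C m + C' m) / real (nn (r N)))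
          \<longlonglongrightarrow> 2 * root 4 0 + 2 * \<epsilon> m + 0"
      proof (intro tendsto_add tendsto_mult tendsto_const tendsto_real_root)
        have "filterlim r sequentially sequentially" using r by (rule filterlim_subseq)
        from filterlim_compose[OF LIMSEQ_inverse_real_of_nat this]
        show "(\<lambda>N. 1 / real (Suc (r N))) \<longlonglongrightarrow> 0" by (simp add: inverse_eq_divide)
        have "filterlim (\<lambda>N. nn (r N)) sequentially sequentially"
        proof (rule filterlim_at_top_mono[OF filterlim_ident])
          show "eventually (\<lambda>N. N \<le> nn (r N)) sequentially"
            using rN nn by (intro always_eventually allI) (meson le_trans less_imp_le)
        qed
        then have "filterlim (\<lambda>N. real (nn (r N))) at_top sequentially"
          by (rule filterlim_compose[OF filterlim_real_sequentially])
        then show "(\<lambda>N. (C m + C' m) / real (nn (r N))) \<longlonglongrightarrow> 0"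
          by (rule real_tendsto_divide_at_top[OF tendsto_const])
      qed
      have "\<bar>\<integral>z. T z \<partial>(square \<kappa>)\<bar> \<le> 2 * root 4 0 + 2 * \<epsilon> m + 0"
        by (rule tendsto_le[OF sequentially_bot bd_lim tendsto_rabs[OF S_lim]])
          (use S_bd in \<open>auto simp: eventually_sequentially\<close>)
      then show ?thesis using GT by (simp add: \<epsilon>m)
    qed
    have "(\<integral>z. ?G z * v z \<partial>(square \<kappa>)) = 0"
    proof (rule ccontr)
      assume "(\<integral>z. ?G z * v z \<partial>(square \<kappa>)) \<noteq> 0"
      then have "0 < \<bar>\<integral>z. ?G z * v z \<partial>(square \<kappa>)\<bar> / 4" by simp
      then obtain q where "1 / real (Suc q) < \<bar>\<integral>z. ?G z * v z \<partial>(square \<kappa>)\<bar> / 4"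
        using nat_approx_posE by blast
      with main[of q] show False by simp
    qed
    then show "(\<integral>z. ?G z * (of_bool (bits (fst z) k0 = u) * of_bool (bits (snd z) k0 = u')) \<partial>(square \<kappa>)) = 0"
      by (simp add: v_def)
  qed
  interpret L: prob_space lambda01 by (rule prob_space_lambda01)
  have "AE z in square \<kappa>. \<forall>a. X.coded_cdf (t a) (ev z) = Y.coded_cdf (t a) (od z)"
    unfolding AE_all_countable using AEa by (auto simp: algebra_simps)
  then have "AE z in distr (square lambda01) (square Bits) (\<lambda>z. (\<Psi> (fst z), \<Psi> (snd z))).
      \<forall>a. X.coded_cdf (t a) (ev z) = Y.coded_cdf (t a) (od z)"
    unfolding \<kappa>_def L.distr_square[OF \<Psi>] .
  then have "AE z in square lambda01. \<forall>a.
      X.coded_cdf (t a) (ev (\<Psi> (fst z), \<Psi> (snd z))) = Y.coded_cdf (t a) (od (\<Psi> (fst z), \<Psi> (snd z)))"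
    by (rule AE_distrD[OF L.square_measurable[OF \<Psi>]])
  then have AE: "AE z in square lambda01. \<forall>a.
      X.coded_cdf (t a) (evens (\<Psi> (fst z)), evens (\<Psi> (snd z))) = Y.coded_cdf (t a) (odds (\<Psi> (fst z)), odds (\<Psi> (snd z)))"
    by (simp add: ev_def od_def)
  have "distr lambda01 Bits (\<lambda>s. evens (\<Psi> s)) = X.K"
    using mX distr_distr[OF evens_measurable \<Psi>] by (simp add: \<kappa>_def o_def)
  moreover have "distr lambda01 Bits (\<lambda>s. odds (\<Psi> s)) = Y.K"
    using mY distr_distr[OF odds_measurable \<Psi>] by (simp add: \<kappa>_def o_def)
  ultimately show thesis using that[OF \<Psi>] AE by blast
qed

section \<open>From the box distance to the matrix laws\<close>

text \<open>Lipschitz functions are not uniformly bounded, but on the unit interval they differ from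
  their value at 0 by at most 1. Centring at \<open>f 0\<close> gives a bound independent of
  \<open>f\<close>.\<close>

lemma lipschitz_integrable_P_I01:
  fixes f :: "real \<Rightarrow> real"
  assumes p: "p \<in> space (prob_algebra I01)" and f: "1-lipschitz_on {0..1} f"
  shows "integrable p f" "\<bar>(\<integral>x. f x \<partial>p) - f 0\<bar> \<le> 1"
proof -
  interpret prob_space p using p by (rule P_I01D)
  have "f \<in> borel_measurable I01"
    unfolding I01_def
    by (rule borel_measurable_continuous_on_restrict) (rule lipschitz_on_continuous_on[OF f])
  moreover have fb: "\<bar>f x - f 0\<bar> \<le> 1" if "x \<in> {0..1}" for x
    using lipschitz_onD[OF f that, of 0] that by (simp add: dist_real_def)
  then have "\<bar>f x\<bar> \<le> 1 + \<bar>f 0\<bar>" if "x \<in> {0..1}" for x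
    using that[THEN fb] by linarith
  ultimately show int: "integrable p f"
    by (rule integrable_P_I01[OF p])
  have "(\<integral>x. f x \<partial>p) - f 0 = (\<integral>x. f x - f 0 \<partial>p)"
    using int by (simp add: prob_space)
  also have "\<bar>\<dots>\<bar> \<le> (\<integral>x. \<bar>f x - f 0\<bar> \<partial>p)" by (rule integral_abs_bound)
  also have "\<dots> \<le> 1"
    using int fb by (intro integral_le_const AE_I2) (auto simp: P_I01D[OF p])
  finally show "\<bar>(\<integral>x. f x \<partial>p) - f 0\<bar> \<le> 1" .
qed

text \<open>A real supremum is known to dominate its terms only for a bounded family. Comparing both
  integrals with \<open>f 0\<close> bounds this family by 2.\<close>

lemma d_ext_upper:
  fixes f :: "real \<Rightarrow> real"
  assumes p: "p \<in> space (prob_algebra I01)" and q: "q \<in> space (prob_algebra I01)"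
    and f: "1-lipschitz_on {0..1} f"
  shows "\<bar>(\<integral>x. f x \<partial>p) - (\<integral>x. f x \<partial>q)\<bar> \<le> d_ext p q"
  unfolding d_ext_def
proof (rule cSUP_upper)
  show "f \<in> {f. 1-lipschitz_on {0..1} f}" using f by simp
  have g2: "\<bar>(\<integral>x. g x \<partial>p) - (\<integral>x. g x \<partial>q)\<bar> \<le> 2" if "1-lipschitz_on {0..1} g" for g :: "real \<Rightarrow> real"
    using lipschitz_integrable_P_I01(2)[OF p that] lipschitz_integrable_P_I01(2)[OF q that] by linarith
  show "bdd_above ((\<lambda>f :: real \<Rightarrow> real. \<bar>(\<integral>x. f x \<partial>p) - (\<integral>x. f x \<partial>q)\<bar>) ` {f. 1-lipschitz_on {0..1} f})"
    by (rule bdd_aboveI2[where M=2]) (use g2 in simp)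
qed

lemma d_ext_self: "d_ext p p = 0"
proof -
  have "1-lipschitz_on {0..1} (\<lambda>_ :: real. 0 :: real)"
    by (rule lipschitz_onI) auto
  then have "{f :: real \<Rightarrow> real. 1-lipschitz_on {0..1} f} \<noteq> {}" by blast
  then show ?thesis by (simp add: d_ext_def)
qed

lemma ramp_integral_diff:
  assumes p: "p \<in> space (prob_algebra I01)" and q: "q \<in> space (prob_algebra I01)"
  shows "\<bar>(\<integral>r. ramp (real k) a r \<partial>p) - (\<integral>r. ramp (real k) a r \<partial>q)\<bar> \<le> real k * d_ext p q"
proof (cases "k = 0")
  case True
  have "ramp 0 a = (\<lambda>_. 1)" by (simp add: ramp_def fun_eq_iff)
  moreover interpret p: prob_space p using p by (rule P_I01D)
  interpret q: prob_space q using q by (rule P_I01D)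
  show ?thesis using True calculation by (simp add: p.prob_space q.prob_space)
next
  case False
  define f where "f r = ramp (real k) a r / real k" for r
  have "1-lipschitz_on {0..1} f"
  proof (rule lipschitz_onI)
    fix x y :: real assume "x \<in> {0..1}" "y \<in> {0..1}"
    then have "dist (ramp (real k) a x) (ramp (real k) a y) \<le> real k * dist x y"
      by (intro lipschitz_onD[OF ramp_lipschitz[of "real k" "{0..1}" a]]) auto
    then show "dist (f x) (f y) \<le> 1 * dist x y"
      using False by (simp add: f_def dist_real_def field_simps flip: diff_divide_distrib)
  qed simp
  from d_ext_upper[OF p q this] show ?thesis
    using False by (simp add: f_def field_simps flip: diff_divide_distrib)
qed

text \<open>Boxes constrain only the entries above the diagonal, which determine a matrix in \<open>M_inf\<close>.\<close>

definition M_inf_box :: "nat \<Rightarrow> (nat \<times> nat \<Rightarrow> real) \<Rightarrow> (nat \<Rightarrow> nat \<Rightarrow> real) set" where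
  "M_inf_box n a = {D \<in> space M_inf. \<forall>i j. i < j \<and> j < n \<longrightarrow> D i j \<le> a (i, j)}"

lemma M_inf_box_sets: "M_inf_box n a \<in> sets M_inf"
  unfolding M_inf_box_def by measurable

lemma sets_M_inf_generator: "sets M_inf = sigma_sets (space M_inf) {M_inf_box n a | n a. True}" (is "_ = sigma_sets _ ?G")
proof
  have G: "?G \<subseteq> Pow (space M_inf)" by (auto simp: M_inf_box_def)
  define S where "S = sigma (space M_inf) ?G"
  have sS: "sets S = sigma_sets (space M_inf) ?G" "space S = space M_inf"
    unfolding S_def using G by (simp_all add: sets_measure_of space_measure_of)
  have lt: "(\<lambda>D. D i j) \<in> borel_measurable S" if "i < j" for i j
  proof (rule borel_measurableI_le)
    fix y :: real
    \<comment> \<open>On \<open>M_inf\<close> the bound 1 is vacuous, so a box can isolate one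
      entry; \<open>Suc j\<close> is the least size that contains column \<open>j\<close>.\<close>
    have "{D \<in> space S. D i j \<le> y} = M_inf_box (Suc j) ((\<lambda>_. 1)((i, j) := y))"
      using that by (auto simp: M_inf_box_def sS space_M_inf)
    also have "\<dots> \<in> sets S" unfolding sS by (intro sigma_sets.Basic) blast
    finally show "{D \<in> space S. D i j \<le> y} \<in> sets S" .
  qed
  have "(\<lambda>D. D i j) \<in> borel_measurable S" for i j
  proof (cases i j rule: linorder_cases)
    case less
    then show ?thesis by (rule lt)
  next
    case equal
    then have "D i j = 0" if "D \<in> space S" for D using that by (simp add: sS space_M_inf)
    then show ?thesis by (subst measurable_cong[where g="\<lambda>_. 0"]) auto
  next
    case greater
    have "D i j = D j i" if "D \<in> space S" for D using that by (simp add: sS space_M_inf)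
    then show ?thesis using lt[OF greater] by (subst measurable_cong[where g="\<lambda>D. D j i"]) auto
  qed
  then have "(\<lambda>D. D) \<in> S \<rightarrow>\<^sub>M M_inf"
    by (rule measurable_M_infI) (simp add: sS)
  then have m: "(\<lambda>D. D) -` X \<inter> space S \<in> sets S" if "X \<in> sets M_inf" for X
    using that by (rule measurable_sets)
  show "sets M_inf \<subseteq> sigma_sets (space M_inf) ?G"
  proof
    fix X assume X: "X \<in> sets M_inf"
    then have "(\<lambda>D. D) -` X \<inter> space S = X" using sets.sets_into_space by (auto simp: sS)
    then show "X \<in> sigma_sets (space M_inf) ?G" using m[OF X] by (simp add: sS)
  qed
  have "?G \<subseteq> sets M_inf" using M_inf_box_sets by auto
  from sets.sigma_sets_subset[OF this] show "sigma_sets (space M_inf) ?G \<subseteq> sets M_inf" .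
qed

lemma M_inf_measure_eqI:
  assumes "prob_space M" "prob_space N" and sets: "sets M = sets M_inf" "sets N = sets M_inf"
    and eq: "\<And>n a. measure M (M_inf_box n a) = measure N (M_inf_box n a)"
  shows "M = N"
proof -
  interpret M: prob_space M by fact
  interpret N: prob_space N by fact
  let ?G = "{M_inf_box n a | n a. True}"
  show ?thesis
  proof (rule measure_eqI_generator_eq[where E="?G" and \<Omega>="space M_inf" and A="\<lambda>_. space M_inf"])
    show "Int_stable ?G"
    proof (rule Int_stableI)
      fix u v assume "u \<in> ?G" "v \<in> ?G"
      then obtain n a n' a' where uv: "u = M_inf_box n a" "v = M_inf_box n' a'" by blast
      \<comment> \<open>Entries outside one of the boxes must stay unconstrained by it, hence the
        vacuous bound 1 there.\<close>
      define b where "b p = min (if snd p < n then a p else 1) (if snd p < n' then a' p else 1)" for p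
      have "u \<inter> v = M_inf_box (max n n') b"
        unfolding uv M_inf_box_def b_def by (fastforce simp: space_M_inf)
      then show "u \<inter> v \<in> ?G" by blast
    qed
    show "?G \<subseteq> Pow (space M_inf)" by (auto simp: M_inf_box_def)
    show "emeasure M X = emeasure N X" if XG: "X \<in> ?G" for X
    proof -
      obtain n a where "X = M_inf_box n a" using XG by blast
      then show ?thesis by (simp add: M.emeasure_eq_measure N.emeasure_eq_measure eq)
    qed
    show "sets M = sigma_sets (space M_inf) ?G" "sets N = sigma_sets (space M_inf) ?G"
      using sets sets_M_inf_generator by simp_all
    have "space M_inf = M_inf_box 0 (\<lambda>_. 0)" by (simp add: M_inf_box_def)
    then show "range (\<lambda>_ :: nat. space M_inf) \<subseteq> ?G" by blast
    show "emeasure M (space M_inf) \<noteq> \<infinity>" for i :: nat by simp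
  qed simp
qed

section \<open>Pulling samples back to the unit interval\<close>

lemma (in kernel_space) pullback_measurable:
  assumes \<Psi>: "\<Psi> \<in> lambda01 \<rightarrow>\<^sub>M \<mu>"
  shows "(\<lambda>s i. \<Psi> (s i)) \<in> PiM UNIV (\<lambda>_. lambda01) \<rightarrow>\<^sub>M PX"
proof (rule measurable_PiM_single')
  show "(\<lambda>s. \<Psi> (s i)) \<in> PiM UNIV (\<lambda>_. lambda01) \<rightarrow>\<^sub>M \<mu>" for i
    by (rule measurable_compose[OF _ \<Psi>], rule measurable_component_singleton) simp
  show "(\<lambda>s i. \<Psi> (s i)) \<in> space (PiM UNIV (\<lambda>_. lambda01)) \<rightarrow> (\<Pi>\<^sub>E i\<in>UNIV. space \<mu>)"
  proof
    fix s assume "s \<in> space (PiM (UNIV :: 'c set) (\<lambda>_. lambda01))"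
    then have "s \<in> (\<Pi>\<^sub>E i\<in>UNIV. space lambda01)" by (simp only: space_PiM)
    then have "s i \<in> space lambda01" for i by (rule PiE_mem) simp
    then show "(\<lambda>i. \<Psi> (s i)) \<in> (\<Pi>\<^sub>E i\<in>UNIV. space \<mu>)"
      using measurable_space[OF \<Psi>] by (simp only: PiE_UNIV_domain Pi_iff) simp
  qed
qed

lemma (in kernel_space) distr_PX:
  assumes "\<Psi> \<in> MPM \<mu>"
  shows "distr (PiM UNIV (\<lambda>_. lambda01)) PX (\<lambda>s i. \<Psi> (s i)) = PX"
proof -
  have \<Psi>: "\<Psi> \<in> lambda01 \<rightarrow>\<^sub>M \<mu>" "distr lambda01 \<mu> \<Psi> = \<mu>" using assms by (auto simp: MPM_def)
  interpret L: prob_space lambda01 by (rule prob_space_lambda01)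
  interpret PL: product_prob_space "\<lambda>_. lambda01" "UNIV :: nat set" ..
  have m: "(\<lambda>s i. \<Psi> (s i)) \<in> PiM UNIV (\<lambda>_. lambda01) \<rightarrow>\<^sub>M PX"
    by (rule pullback_measurable[OF \<Psi>(1)])
  show ?thesis
  proof (rule PX.PiM_eq)
    fix J :: "nat set" and F assume J: "finite J" and F: "\<And>j. j \<in> J \<Longrightarrow> F j \<in> sets \<mu>"
    have "emeasure (distr (PiM UNIV (\<lambda>_. lambda01)) PX (\<lambda>s i. \<Psi> (s i))) (prod_emb UNIV (\<lambda>_. \<mu>) J (Pi\<^sub>E J F)) =
      emeasure (PiM UNIV (\<lambda>_. lambda01)) ((\<lambda>s i. \<Psi> (s i)) -` prod_emb UNIV (\<lambda>_. \<mu>) J (Pi\<^sub>E J F) \<inter> space (PiM UNIV (\<lambda>_. lambda01)))"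
      using J F by (intro emeasure_distr m sets_PiM_I) auto
    also have "(\<lambda>s i. \<Psi> (s i)) -` prod_emb UNIV (\<lambda>_. \<mu>) J (Pi\<^sub>E J F) \<inter> space (PiM UNIV (\<lambda>_. lambda01)) =
      {s \<in> space (PiM UNIV (\<lambda>_. lambda01)). \<forall>j\<in>J. s j \<in> \<Psi> -` F j \<inter> space lambda01}"
      using measurable_space[OF \<Psi>(1)] by (auto simp: prod_emb_def space_PiM PiE_iff Pi_iff)
    also have "emeasure (PiM UNIV (\<lambda>_. lambda01)) \<dots> = (\<Prod>j\<in>J. emeasure lambda01 (\<Psi> -` F j \<inter> space lambda01))"
      using J measurable_sets[OF \<Psi>(1) F] by (intro PL.emeasure_PiM_Collect) auto
    also have "\<dots> = (\<Prod>j\<in>J. emeasure \<mu> (F j))"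
    proof (rule prod.cong[OF refl])
      fix j assume "j \<in> J"
      then show "emeasure lambda01 (\<Psi> -` F j \<inter> space lambda01) = emeasure \<mu> (F j)"
        using emeasure_distr[OF \<Psi>(1) F] \<Psi>(2) by simp
    qed
    finally show "emeasure (distr (PiM UNIV (\<lambda>_. lambda01)) PX (\<lambda>s i. \<Psi> (s i))) (prod_emb UNIV (\<lambda>_. \<mu>) J (Pi\<^sub>E J F)) =
      (\<Prod>j\<in>J. emeasure \<mu> (F j))" .
  qed simp
qed

section \<open>Box probabilities as limits of Lipschitz statistics\<close>

context kernel_space
begin

definition ramp_kernel :: "nat \<Rightarrow> real \<Rightarrow> 'a \<Rightarrow> 'a \<Rightarrow> real" where
  "ramp_kernel k a x y = (\<integral>r. ramp (real k) a r \<partial>d x y)"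

lemma ramp_kernel_measurable: "(\<lambda>(x, y). ramp_kernel k a x y) \<in> borel_measurable (square \<mu>)"
  using measurable_compose[OF measurable_prob_algebraD[OF measurable_kernel]
      integral_measurable_subprob_algebra[OF measurable_I01[OF borel_measurable_ramp[of "real k" a]]]]
  by (simp add: ramp_kernel_def split_def)

lemma ramp_kernel_bounds:
  assumes "x \<in> space \<mu>" "y \<in> space \<mu>"
  shows "0 \<le> ramp_kernel k a x y" "ramp_kernel k a x y \<le> 1"
proof -
  have p: "d x y \<in> space (prob_algebra I01)" using assms by (rule kernel_in)
  interpret Q: prob_space "d x y" using p by (rule P_I01D)
  show "0 \<le> ramp_kernel k a x y" unfolding ramp_kernel_def by (rule Bochner_Integration.integral_nonneg) (rule ramp_bounds)
  have "integrable (d x y) (ramp (real k) a)"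
    by (rule integrable_P_I01[OF p measurable_I01, where c=1])
      (use ramp_bounds[of "real k" a] in \<open>auto simp: abs_le_iff intro: order_trans[of _ 0]\<close>)
  then show "ramp_kernel k a x y \<le> 1"
    unfolding ramp_kernel_def by (rule Q.integral_le_const) (simp add: ramp_bounds)
qed

text \<open>By conditional independence this is the conditional mean, given the sample
  \<open>x\<close>, of a product of ramps of the matrix entries; it approximates the conditional
  probability of a box.\<close>

definition ramp_product :: "nat \<Rightarrow> nat \<Rightarrow> (nat \<times> nat \<Rightarrow> real) \<Rightarrow> (nat \<Rightarrow> 'a) \<Rightarrow> real" where
  "ramp_product k n a x = (\<Prod>p\<in>{(i, j). i < j \<and> j < n}. ramp_kernel k (a p) (x (fst p)) (x (snd p)))"

lemma finite_pairs: "finite {(i, j). i < j \<and> j < (n :: nat)}"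
  by (rule finite_subset[of _ "{..<n} \<times> {..<n}"]) auto

lemma ramp_kernel_entry_measurable: "(\<lambda>x. ramp_kernel k a (x i) (x j)) \<in> borel_measurable PX"
proof -
  have "(\<lambda>x. (x i, x j)) \<in> PX \<rightarrow>\<^sub>M square \<mu>" by measurable
  from measurable_compose[OF this ramp_kernel_measurable] show ?thesis by simp
qed

lemma ramp_product_measurable: "ramp_product k n a \<in> borel_measurable PX"
  unfolding ramp_product_def[abs_def] by (intro borel_measurable_prod ramp_kernel_entry_measurable)

lemma ramp_product_bounds:
  assumes "x \<in> space PX" shows "0 \<le> ramp_product k n a x" "ramp_product k n a x \<le> 1"
  unfolding ramp_product_def using ramp_kernel_bounds[OF space_PX_D[OF assms] space_PX_D[OF assms]]
  by (auto intro!: prod_nonneg prod_le_1)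

lemma measure_random_matrix_box:
  assumes x: "x \<in> space PX"
  shows "measure (random_matrix d x) (M_inf_box n a) =
    (\<Prod>p\<in>{(i, j). i < j \<and> j < n}. cdf01 (d (x (fst p)) (x (snd p))) (a p))"
proof -
  let ?J = "{(i, j). i < j \<and> j < n}"
  have J: "?J \<subseteq> {(i, j). i < j}" by auto
  have "measure (random_matrix d x) (M_inf_box n a) = (\<integral>D. indicator (M_inf_box n a) D \<partial>random_matrix d x)"
    using sets.sets_into_space[OF M_inf_box_sets[of n a]] by (simp add: space_random_matrix Int_absorb2)
  also have "\<dots> = (\<integral>D. (\<Prod>p\<in>?J. indicator {..a p} (D (fst p) (snd p))) \<partial>random_matrix d x)"
  proof (rule Bochner_Integration.integral_cong[OF refl])
    fix D assume "D \<in> space (random_matrix d x)"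
    then have D: "D \<in> space M_inf" by (simp add: space_random_matrix)
    show "indicator (M_inf_box n a) D = (\<Prod>p\<in>?J. indicator {..a p} (D (fst p) (snd p)) :: real)"
    proof (cases "D \<in> M_inf_box n a")
      case True
      then show ?thesis by (subst prod.neutral) (auto simp: M_inf_box_def)
    next
      case False
      then obtain i j where "i < j" "j < n" "\<not> D i j \<le> a (i, j)" using D by (auto simp: M_inf_box_def)
      then have "\<exists>p\<in>?J. indicator {..a p} (D (fst p) (snd p)) = (0 :: real)"
        by (intro bexI[of _ "(i, j)"]) auto
      from prod_zero[OF finite_pairs this] show ?thesis using False by simp
    qed
  qed
  also have "\<dots> = (\<Prod>p\<in>?J. \<integral>r. indicator {..a p} r \<partial>d (x (fst p)) (x (snd p)))"
    by (rule integral_random_matrix_prod[OF x finite_pairs J, where c=1]) auto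
  also have "\<dots> = (\<Prod>p\<in>?J. cdf01 (d (x (fst p)) (x (snd p))) (a p))"
  proof (rule prod.cong[OF refl])
    fix p
    have q: "d (x (fst p)) (x (snd p)) \<in> space (prob_algebra I01)" by (rule kernel_in_PX[OF x])
    have "(\<integral>r. indicator {..a p} r \<partial>d (x (fst p)) (x (snd p))) =
        (\<integral>r. indicat_real ({0..1} \<inter> {..a p}) r \<partial>d (x (fst p)) (x (snd p)))"
      by (rule Bochner_Integration.integral_cong) (auto simp: P_I01D[OF q] indicator_def)
    then show "(\<integral>r. indicator {..a p} r \<partial>d (x (fst p)) (x (snd p))) = cdf01 (d (x (fst p)) (x (snd p))) (a p)"
      by (simp add: cdf01_def P_I01D[OF q])
  qed
  finally show ?thesis .
qed

text \<open>\<open>d_ext\<close> does not control distribution functions, which may jump, but it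
  controls ramps of fixed slope. Two spaces are compared at fixed slope, and only then does the
  slope tend to infinity to recover the probabilities of boxes.\<close>

lemma tau_box_LIMSEQ: "(\<lambda>k. \<integral>x. ramp_product k n a x \<partial>PX) \<longlonglongrightarrow> measure (tau \<mu> d) (M_inf_box n a)"
proof -
  let ?J = "{(i, j). i < j \<and> j < n}"
  interpret T: prob_space "tau \<mu> d" by (rule prob_space_tau)
  define F where "F x = (\<Prod>p\<in>?J. W (a p) (x (fst p)) (x (snd p)))" for x
  have lim: "(\<lambda>k. ramp_product k n a x) \<longlonglongrightarrow> F x" if x: "x \<in> space PX" for x
    unfolding ramp_product_def F_def ramp_kernel_def by (intro tendsto_prod integral_ramp_LIMSEQ kernel_in_PX x)
  have Fm: "F \<in> borel_measurable PX"
    by (rule borel_measurable_LIMSEQ_real[OF lim ramp_product_measurable])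
  have F01: "0 \<le> F x" "F x \<le> 1" if x: "x \<in> space PX" for x
    unfolding F_def using cdf01_bounds[OF kernel_in_PX[OF x]] by (auto intro!: prod_nonneg prod_le_1)
  have "(\<lambda>k. \<integral>x. ramp_product k n a x \<partial>PX) \<longlonglongrightarrow> (\<integral>x. F x \<partial>PX)"
  proof (rule integral_dominated_convergence[where w="\<lambda>_. 1"])
    show "AE x in PX. norm (ramp_product k n a x) \<le> 1" for k
      using ramp_product_bounds by (intro AE_I2) auto
  qed (auto simp: Fm ramp_product_measurable lim)
  also have "(\<integral>x. F x \<partial>PX) = measure (tau \<mu> d) (M_inf_box n a)"
  proof -
    have "emeasure (tau \<mu> d) (M_inf_box n a) = (\<integral>\<^sup>+x. emeasure (random_matrix d x) (M_inf_box n a) \<partial>PX)"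
      by (rule emeasure_tau[OF M_inf_box_sets])
    also have "\<dots> = (\<integral>\<^sup>+x. ennreal (F x) \<partial>PX)"
    proof (rule nn_integral_cong)
      fix x assume x: "x \<in> space PX"
      interpret Rx: prob_space "random_matrix d x" using x by (rule prob_space_random_matrix)
      show "emeasure (random_matrix d x) (M_inf_box n a) = ennreal (F x)"
        unfolding F_def measure_random_matrix_box[OF x, symmetric] by (rule Rx.emeasure_eq_measure)
    qed
    also have "\<dots> = ennreal (\<integral>x. F x \<partial>PX)"
      using Fm F01 by (intro nn_integral_eq_integral PX.P.integrable_const_bound[where B=1]) auto
    finally show ?thesis
      using F01 by (simp add: measure_def Bochner_Integration.integral_nonneg)
  qed
  finally show ?thesis .
qed

lemma integral_ramp_product_pullback:
  assumes "\<Psi> \<in> MPM \<mu>"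
  shows "(\<integral>x. ramp_product k n a x \<partial>PX) = (\<integral>s. ramp_product k n a (\<lambda>i. \<Psi> (s i)) \<partial>PiM UNIV (\<lambda>_. lambda01))"
proof -
  have \<Psi>: "\<Psi> \<in> lambda01 \<rightarrow>\<^sub>M \<mu>" using assms by (auto simp: MPM_def)
  have m: "(\<lambda>s i. \<Psi> (s i)) \<in> PiM UNIV (\<lambda>_. lambda01) \<rightarrow>\<^sub>M PX"
    by (rule pullback_measurable[OF \<Psi>])
  show ?thesis
    using integral_distr[OF m ramp_product_measurable] distr_PX[OF assms] by simp
qed

end

section \<open>The reconstruction theorem\<close>

lemma qmm_coded:
  assumes "qmm_space \<mu> d"
  obtains e g where "coded_kernel \<mu> d e g"
proof -
  interpret qmm_space \<mu> d by fact
  obtain e g where eg: "e \<in> \<mu> \<rightarrow>\<^sub>M Bits" "g \<in> Bits \<rightarrow>\<^sub>M \<mu>" "\<And>x. x \<in> space \<mu> \<Longrightarrow> g (e x) = x"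
    using standard_borel_bits[OF standard_borel not_empty] by blast
  have "kernel_space \<mu> d"
  proof
    show "(\<lambda>(x, y). d x y) \<in> square \<mu> \<rightarrow>\<^sub>M prob_algebra I01"
      using measurable_compose[OF measurable_d P01_ident_measurable] by simp
  qed (rule d_sym)
  then have "coded_kernel \<mu> d e g"
    by (rule coded_kernel.intro) (intro coded_kernel_axioms.intro eg)
  then show thesis by (rule that)
qed

lemma (in coded_kernel) decode_MPM:
  assumes h: "h \<in> lambda01 \<rightarrow>\<^sub>M Bits" "distr lambda01 Bits h = K"
  shows "(\<lambda>s. g (h s)) \<in> MPM \<mu>"
proof -
  have "distr lambda01 \<mu> (\<lambda>s. g (h s)) = distr (distr lambda01 Bits h) \<mu> g"
    by (subst distr_distr[OF g h(1)]) (simp add: o_def)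
  also have "\<dots> = distr \<mu> \<mu> (g \<circ> e)"
    unfolding h(2) by (rule distr_distr[OF g e])
  also have "\<dots> = distr \<mu> \<mu> (\<lambda>x. x)"
    by (rule distr_cong) (auto simp: g_e)
  finally show ?thesis
    using measurable_compose[OF h(1) g] by (simp add: MPM_def distr_id2)
qed

text \<open>The law of the code is realized on the unit interval from its cylinder weights and then
  decoded. Nonemptiness matters since a real infimum over an empty index set carries no
  information.\<close>

lemma (in coded_kernel) MPM_nonempty: "MPM \<mu> \<noteq> {}"
proof -
  interpret K: bits_measure K by (rule bits_measure_K)
  define p where "p s = measure K {b. bits b (length s) = s}" for s
  have "p s = p (s @ [False]) + p (s @ [True])" for s
  proof -
    have "{b. bits b (length s) = s} = {b. bits b (Suc (length s)) = s @ [False]} \<union> {b. bits b (Suc (length s)) = s @ [True]}"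
      by (auto simp: prefix_Suc)
    also have "measure K \<dots> = p (s @ [False]) + p (s @ [True])"
      unfolding p_def length_append list.size add_0_right add_Suc_right One_nat_def
      by (intro K.finite_measure_Union K.cylinder_sets) auto
    finally show ?thesis by (simp add: p_def)
  qed
  moreover have "p [] = 1" using K.prob_space by (simp add: p_def bits_def)
  moreover have "0 \<le> p s" for s by (simp add: p_def)
  ultimately obtain \<Psi> where \<Psi>: "\<Psi> \<in> lambda01 \<rightarrow>\<^sub>M Bits"
    "\<And>s. measure lambda01 {t \<in> space lambda01. bits (\<Psi> t) (length s) = s} = p s"
    using bits_from_cylinders[of p] by blast
  have "distr lambda01 Bits \<Psi> = K"
  proof (rule bits_measure_eqI[OF _ bits_measure_K])
    show "bits_measure (distr lambda01 Bits \<Psi>)"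
      by (intro bits_measure.intro prob_space.prob_space_distr prob_space_lambda01 \<Psi> bits_measure_axioms.intro) simp
    fix s
    have "measure (distr lambda01 Bits \<Psi>) {b. bits b (length s) = s} =
        measure lambda01 (\<Psi> -` {b. bits b (length s) = s} \<inter> space lambda01)"
      using prefix_pred_sets[of "\<lambda>v. v = s"] by (intro measure_distr \<Psi>) simp
    also have "\<Psi> -` {b. bits b (length s) = s} \<inter> space lambda01 = {t \<in> space lambda01. bits (\<Psi> t) (length s) = s}"
      by auto
    finally show "measure (distr lambda01 Bits \<Psi>) {b. bits b (length s) = s} = measure K {b. bits b (length s) = s}"
      by (simp only: \<Psi>(2) p_def)
  qed
  from decode_MPM[OF \<Psi>(1) this] show ?thesis by blast
qed

text \<open>The even and odd bits of the coupling decode to the two maps. Agreement of the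
  distribution functions along an enumeration of the rationals holds outside one null set and forces
  equality of the laws there.\<close>

lemma tau_eq_imp_pullback_eq:
  assumes X: "coded_kernel \<mu> d e g" and Y: "coded_kernel \<nu> d' e' g'" and tau: "tau \<mu> d = tau \<nu> d'"
  shows "\<exists>\<Psi>\<^sub>1 \<in> MPM \<mu>. \<exists>\<Psi>\<^sub>2 \<in> MPM \<nu>.
    AE (s, t) in square lambda01. pullback \<Psi>\<^sub>1 d s t = pullback \<Psi>\<^sub>2 d' s t"
proof -
  interpret X: coded_kernel \<mu> d e g by fact
  interpret Y: coded_kernel \<nu> d' e' g' by fact
  define q where "q = from_nat_into (\<rat> :: real set)"
  have q: "range q = \<rat>" unfolding q_def
    by (rule range_from_nat_into) (use Rats_0 countable_rat in auto)
  obtain \<Psi> where \<Psi>: "\<Psi> \<in> lambda01 \<rightarrow>\<^sub>M Bits"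
    and dX: "distr lambda01 Bits (\<lambda>s. evens (\<Psi> s)) = X.K"
    and dY: "distr lambda01 Bits (\<lambda>s. odds (\<Psi> s)) = Y.K"
    and AE: "AE z in square lambda01. \<forall>a.
       X.coded_cdf (q a) (evens (\<Psi> (fst z)), evens (\<Psi> (snd z))) = Y.coded_cdf (q a) (odds (\<Psi> (fst z)), odds (\<Psi> (snd z)))"
    by (rule coupling_exists[OF X Y tau, of q]) (rule that)
  define \<Psi>1 where "\<Psi>1 s = g (evens (\<Psi> s))" for s
  define \<Psi>2 where "\<Psi>2 s = g' (odds (\<Psi> s))" for s
  have "\<Psi>1 \<in> MPM \<mu>" unfolding \<Psi>1_def[abs_def]
    by (rule X.decode_MPM[OF measurable_compose[OF \<Psi> evens_measurable] dX])
  moreover have "\<Psi>2 \<in> MPM \<nu>" unfolding \<Psi>2_def[abs_def]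
    by (rule Y.decode_MPM[OF measurable_compose[OF \<Psi> odds_measurable] dY])
  moreover have "AE (s, t) in square lambda01. pullback \<Psi>1 d s t = pullback \<Psi>2 d' s t"
    using AE
  proof (rule AE_mp, intro AE_I2 impI)
    fix z assume H: "\<forall>a. X.coded_cdf (q a) (evens (\<Psi> (fst z)), evens (\<Psi> (snd z))) =
        Y.coded_cdf (q a) (odds (\<Psi> (fst z)), odds (\<Psi> (snd z)))"
    have "d (\<Psi>1 (fst z)) (\<Psi>1 (snd z)) = d' (\<Psi>2 (fst z)) (\<Psi>2 (snd z))"
    proof (rule P_I01_eqI)
      show "d (\<Psi>1 (fst z)) (\<Psi>1 (snd z)) \<in> space (prob_algebra I01)"
        unfolding \<Psi>1_def by (intro X.kernel_in X.g_space)
      show "d' (\<Psi>2 (fst z)) (\<Psi>2 (snd z)) \<in> space (prob_algebra I01)"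
        unfolding \<Psi>2_def by (intro Y.kernel_in Y.g_space)
      fix r :: real assume "r \<in> \<rat>"
      then obtain a where "r = q a" using q by (metis imageE)
      then show "cdf01 (d (\<Psi>1 (fst z)) (\<Psi>1 (snd z))) r = cdf01 (d' (\<Psi>2 (fst z)) (\<Psi>2 (snd z))) r"
        using H[rule_format, of a] by (simp add: X.coded_cdf_def Y.coded_cdf_def \<Psi>1_def \<Psi>2_def)
    qed
    then show "case z of (s, t) \<Rightarrow> pullback \<Psi>1 d s t = pullback \<Psi>2 d' s t"
      by (simp add: pullback_def split_def)
  qed
  ultimately show ?thesis by blast
qed

section \<open>Vanishing box distance\<close>

lemma box1_set_nonempty:
  "{\<epsilon>. \<exists>E \<in> sets lambda01. measure lambda01 E \<le> \<epsilon> \<and>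
     (AE (x, y) in square lambda01. x \<notin> E \<and> y \<notin> E \<longrightarrow> d_ext (f x y) (g x y) \<le> \<epsilon>)} \<noteq> {}"
proof -
  have "1 \<in> {\<epsilon>. \<exists>E \<in> sets lambda01. measure lambda01 E \<le> \<epsilon> \<and>
     (AE (x, y) in square lambda01. x \<notin> E \<and> y \<notin> E \<longrightarrow> d_ext (f x y) (g x y) \<le> \<epsilon>)}"
  \<comment> \<open>With the whole interval as exceptional set, closeness is vacuous.\<close>
  proof (intro CollectI bexI[of _ "space lambda01"] conjI)
    show "measure lambda01 (space lambda01) \<le> 1"
      using prob_space.prob_space[OF prob_space_lambda01] by simp
    show "AE (x, y) in square lambda01. x \<notin> space lambda01 \<and> y \<notin> space lambda01 \<longrightarrow> d_ext (f x y) (g x y) \<le> 1"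
      by (intro AE_I2) (auto simp: space_pair_measure)
  qed (rule sets.top)
  then show ?thesis by blast
qed

lemma box1_nonneg: "0 \<le> box1 f g"
  unfolding box1_def
  by (rule cInf_greatest[OF box1_set_nonempty]) (auto intro: order_trans[OF measure_nonneg])

lemma box1_eq_0:
  assumes "AE (s, t) in square lambda01. f s t = g s t"
  shows "box1 f g = 0"
proof (rule antisym[OF _ box1_nonneg])
  have "AE (x, y) in square lambda01. x \<notin> {} \<and> y \<notin> {} \<longrightarrow> d_ext (f x y) (g x y) \<le> 0"
    using assms by (rule AE_mp) (intro AE_I2, auto simp: d_ext_self)
  then have "0 \<in> {\<epsilon>. \<exists>E \<in> sets lambda01. measure lambda01 E \<le> \<epsilon> \<and>
     (AE (x, y) in square lambda01. x \<notin> E \<and> y \<notin> E \<longrightarrow> d_ext (f x y) (g x y) \<le> \<epsilon>)}"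
    by (intro CollectI bexI[of _ "{}"] conjI) auto
  then show "box1 f g \<le> 0"
    unfolding box1_def
    by (rule cInf_lower) (rule bdd_belowI[of _ 0], auto intro: order_trans[OF measure_nonneg])
qed

lemma underline_box1_bdd:
  "bdd_below ((\<lambda>(\<Psi>\<^sub>1, \<Psi>\<^sub>2). box1 (pullback \<Psi>\<^sub>1 d) (pullback \<Psi>\<^sub>2 d')) ` (MPM \<mu> \<times> MPM \<nu>))"
  by (rule bdd_belowI[of _ 0]) (auto simp: box1_nonneg)

lemma pullback_eq_imp_underline_box1_0:
  assumes "\<Psi>\<^sub>1 \<in> MPM \<mu>" "\<Psi>\<^sub>2 \<in> MPM \<nu>"
    and "AE (s, t) in square lambda01. pullback \<Psi>\<^sub>1 d s t = pullback \<Psi>\<^sub>2 d' s t"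
  shows "underline_box1 \<mu> d \<nu> d' = 0"
proof (rule antisym)
  have "underline_box1 \<mu> d \<nu> d' \<le> (case (\<Psi>\<^sub>1, \<Psi>\<^sub>2) of (\<Psi>\<^sub>1, \<Psi>\<^sub>2) \<Rightarrow> box1 (pullback \<Psi>\<^sub>1 d) (pullback \<Psi>\<^sub>2 d'))"
    unfolding underline_box1_def using assms(1,2) by (intro cINF_lower underline_box1_bdd) auto
  then show "underline_box1 \<mu> d \<nu> d' \<le> 0" using box1_eq_0[OF assms(3)] by simp
  show "0 \<le> underline_box1 \<mu> d \<nu> d'"
    unfolding underline_box1_def using assms(1,2) by (intro cINF_greatest) (auto simp: box1_nonneg)
qed

lemma underline_box1_0_approx:
  assumes "MPM \<mu> \<noteq> {}" "MPM \<nu> \<noteq> {}" "underline_box1 \<mu> d \<nu> d' = 0" "0 < \<epsilon>"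
  obtains \<Psi>\<^sub>1 \<Psi>\<^sub>2 E where "\<Psi>\<^sub>1 \<in> MPM \<mu>" "\<Psi>\<^sub>2 \<in> MPM \<nu>" "E \<in> sets lambda01" "measure lambda01 E \<le> \<epsilon>"
    "AE z in square lambda01. fst z \<notin> E \<and> snd z \<notin> E \<longrightarrow>
      d_ext (d (\<Psi>\<^sub>1 (fst z)) (\<Psi>\<^sub>1 (snd z))) (d' (\<Psi>\<^sub>2 (fst z)) (\<Psi>\<^sub>2 (snd z))) \<le> \<epsilon>"
proof -
  have lt: "(INF (\<Psi>\<^sub>1, \<Psi>\<^sub>2) \<in> MPM \<mu> \<times> MPM \<nu>. box1 (pullback \<Psi>\<^sub>1 d) (pullback \<Psi>\<^sub>2 d')) < \<epsilon>"
    using assms(3,4) by (simp add: underline_box1_def)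
  have ne: "MPM \<mu> \<times> MPM \<nu> \<noteq> {}" using assms(1,2) by simp
  obtain z where z: "z \<in> MPM \<mu> \<times> MPM \<nu>"
    "(case z of (\<Psi>\<^sub>1, \<Psi>\<^sub>2) \<Rightarrow> box1 (pullback \<Psi>\<^sub>1 d) (pullback \<Psi>\<^sub>2 d')) < \<epsilon>"
    using iffD1[OF cINF_less_iff[OF ne underline_box1_bdd] lt] by (elim bexE)
  obtain \<Psi>1 \<Psi>2 where "z = (\<Psi>1, \<Psi>2)" by (cases z)
  with z have P: "\<Psi>1 \<in> MPM \<mu>" "\<Psi>2 \<in> MPM \<nu>" "box1 (pullback \<Psi>1 d) (pullback \<Psi>2 d') < \<epsilon>"
    by simp_all
  have "\<exists>\<delta>\<in>{\<delta>. \<exists>E \<in> sets lambda01. measure lambda01 E \<le> \<delta> \<and>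
     (AE (x, y) in square lambda01. x \<notin> E \<and> y \<notin> E \<longrightarrow> d_ext (pullback \<Psi>1 d x y) (pullback \<Psi>2 d' x y) \<le> \<delta>)}. \<delta> < \<epsilon>"
    using P(3) unfolding box1_def by (intro cInf_lessD[OF box1_set_nonempty])
  then obtain \<delta> E where E: "\<delta> < \<epsilon>" "E \<in> sets lambda01" "measure lambda01 E \<le> \<delta>"
    "AE (x, y) in square lambda01. x \<notin> E \<and> y \<notin> E \<longrightarrow> d_ext (pullback \<Psi>1 d x y) (pullback \<Psi>2 d' x y) \<le> \<delta>"
    by blast
  show thesis
  proof (rule that[OF P(1,2) E(2)])
    show "measure lambda01 E \<le> \<epsilon>" using E by simp
    show "AE z in square lambda01. fst z \<notin> E \<and> snd z \<notin> E \<longrightarrow>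
      d_ext (d (\<Psi>1 (fst z)) (\<Psi>1 (snd z))) (d' (\<Psi>2 (fst z)) (\<Psi>2 (snd z))) \<le> \<epsilon>"
      using E(4) by (rule AE_mp) (intro AE_I2, use E(1) in \<open>auto simp: pullback_def\<close>)
  qed
qed

text \<open>The factors lie in \<open>{0..1}\<close>, so the products differ by at most the sum of
  the differences of the factors. Such a difference is at most \<open>k * \<epsilon>\<close> almost
  everywhere off the exceptional set and at most 1 where one of the two coordinates lies in
  \<open>E\<close>, an event of probability at most \<open>2 * \<epsilon>\<close>; hence the
  contribution \<open>(k + 2) * \<epsilon>\<close> of each pair.\<close>

lemma ramp_product_integral_diff:
  fixes n k :: nat and \<epsilon> :: real
  assumes X: "kernel_space \<mu> d" and Y: "kernel_space \<nu> d'"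
    and \<Psi>: "\<Psi>1 \<in> MPM \<mu>" "\<Psi>2 \<in> MPM \<nu>" and E: "E \<in> sets lambda01" "measure lambda01 E \<le> \<epsilon>"
    and close: "AE z in square lambda01. fst z \<notin> E \<and> snd z \<notin> E \<longrightarrow>
      d_ext (d (\<Psi>1 (fst z)) (\<Psi>1 (snd z))) (d' (\<Psi>2 (fst z)) (\<Psi>2 (snd z))) \<le> \<epsilon>"
    and \<epsilon>: "0 < \<epsilon>"
  shows "\<bar>(\<integral>x. kernel_space.ramp_product d k n a x \<partial>PiM UNIV (\<lambda>_. \<mu>)) - (\<integral>y. kernel_space.ramp_product d' k n a y \<partial>PiM UNIV (\<lambda>_. \<nu>))\<bar>
    \<le> real (card {(i, j). i < j \<and> j < n}) * ((real k + 2) * \<epsilon>)"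
proof -
  interpret X: kernel_space \<mu> d by fact
  interpret Y: kernel_space \<nu> d' by fact
  interpret L: prob_space lambda01 by (rule prob_space_lambda01)
  interpret LL: pair_prob_space lambda01 lambda01 ..
  interpret PL: product_prob_space "\<lambda>_. lambda01" "UNIV :: nat set" ..
  let ?J = "{(i, j). i < j \<and> j < n}"
  let ?P = "PiM (UNIV :: nat set) (\<lambda>_. lambda01)"
  have m1: "\<Psi>1 \<in> lambda01 \<rightarrow>\<^sub>M \<mu>" and m2: "\<Psi>2 \<in> lambda01 \<rightarrow>\<^sub>M \<nu>" using \<Psi> by (auto simp: MPM_def)
  have s1: "\<Psi>1 s \<in> space \<mu>" and s2: "\<Psi>2 s \<in> space \<nu>" if "s \<in> space lambda01" for s
    using measurable_space[OF m1 that] measurable_space[OF m2 that] by auto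
  define h where "h b z = \<bar>X.ramp_kernel k b (\<Psi>1 (fst z)) (\<Psi>1 (snd z)) - Y.ramp_kernel k b (\<Psi>2 (fst z)) (\<Psi>2 (snd z))\<bar>" for b z
  have hm: "h b \<in> borel_measurable (square lambda01)" for b
  proof -
    have "(\<lambda>z. X.ramp_kernel k b (\<Psi>1 (fst z)) (\<Psi>1 (snd z))) \<in> borel_measurable (square lambda01)"
      using measurable_compose[OF L.square_measurable[OF m1] X.ramp_kernel_measurable] by simp
    moreover have "(\<lambda>z. Y.ramp_kernel k b (\<Psi>2 (fst z)) (\<Psi>2 (snd z))) \<in> borel_measurable (square lambda01)"
      using measurable_compose[OF L.square_measurable[OF m2] Y.ramp_kernel_measurable] by simp
    ultimately show ?thesis unfolding h_def[abs_def] by measurable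
  qed
  have hb: "h b z \<le> 1" if "fst z \<in> space lambda01" "snd z \<in> space lambda01" for b z
    using X.ramp_kernel_bounds[OF s1[OF that(1)] s1[OF that(2)], of k b] Y.ramp_kernel_bounds[OF s2[OF that(1)] s2[OF that(2)], of k b]
    unfolding h_def by linarith
  have hi: "integrable (square lambda01) (h b)" for b
    using hm hb by (intro LL.P.integrable_const_bound[where B=1] AE_I2) (auto simp: space_pair_measure h_def)
  have iE1: "integrable (square lambda01) (\<lambda>z. indicat_real E (fst z))"
    and iE2: "integrable (square lambda01) (\<lambda>z. indicat_real E (snd z))"
    using E(1) by (auto intro!: LL.P.integrable_const_bound[where B=1])
  have E1: "(\<integral>z. indicat_real E (fst z) \<partial>(square lambda01)) = measure lambda01 E"
  proof -
    have "(\<integral>z. indicat_real E (fst z) \<partial>(square lambda01)) = (\<integral>s. indicat_real E s \<partial>distr (square lambda01) lambda01 fst)"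
      using E(1) by (subst integral_distr) auto
    also have "\<dots> = measure lambda01 E"
      using L.distr_pair_fst[of lambda01] sets.sets_into_space[OF E(1)] by (simp add: Int_absorb2)
    finally show ?thesis .
  qed
  have E2: "(\<integral>z. indicat_real E (snd z) \<partial>(square lambda01)) = measure lambda01 E"
  proof -
    have "(\<integral>z. indicat_real E (snd z) \<partial>(square lambda01)) =
      (\<integral>z. indicat_real E (snd z) \<partial>distr (square lambda01) (square lambda01) (\<lambda>(x, y). (y, x)))"
      using LL.distr_pair_swap by simp
    also have "\<dots> = (\<integral>z. indicat_real E (fst z) \<partial>(square lambda01))"
      using E(1) by (subst integral_distr) (auto simp: split_def)
    finally show ?thesis using E1 by simp
  qed
  have hI: "(\<integral>z. h b z \<partial>(square lambda01)) \<le> (real k + 2) * \<epsilon>" for b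
  proof -
    have "(\<integral>z. h b z \<partial>(square lambda01)) \<le>
      (\<integral>z. real k * \<epsilon> + indicat_real E (fst z) + indicat_real E (snd z) \<partial>(square lambda01))"
    proof (rule integral_mono_AE)
      show "AE z in square lambda01. h b z \<le> real k * \<epsilon> + indicat_real E (fst z) + indicat_real E (snd z)"
        using close
      proof (rule AE_mp, intro AE_I2 impI)
        fix z assume z: "z \<in> space (square lambda01)"
          and cl: "fst z \<notin> E \<and> snd z \<notin> E \<longrightarrow>
            d_ext (d (\<Psi>1 (fst z)) (\<Psi>1 (snd z))) (d' (\<Psi>2 (fst z)) (\<Psi>2 (snd z))) \<le> \<epsilon>"
        have zs: "fst z \<in> space lambda01" "snd z \<in> space lambda01" using z by (auto simp: space_pair_measure)
        show "h b z \<le> real k * \<epsilon> + indicat_real E (fst z) + indicat_real E (snd z)"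
        proof (cases "fst z \<notin> E \<and> snd z \<notin> E")
          case True
          have "h b z \<le> real k * d_ext (d (\<Psi>1 (fst z)) (\<Psi>1 (snd z))) (d' (\<Psi>2 (fst z)) (\<Psi>2 (snd z)))"
            unfolding h_def X.ramp_kernel_def Y.ramp_kernel_def
            by (rule ramp_integral_diff) (intro X.kernel_in Y.kernel_in s1 s2 zs)+
          also have "\<dots> \<le> real k * \<epsilon>" using cl True by (intro mult_left_mono) auto
          finally show ?thesis using True by simp
        next
          case False
          have "0 \<le> real k * \<epsilon>" using \<epsilon> by simp
          then show ?thesis using hb[OF zs, of b] False by (auto simp: indicator_def)
        qed
      qed
    qed (use hi iE1 iE2 in auto)
    also have "\<dots> = real k * \<epsilon> + measure lambda01 E + measure lambda01 E"
      using iE1 iE2 E1 E2 LL.P.prob_space by simp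
    also have "\<dots> \<le> (real k + 2) * \<epsilon>" using E(2) by (simp add: algebra_simps)
    finally show ?thesis .
  qed
  define F1 where "F1 s = X.ramp_product k n a (\<lambda>i. \<Psi>1 (s i))" for s
  define F2 where "F2 s = Y.ramp_product k n a (\<lambda>i. \<Psi>2 (s i))" for s
  have pm1: "(\<lambda>s i. \<Psi>1 (s i)) \<in> ?P \<rightarrow>\<^sub>M X.PX" by (rule X.pullback_measurable[OF m1])
  have pm2: "(\<lambda>s i. \<Psi>2 (s i)) \<in> ?P \<rightarrow>\<^sub>M Y.PX" by (rule Y.pullback_measurable[OF m2])
  have F1i: "integrable ?P F1"
    using measurable_compose[OF pm1 X.ramp_product_measurable] X.ramp_product_bounds measurable_space[OF pm1]
    by (intro PL.P.integrable_const_bound[where B=1] AE_I2) (auto simp: F1_def[abs_def])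
  have F2i: "integrable ?P F2"
    using measurable_compose[OF pm2 Y.ramp_product_measurable] Y.ramp_product_bounds measurable_space[OF pm2]
    by (intro PL.P.integrable_const_bound[where B=1] AE_I2) (auto simp: F2_def[abs_def])
  have pr: "(\<lambda>s. (s i, s j)) \<in> ?P \<rightarrow>\<^sub>M square lambda01" for i j by measurable
  have dp: "distr ?P (square lambda01) (\<lambda>s. (s i, s j)) = square lambda01" if "i \<noteq> j" for i j
    using that by (rule L.distr_PiM_pair)
  have hpi: "integrable ?P (\<lambda>s. h b (s i, s j))" if "i \<noteq> j" for b i j
    using integrable_distr[OF pr[of i j], of "h b"] hi[of b] dp[OF that] by simp
  have hpI: "(\<integral>s. h b (s i, s j) \<partial>?P) \<le> (real k + 2) * \<epsilon>" if "i \<noteq> j" for b i j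
    using integral_distr[OF pr[of i j], of "h b"] hm[of b] hI[of b] dp[OF that] by simp
  have "\<bar>(\<integral>x. X.ramp_product k n a x \<partial>X.PX) - (\<integral>y. Y.ramp_product k n a y \<partial>Y.PX)\<bar> = \<bar>\<integral>s. F1 s - F2 s \<partial>?P\<bar>"
    unfolding X.integral_ramp_product_pullback[OF \<Psi>(1)] Y.integral_ramp_product_pullback[OF \<Psi>(2)]
      F1_def[symmetric] F2_def[symmetric]
    using F1i F2i by simp
  also have "\<dots> \<le> (\<integral>s. \<bar>F1 s - F2 s\<bar> \<partial>?P)" by (rule integral_abs_bound)
  also have "\<dots> \<le> (\<integral>s. (\<Sum>p\<in>?J. h (a p) (s (fst p), s (snd p))) \<partial>?P)"
  proof (rule integral_mono)
    show "integrable ?P (\<lambda>s. \<Sum>p\<in>?J. h (a p) (s (fst p), s (snd p)))"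
      by (intro Bochner_Integration.integrable_sum hpi) auto
    fix s assume s: "s \<in> space ?P"
    have x: "(\<lambda>i. \<Psi>1 (s i)) \<in> space X.PX" and y: "(\<lambda>i. \<Psi>2 (s i)) \<in> space Y.PX"
      using measurable_space[OF pm1 s] measurable_space[OF pm2 s] by auto
    have "norm (F1 s - F2 s) \<le> (\<Sum>p\<in>?J. norm (X.ramp_kernel k (a p) (\<Psi>1 (s (fst p))) (\<Psi>1 (s (snd p))) -
        Y.ramp_kernel k (a p) (\<Psi>2 (s (fst p))) (\<Psi>2 (s (snd p)))))"
      unfolding F1_def F2_def X.ramp_product_def Y.ramp_product_def
      using X.ramp_kernel_bounds[OF X.space_PX_D[OF x] X.space_PX_D[OF x]] Y.ramp_kernel_bounds[OF Y.space_PX_D[OF y] Y.space_PX_D[OF y]]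
      by (intro norm_prod_diff) auto
    then show "\<bar>F1 s - F2 s\<bar> \<le> (\<Sum>p\<in>?J. h (a p) (s (fst p), s (snd p)))"
      by (simp add: h_def)
  qed (use F1i F2i in auto)
  also have "\<dots> = (\<Sum>p\<in>?J. \<integral>s. h (a p) (s (fst p), s (snd p)) \<partial>?P)"
    by (intro Bochner_Integration.integral_sum hpi) auto
  also have "\<dots> \<le> (\<Sum>p\<in>?J. (real k + 2) * \<epsilon>)"
    by (intro sum_mono hpI) auto
  finally show ?thesis by simp
qed

text \<open>The maps may change with \<open>\<epsilon>\<close>, but the integrals compared depend on
  the two spaces alone; being arbitrarily close for fixed \<open>k\<close> and \<open>n\<close>,
  they coincide.\<close>

lemma underline_box1_0_imp_tau_eq:
  assumes X: "kernel_space \<mu> d" and Y: "kernel_space \<nu> d'"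
    and ne: "MPM \<mu> \<noteq> {}" "MPM \<nu> \<noteq> {}" and box: "underline_box1 \<mu> d \<nu> d' = 0"
  shows "tau \<mu> d = tau \<nu> d'"
proof -
  interpret X: kernel_space \<mu> d by fact
  interpret Y: kernel_space \<nu> d' by fact
  have eq: "(\<integral>x. X.ramp_product k n a x \<partial>X.PX) = (\<integral>y. Y.ramp_product k n a y \<partial>Y.PX)" for k n a
  proof (rule ccontr)
    let ?\<Delta> = "\<bar>(\<integral>x. X.ramp_product k n a x \<partial>X.PX) - (\<integral>y. Y.ramp_product k n a y \<partial>Y.PX)\<bar>"
    \<comment> \<open>The summand 1 makes \<open>?c\<close> positive even when there are no pairs,
      and it produces the strict inequality below.\<close>
    let ?c = "real (card {(i, j). i < j \<and> j < n}) * (real k + 2) + 1"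
    assume "(\<integral>x. X.ramp_product k n a x \<partial>X.PX) \<noteq> (\<integral>y. Y.ramp_product k n a y \<partial>Y.PX)"
    then have \<Delta>: "0 < ?\<Delta>" by simp
    have c: "0 < ?c" by (intro add_nonneg_pos mult_nonneg_nonneg) auto
    define \<epsilon> where "\<epsilon> = ?\<Delta> / ?c"
    have \<epsilon>: "0 < \<epsilon>" unfolding \<epsilon>_def by (rule divide_pos_pos[OF \<Delta> c])
    obtain \<Psi>1 \<Psi>2 E where P: "\<Psi>1 \<in> MPM \<mu>" "\<Psi>2 \<in> MPM \<nu>" "E \<in> sets lambda01" "measure lambda01 E \<le> \<epsilon>"
      "AE z in square lambda01. fst z \<notin> E \<and> snd z \<notin> E \<longrightarrow>
        d_ext (d (\<Psi>1 (fst z)) (\<Psi>1 (snd z))) (d' (\<Psi>2 (fst z)) (\<Psi>2 (snd z))) \<le> \<epsilon>"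
      using underline_box1_0_approx[OF ne box \<epsilon>] by blast
    have "?\<Delta> \<le> (?c - 1) * \<epsilon>"
      using ramp_product_integral_diff[OF X Y P \<epsilon>, of k n a] by (simp add: mult.assoc)
    also have "\<dots> < ?c * \<epsilon>" using \<epsilon> by (intro mult_strict_right_mono) auto
    also have "\<dots> = ?\<Delta>" using c by (simp add: \<epsilon>_def)
    finally show False by simp
  qed
  show ?thesis
  proof (rule M_inf_measure_eqI[OF X.prob_space_tau Y.prob_space_tau X.sets_tau Y.sets_tau])
    show "measure (tau \<mu> d) (M_inf_box n a) = measure (tau \<nu> d') (M_inf_box n a)" for n a
      using LIMSEQ_unique[OF X.tau_box_LIMSEQ] Y.tau_box_LIMSEQ by (simp add: eq)
  qed
qed

theorem theorem2:
  fixes \<mu>\<^sub>X :: "'a measure" and d\<^sub>X :: "'a \<Rightarrow> 'a \<Rightarrow> real measure"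
    and \<mu>\<^sub>Y :: "'b measure" and d\<^sub>Y :: "'b \<Rightarrow> 'b \<Rightarrow> real measure"
  assumes "qmm_space \<mu>\<^sub>X d\<^sub>X" and "qmm_space \<mu>\<^sub>Y d\<^sub>Y"
  shows "(tau \<mu>\<^sub>X d\<^sub>X = tau \<mu>\<^sub>Y d\<^sub>Y \<longleftrightarrow> underline_box1 \<mu>\<^sub>X d\<^sub>X \<mu>\<^sub>Y d\<^sub>Y = 0) \<and>
    (tau \<mu>\<^sub>X d\<^sub>X = tau \<mu>\<^sub>Y d\<^sub>Y \<longrightarrow>
      (\<exists>\<Psi>\<^sub>1 \<in> MPM \<mu>\<^sub>X. \<exists>\<Psi>\<^sub>2 \<in> MPM \<mu>\<^sub>Y.
        AE (s, t) in lambda01 \<Otimes>\<^sub>M lambda01. pullback \<Psi>\<^sub>1 d\<^sub>X s t = pullback \<Psi>\<^sub>2 d\<^sub>Y s t))"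
proof -
  obtain e g where X: "coded_kernel \<mu>\<^sub>X d\<^sub>X e g" using qmm_coded[OF assms(1)] .
  obtain e' g' where Y: "coded_kernel \<mu>\<^sub>Y d\<^sub>Y e' g'" using qmm_coded[OF assms(2)] .
  interpret X: coded_kernel \<mu>\<^sub>X d\<^sub>X e g by (rule X)
  interpret Y: coded_kernel \<mu>\<^sub>Y d\<^sub>Y e' g' by (rule Y)
  note pull = tau_eq_imp_pullback_eq[OF X Y]
  have "underline_box1 \<mu>\<^sub>X d\<^sub>X \<mu>\<^sub>Y d\<^sub>Y = 0" if "tau \<mu>\<^sub>X d\<^sub>X = tau \<mu>\<^sub>Y d\<^sub>Y"
    using pull[OF that] by (auto intro: pullback_eq_imp_underline_box1_0)
  moreover have "tau \<mu>\<^sub>X d\<^sub>X = tau \<mu>\<^sub>Y d\<^sub>Y" if "underline_box1 \<mu>\<^sub>X d\<^sub>X \<mu>\<^sub>Y d\<^sub>Y = 0"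
    using underline_box1_0_imp_tau_eq[OF X.kernel_space_axioms Y.kernel_space_axioms
        X.MPM_nonempty Y.MPM_nonempty that] .
  ultimately show ?thesis using pull by blast
qed

end
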